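(* Let $M$ be compact and connected, let $u_0\in L^2(M)$, and let $u$ be the solution of $$u_t-Lu=0\ \text{ in }M\times(0,\infty),\qquad u(x,0)=u_0(x)\ \text{ in }M.$$ Then, for all $t\ge0$, $$\|u(\cdot,t)-\langle u_0\rangle\|_{L^2(M)}\le e^{-\lambda_1t}\|u_0\|_{L^2(M)},$$ where $\langle u_0\rangle=\frac1{\mu(M)}\int_M u_0\,d\mu$ is the mean value of $u_0$ on $M$ and $\lambda_1>0$ is the first nonzero eigenvalue of $-L$.
   Context: $M$ is an $N$-dimensional Riemannian manifold without boundary, $O\in M$ is a fixed point, and there is a family of isometries $\tau_x:M\to M$, $x\in M$, with $\tau_x(x)=O$. $\mu$ is a measure on $M$ invariant under all the isometries $\tau_x$, and $L^p(M)=L^p(M,\mu)$. $s_{xy}$ denotes the geodesic distance. $J:\mathbb{R}_{\ge0}\to\mathbb{R}_{\ge0}$ is normalized by $\int_M J(s_{xO})\,d\mu_x=1$, is Lipschitz, and satisfies $J(s)>0$ for $0\le s<s_0$ for a certain $s_0>0$. The operator $L$, considered in $L^2(M)$, is $$Lu(x)=\int_M J(s_{xy})u(y)\,d\mu_y-u(x).$$ The solution $u$ is the unique one in $C([0,\infty);L^1(M))$, equivalently satisfying $u(x,t)=e^{-t}u_0(x)+\int_0^t\int_M e^{-(t-r)}J(s_{xy})u(y,r)\,d\mu_y\,dr$. The eigenvalues of $-L$ on $L^2(M)$ are nonnegative and $0$ is a simple eigenvalue (with constant eigenfunctions); $\lambda_1$ is the smallest nonzero one. *)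

theory Defs
  imports "HOL-Analysis.Analysis"
begin

section \<open>Smooth manifolds without boundary\<close>

text \<open>The point set of the manifold is a whole type, carrying a Hausdorff and second countable
  topology, and an atlas is a set of pairs of a chart domain and a coordinate map into
  \<open>real ^ 'n\<close>. The dimension is therefore \<open>CARD('n)\<close>, which is at least 1. Coordinate maps are
  total functions whose values outside the chart domain are irrelevant.\<close>

type_synonym ('a, 'n) chart = "'a set \<times> ('a \<Rightarrow> real ^ 'n)"

text \<open>\<open>Ck_on k S f\<close> is meant for open \<open>S\<close>: all iterated directional derivatives of \<open>f\<close> up to order
  \<open>k\<close> exist on \<open>S\<close>, as Frechet derivatives, and are continuous there.\<close>

fun Ck_on :: "nat \<Rightarrow> 'a::real_normed_vector set \<Rightarrow> ('a \<Rightarrow> 'b::real_normed_vector) \<Rightarrow> bool" where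
  "Ck_on 0 S f \<longleftrightarrow> continuous_on S f"
| "Ck_on (Suc k) S f \<longleftrightarrow>
     (\<forall>x\<in>S. f differentiable (at x)) \<and> (\<forall>v. Ck_on k S (\<lambda>x. frechet_derivative f (at x) v))"

definition smooth_on :: "'a::real_normed_vector set \<Rightarrow> ('a \<Rightarrow> 'b::real_normed_vector) \<Rightarrow> bool" where
  "smooth_on S f \<longleftrightarrow> (\<forall>k. Ck_on k S f)"

definition smooth_atlas ::
    "('a::{t2_space, second_countable_topology}, 'n::finite) chart set \<Rightarrow> bool" where
  "smooth_atlas A \<longleftrightarrow>
     (\<Union>(U, \<phi>)\<in>A. U) = UNIV \<and>
     (\<forall>(U, \<phi>)\<in>A. open U \<and> open (\<phi> ` U) \<and> homeomorphism U (\<phi> ` U) \<phi> (inv_into U \<phi>)) \<and>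
     (\<forall>(U, \<phi>)\<in>A. \<forall>(V, \<psi>)\<in>A. smooth_on (\<phi> ` (U \<inter> V)) (\<psi> \<circ> inv_into U \<phi>))"

definition smooth_map :: "('a::topological_space, 'n::finite) chart set \<Rightarrow> ('a \<Rightarrow> 'a) \<Rightarrow> bool" where
  "smooth_map A f \<longleftrightarrow>
     continuous_on UNIV f \<and>
     (\<forall>(U, \<phi>)\<in>A. \<forall>(V, \<psi>)\<in>A. smooth_on (\<phi> ` (U \<inter> f -` V)) (\<psi> \<circ> f \<circ> inv_into U \<phi>))"


section \<open>Riemannian metrics, geodesic distance, isometries\<close>

text \<open>A metric \<open>g\<close> is given in coordinates: \<open>g c p v w\<close> is the inner product at \<open>p\<close> of the two
  tangent vectors whose coordinates in the chart \<open>c\<close> are \<open>v\<close> and \<open>w\<close>. The last condition is the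
  transformation law of a covariant 2-tensor.\<close>

definition riemannian_manifold ::
    "('a::{t2_space, second_countable_topology}, 'n::finite) chart set \<Rightarrow>
     (('a, 'n) chart \<Rightarrow> 'a \<Rightarrow> real ^ 'n \<Rightarrow> real ^ 'n \<Rightarrow> real) \<Rightarrow> bool" where
  "riemannian_manifold A g \<longleftrightarrow>
     smooth_atlas A \<and>
     (\<forall>(U, \<phi>)\<in>A. \<forall>p\<in>U.
        bilinear (g (U, \<phi>) p) \<and>
        (\<forall>v w. g (U, \<phi>) p v w = g (U, \<phi>) p w v) \<and>
        (\<forall>v. v \<noteq> 0 \<longrightarrow> 0 < g (U, \<phi>) p v v)) \<and>
     (\<forall>(U, \<phi>)\<in>A. \<forall>v w. smooth_on (\<phi> ` U) (\<lambda>z. g (U, \<phi>) (inv_into U \<phi> z) v w)) \<and>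
     (\<forall>(U, \<phi>)\<in>A. \<forall>(V, \<psi>)\<in>A. \<forall>p\<in>U \<inter> V. \<forall>v w.
        let D = frechet_derivative (\<psi> \<circ> inv_into U \<phi>) (at (\<phi> p))
        in g (V, \<psi>) p (D v) (D w) = g (U, \<phi>) p v w)"

text \<open>At the end points of a segment the derivatives are one-sided.\<close>

definition C1_curve_on ::
    "('a::topological_space, 'n::finite) chart set \<Rightarrow> (real \<Rightarrow> 'a) \<Rightarrow> real set \<Rightarrow> bool" where
  "C1_curve_on A \<gamma> S \<longleftrightarrow>
     continuous_on S \<gamma> \<and>
     (\<forall>(U, \<phi>)\<in>A. \<exists>D. continuous_on (S \<inter> \<gamma> -` U) D \<and>
        (\<forall>t\<in>S \<inter> \<gamma> -` U. ((\<phi> \<circ> \<gamma>) has_vector_derivative D t) (at t within S)))"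

definition piecewise_C1_curve ::
    "('a::topological_space, 'n::finite) chart set \<Rightarrow> (real \<Rightarrow> 'a) \<Rightarrow> bool" where
  "piecewise_C1_curve A \<gamma> \<longleftrightarrow>
     continuous_on {0..1} \<gamma> \<and>
     (\<exists>T. finite T \<and>
        (\<forall>a b. 0 \<le> a \<and> a < b \<and> b \<le> 1 \<and> {a<..<b} \<inter> T = {} \<longrightarrow> C1_curve_on A \<gamma> {a..b}))"

text \<open>By the transformation law the speed does not depend on the chart that is chosen. Its values
  at the finitely many break points are arbitrary and do not affect the length.\<close>

definition curve_speed ::
    "('a, 'n::finite) chart set \<Rightarrow> (('a, 'n) chart \<Rightarrow> 'a \<Rightarrow> real ^ 'n \<Rightarrow> real ^ 'n \<Rightarrow> real) \<Rightarrow>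
     (real \<Rightarrow> 'a) \<Rightarrow> real \<Rightarrow> real" where
  "curve_speed A g \<gamma> t =
     (let c = (SOME c. c \<in> A \<and> \<gamma> t \<in> fst c);
          v = vector_derivative (snd c \<circ> \<gamma>) (at t)
      in sqrt (g c (\<gamma> t) v v))"

definition curve_length ::
    "('a, 'n::finite) chart set \<Rightarrow> (('a, 'n) chart \<Rightarrow> 'a \<Rightarrow> real ^ 'n \<Rightarrow> real ^ 'n \<Rightarrow> real) \<Rightarrow>
     (real \<Rightarrow> 'a) \<Rightarrow> real" where
  "curve_length A g \<gamma> = integral {0..1} (curve_speed A g \<gamma>)"

text \<open>Meaningful for connected manifolds only: there the set of lengths is nonempty.\<close>

definition geodesic_dist ::
    "('a::topological_space, 'n::finite) chart set \<Rightarrow>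
     (('a, 'n) chart \<Rightarrow> 'a \<Rightarrow> real ^ 'n \<Rightarrow> real ^ 'n \<Rightarrow> real) \<Rightarrow> 'a \<Rightarrow> 'a \<Rightarrow> real" where
  "geodesic_dist A g x y =
     Inf {curve_length A g \<gamma> | \<gamma>. piecewise_C1_curve A \<gamma> \<and> \<gamma> 0 = x \<and> \<gamma> 1 = y}"

text \<open>A diffeomorphism that pulls the metric back to itself.\<close>

definition riemannian_isometry ::
    "('a::topological_space, 'n::finite) chart set \<Rightarrow>
     (('a, 'n) chart \<Rightarrow> 'a \<Rightarrow> real ^ 'n \<Rightarrow> real ^ 'n \<Rightarrow> real) \<Rightarrow> ('a \<Rightarrow> 'a) \<Rightarrow> bool" where
  "riemannian_isometry A g f \<longleftrightarrow>
     bij f \<and> smooth_map A f \<and> smooth_map A (inv f) \<and>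
     (\<forall>(U, \<phi>)\<in>A. \<forall>(V, \<psi>)\<in>A. \<forall>p\<in>U \<inter> f -` V. \<forall>v w.
        let D = frechet_derivative (\<psi> \<circ> f \<circ> inv_into U \<phi>) (at (\<phi> p))
        in g (V, \<psi>) (f p) (D v) (D w) = g (U, \<phi>) p v w)"


section \<open>Lebesgue spaces and the nonlocal operator\<close>

text \<open>Elements of the Lebesgue spaces are represented by functions; equality in these spaces is
  equality almost everywhere.\<close>

definition in_L2 :: "'a measure \<Rightarrow> ('a \<Rightarrow> real) \<Rightarrow> bool" where
  "in_L2 \<mu> f \<longleftrightarrow> f \<in> borel_measurable \<mu> \<and> integrable \<mu> (\<lambda>x. (f x)\<^sup>2)"

definition L2_norm :: "'a measure \<Rightarrow> ('a \<Rightarrow> real) \<Rightarrow> real" where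
  "L2_norm \<mu> f = sqrt (\<integral>x. (f x)\<^sup>2 \<partial>\<mu>)"

definition L1_norm :: "'a measure \<Rightarrow> ('a \<Rightarrow> real) \<Rightarrow> real" where
  "L1_norm \<mu> f = (\<integral>x. \<bar>f x\<bar> \<partial>\<mu>)"

definition mean_value :: "'a measure \<Rightarrow> ('a \<Rightarrow> real) \<Rightarrow> real" where
  "mean_value \<mu> f = (\<integral>x. f x \<partial>\<mu>) / measure \<mu> (space \<mu>)"

text \<open>\<open>s\<close> is the distance function.\<close>

definition nonlocal_op ::
    "'a measure \<Rightarrow> ('a \<Rightarrow> 'a \<Rightarrow> real) \<Rightarrow> (real \<Rightarrow> real) \<Rightarrow> ('a \<Rightarrow> real) \<Rightarrow> 'a \<Rightarrow> real" where
  "nonlocal_op \<mu> s J u x = (\<integral>y. J (s x y) * u y \<partial>\<mu>) - u x"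

text \<open>Eigenvalues of minus the operator \<open>L\<close> on the real space \<open>L\<^sup>2\<close>.\<close>

definition L2_eigenvalue_minus ::
    "'a measure \<Rightarrow> (('a \<Rightarrow> real) \<Rightarrow> 'a \<Rightarrow> real) \<Rightarrow> real \<Rightarrow> bool" where
  "L2_eigenvalue_minus \<mu> L c \<longleftrightarrow>
     (\<exists>u. in_L2 \<mu> u \<and> \<not> (AE x in \<mu>. u x = 0) \<and> (AE x in \<mu>. - L u x = c * u x))"

definition first_nonzero_eigenvalue ::
    "'a measure \<Rightarrow> (('a \<Rightarrow> real) \<Rightarrow> 'a \<Rightarrow> real) \<Rightarrow> real \<Rightarrow> bool" where
  "first_nonzero_eigenvalue \<mu> L c \<longleftrightarrow>
     L2_eigenvalue_minus \<mu> L c \<and> c \<noteq> 0 \<and>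
     (\<forall>d. L2_eigenvalue_minus \<mu> L d \<and> d \<noteq> 0 \<longrightarrow> c \<le> d)"

text \<open>Solutions in \<open>C([0,\<infinity>); L\<^sup>1)\<close> of the Cauchy problem \<open>u\<^sub>t - L u = 0\<close>, with \<open>u t\<close> the state at
  time \<open>t\<close>; the time derivative is that of the \<open>L\<^sup>1\<close>-valued curve. Values at negative times are
  irrelevant.\<close>

definition cauchy_solution ::
    "'a measure \<Rightarrow> (('a \<Rightarrow> real) \<Rightarrow> 'a \<Rightarrow> real) \<Rightarrow> ('a \<Rightarrow> real) \<Rightarrow> (real \<Rightarrow> 'a \<Rightarrow> real) \<Rightarrow> bool" where
  "cauchy_solution \<mu> L u0 u \<longleftrightarrow>
     (\<forall>t\<ge>0. integrable \<mu> (u t)) \<and>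
     (\<forall>t\<ge>0. ((\<lambda>r. L1_norm \<mu> (\<lambda>x. u r x - u t x)) \<longlongrightarrow> 0) (at t within {0..})) \<and>
     (\<forall>t>0. ((\<lambda>r. L1_norm \<mu> (\<lambda>x. (u r x - u t x) / (r - t) - L (u t) x)) \<longlongrightarrow> 0) (at t)) \<and>
     (AE x in \<mu>. u 0 x = u0 x)"

end

(* The nonlocal operator is L = K - 1, where K has the continuous, symmetric, stochastic kernel
   J (s x y). Invariance under the isometries gives the rows of the kernel the same integral, and
   together with compactness it makes the measure finite and positive on open sets. By the maximum
   principle and connectedness the harmonic functions of K are the constants. On mean zero
   functions the supremum of the spectrum of the compact operator K is an eigenvalue unless it is 0;
   hence the quadratic form of K is at most 1 - lam1 there, where 1 - lam1 < 0 is dealt with by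
   splitting off eigenvectors. The decay then follows from Gronwall's inequality for the energy of
   exp t * (u t - mean), which equals its initial value plus a bounded function. *)

theory Submission
  imports Defs "HOL-Complex_Analysis.Great_Picard"
begin

section \<open>Curves in a manifold\<close>

text \<open>The analysis uses only that the geodesic distance is nonnegative, zero on the diagonal,
  symmetric, continuous for the manifold topology and preserved by isometries. A non-integrable
  speed gives a curve the default length 0, so every statement about lengths has to survive that
  value. Two obstacles shape the rest. First, \<open>first_nonzero_eigenvalue\<close> speaks of
  eigenvalues only, while 0 may be the supremum of the spectrum of K on mean zero functions without
  being an eigenvalue. If 1 - lam1 is negative, all eigenvalues of K other than 1 lie below a
  negative number, so the Hilbert-Schmidt norm has room for finitely many of them, and 0 is excluded
  because it would give lam1 \<le> 1; hence nothing is left once they are split off. Second, the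
  solution is a curve in L1 but the energy lives in L2. The factor exp t cancels the term -u, so w =
  exp t * (u - mean) satisfies w' = K w, and K maps L1 into continuous functions: the increment of w
  is an integral that makes sense at every point. The squared norm of w grows at rate at most 2 * (1
  - lam1), and undoing the factor subtracts 2.\<close>

lemma smooth_on_differentiable:
  assumes "smooth_on W h" "z \<in> W"
  shows "h differentiable (at z)"
proof -
  have "Ck_on (Suc 0) W h" using assms(1) unfolding smooth_on_def by (rule allE)
  then show ?thesis using assms(2) by simp
qed

lemma smooth_on_continuous_on:
  assumes "smooth_on W h"
  shows "continuous_on W h"
proof -
  have "Ck_on 0 W h" using assms unfolding smooth_on_def by (rule allE)
  then show ?thesis by simp
qed

lemma smooth_on_chain:
  fixes h :: "'b::real_normed_vector \<Rightarrow> 'c::real_normed_vector"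
  assumes "smooth_on W h" "c t \<in> W" "(c has_vector_derivative v) (at t within S)"
  shows "((h \<circ> c) has_vector_derivative frechet_derivative h (at (c t)) v) (at t within S)"
proof -
  have "(h has_derivative frechet_derivative h (at (c t))) (at (c t))"
    using smooth_on_differentiable[OF assms(1,2)] by (simp add: frechet_derivative_works)
  then show ?thesis
    using vector_derivative_diff_chain_within[OF assms(3)] has_derivative_at_withinI by blast
qed

text \<open>\<open>smooth_on\<close> gives continuity of the derivative only in each fixed
  direction. Expanding \<open>D t\<close> in the basis replaces the moving direction by finitely
  many fixed ones with continuous coefficients.\<close>

lemma smooth_on_chain_continuous:
  fixes h :: "'b::euclidean_space \<Rightarrow> 'c::real_normed_vector"
  assumes h: "smooth_on W h" and c: "continuous_on X c" "c ` X \<subseteq> W" and D: "continuous_on X D"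
  shows "continuous_on X (\<lambda>t. frechet_derivative h (at (c t)) (D t))"
proof -
  have eq: "frechet_derivative h (at (c t)) (D t)
      = (\<Sum>b\<in>Basis. (D t \<bullet> b) *\<^sub>R frechet_derivative h (at (c t)) b)" if "t \<in> X" for t
  proof -
    have lin: "linear (frechet_derivative h (at (c t)))"
      using smooth_on_differentiable[OF h] c(2) that by (intro linear_frechet_derivative) auto
    have "frechet_derivative h (at (c t)) (D t)
        = frechet_derivative h (at (c t)) (\<Sum>b\<in>Basis. (D t \<bullet> b) *\<^sub>R b)"
      by (simp add: euclidean_representation)
    also have "\<dots> = (\<Sum>b\<in>Basis. (D t \<bullet> b) *\<^sub>R frechet_derivative h (at (c t)) b)"
      by (simp add: linear_sum[OF lin] linear_scale[OF lin])
    finally show ?thesis .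
  qed
  have "continuous_on W (\<lambda>z. frechet_derivative h (at z) b)" for b
    using h[unfolded smooth_on_def, THEN spec, of "Suc 0"] by simp
  then have "continuous_on X (\<lambda>t. frechet_derivative h (at (c t)) b)" for b
    using continuous_on_compose2[OF _ c(1) c(2)] by blast
  then have "continuous_on X (\<lambda>t. \<Sum>b\<in>Basis. (D t \<bullet> b) *\<^sub>R frechet_derivative h (at (c t)) b)"
    by (intro continuous_intros D)
  then show ?thesis
    using eq by (simp cong: continuous_on_cong)
qed

lemma C1_curve_on_cong:
  assumes "\<And>t. t \<in> S \<Longrightarrow> \<gamma> t = \<eta> t" "C1_curve_on A \<gamma> S"
  shows "C1_curve_on A \<eta> S"
  unfolding C1_curve_on_def
proof (intro conjI ballI, safe)
  show "continuous_on S \<eta>"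
    using assms by (simp add: C1_curve_on_def cong: continuous_on_cong)
  fix U \<phi> assume "(U, \<phi>) \<in> A"
  then obtain D where D: "continuous_on (S \<inter> \<gamma> -` U) D"
    "\<And>t. t\<in>S \<inter> \<gamma> -` U \<Longrightarrow> ((\<phi> \<circ> \<gamma>) has_vector_derivative D t) (at t within S)"
    using assms(2) unfolding C1_curve_on_def by blast
  have "S \<inter> \<eta> -` U = S \<inter> \<gamma> -` U" using assms(1) by auto
  moreover have "((\<phi> \<circ> \<eta>) has_vector_derivative D t) (at t within S)" if "t\<in>S \<inter> \<gamma> -` U" for t
    by (rule has_vector_derivative_transform[OF _ _ D(2)[OF that]]) (use that assms(1) in auto)
  ultimately show "\<exists>D. continuous_on (S \<inter> \<eta> -` U) D \<and>
        (\<forall>t\<in>S \<inter> \<eta> -` U. ((\<phi> \<circ> \<eta>) has_vector_derivative D t) (at t within S))"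
    using D(1) by auto
qed

text \<open>Slope -1 serves for reversing a curve, slope 2 for the two halves of a joined
  one.\<close>

lemma C1_curve_on_affine:
  assumes "C1_curve_on A \<gamma> S" and r: "\<And>t. t \<in> S' \<Longrightarrow> m * t + c \<in> S"
  shows "C1_curve_on A (\<lambda>t. \<gamma> (m * t + c)) S'"
  unfolding C1_curve_on_def
proof (intro conjI ballI, safe)
  have cr: "continuous_on X (\<lambda>t. m * t + c)" for X
    by (intro continuous_intros)
  show "continuous_on S' (\<lambda>t. \<gamma> (m * t + c))"
    using assms(1) r unfolding C1_curve_on_def
    by (intro continuous_on_compose2[OF _ cr]) auto
  fix U \<phi> assume "(U, \<phi>) \<in> A"
  then obtain D where D: "continuous_on (S \<inter> \<gamma> -` U) D"
    "\<And>t. t\<in>S \<inter> \<gamma> -` U \<Longrightarrow> ((\<phi> \<circ> \<gamma>) has_vector_derivative D t) (at t within S)"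
    using assms(1) unfolding C1_curve_on_def by blast
  have "continuous_on (S' \<inter> (\<lambda>t. \<gamma> (m * t + c)) -` U) (\<lambda>t. m *\<^sub>R D (m * t + c))"
    using r by (intro continuous_intros continuous_on_compose2[OF D(1) cr]) auto
  moreover have "((\<phi> \<circ> (\<lambda>t. \<gamma> (m * t + c))) has_vector_derivative m *\<^sub>R D (m * t + c)) (at t within S')"
    if "t\<in>S' \<inter> (\<lambda>t. \<gamma> (m * t + c)) -` U" for t
  proof -
    have 1: "((\<lambda>t. m * t + c) has_vector_derivative m) (at t within S')"
      by (auto intro!: derivative_eq_intros)
    have "((\<phi> \<circ> \<gamma>) has_vector_derivative D (m * t + c)) (at (m * t + c) within (\<lambda>t. m * t + c) ` S')"
      by (rule has_vector_derivative_within_subset[OF D(2)]) (use that r in auto)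
    from vector_diff_chain_within[OF 1 this] show ?thesis by (simp add: o_def)
  qed
  ultimately show "\<exists>D. continuous_on (S' \<inter> (\<lambda>t. \<gamma> (m * t + c)) -` U) D \<and>
        (\<forall>t\<in>S' \<inter> (\<lambda>t. \<gamma> (m * t + c)) -` U. ((\<phi> \<circ> (\<lambda>t. \<gamma> (m * t + c))) has_vector_derivative D t) (at t within S'))"
    by blast
qed

lemma piecewise_C1_curve_reverse:
  assumes "piecewise_C1_curve A \<gamma>"
  shows "piecewise_C1_curve A (\<lambda>t. \<gamma> (-1 * t + 1))"
proof -
  obtain T where T: "finite T" and
    c1: "\<And>a b. 0 \<le> a \<Longrightarrow> a < b \<Longrightarrow> b \<le> 1 \<Longrightarrow> {a<..<b} \<inter> T = {} \<Longrightarrow> C1_curve_on A \<gamma> {a..b}"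
    and cont: "continuous_on {0..1} \<gamma>"
    using assms unfolding piecewise_C1_curve_def by metis
  show ?thesis unfolding piecewise_C1_curve_def
  proof (intro conjI exI[of _ "(\<lambda>t. 1 - t) ` T"] allI impI)
    have 1: "continuous_on {0..1::real} (\<lambda>t. -1 * t + 1)" by (intro continuous_intros)
    show "continuous_on {0..1} (\<lambda>t. \<gamma> (-1 * t + 1))"
      by (rule continuous_on_compose2[OF cont 1]) auto
    show "finite ((\<lambda>t. 1 - t) ` T)" using T by simp
    fix a b :: real assume ab: "0 \<le> a \<and> a < b \<and> b \<le> 1 \<and> {a<..<b} \<inter> (\<lambda>t. 1 - t) ` T = {}"
    have "t \<notin> T" if "t \<in> {1 - b<..<1 - a}" for t
    proof
      assume "t \<in> T"
      then have "1 - t \<in> {a<..<b} \<inter> (\<lambda>t. 1 - t) ` T" using that by auto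
      then show False using ab by auto
    qed
    then have "C1_curve_on A \<gamma> {1 - b..1 - a}" using ab by (intro c1) auto
    then show "C1_curve_on A (\<lambda>t. \<gamma> (-1 * t + 1)) {a..b}"
      by (rule C1_curve_on_affine) auto
  qed
qed

lemma piecewise_C1_curve_join:
  fixes \<gamma> \<eta> :: "real \<Rightarrow> 'a::topological_space"
  assumes \<gamma>: "piecewise_C1_curve A \<gamma>" and \<eta>: "piecewise_C1_curve A \<eta>" and join: "\<gamma> 1 = \<eta> 0"
  shows "piecewise_C1_curve A (\<gamma> +++ \<eta>)"
proof -
  obtain T where T: "finite T" and
    c1: "\<And>a b. 0 \<le> a \<Longrightarrow> a < b \<Longrightarrow> b \<le> 1 \<Longrightarrow> {a<..<b} \<inter> T = {} \<Longrightarrow> C1_curve_on A \<gamma> {a..b}"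
    and cont: "continuous_on {0..1} \<gamma>"
    using \<gamma> unfolding piecewise_C1_curve_def by metis
  obtain T' where T': "finite T'" and
    c1': "\<And>a b. 0 \<le> a \<Longrightarrow> a < b \<Longrightarrow> b \<le> 1 \<Longrightarrow> {a<..<b} \<inter> T' = {} \<Longrightarrow> C1_curve_on A \<eta> {a..b}"
    and cont': "continuous_on {0..1} \<eta>"
    using \<eta> unfolding piecewise_C1_curve_def by metis
  \<comment> \<open>The break points of both curves moved to their halves, and the joint 1/2, where
    the two one-sided derivatives may differ.\<close>
  let ?T = "(\<lambda>t. t / 2) ` T \<union> (\<lambda>t. (t + 1) / 2) ` T' \<union> {1/2}"
  show ?thesis unfolding piecewise_C1_curve_def
  proof (intro conjI exI[of _ ?T] allI impI)
    have "path (\<gamma> +++ \<eta>)"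
      using cont cont' join by (intro path_join_imp) (auto simp: path_def pathfinish_def pathstart_def)
    then show "continuous_on {0..1} (\<gamma> +++ \<eta>)" by (simp add: path_def)
    show "finite ?T" using T T' by simp
    fix a b :: real assume ab: "0 \<le> a \<and> a < b \<and> b \<le> 1 \<and> {a<..<b} \<inter> ?T = {}"
    have dj: "t \<notin> ?T" if "t \<in> {a<..<b}" for t using ab that by blast
    have "\<not> (a < 1/2 \<and> 1/2 < b)" using dj[of "1/2"] by auto
    then consider "b \<le> 1/2" | "1/2 \<le> a" by linarith
    then show "C1_curve_on A (\<gamma> +++ \<eta>) {a..b}"
    proof cases
      case 1
      have "t \<notin> T" if "t \<in> {2 * a<..<2 * b}" for t
        using dj[of "t/2"] that by auto
      then have "C1_curve_on A \<gamma> {2 * a..2 * b}" using ab 1 by (intro c1) auto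
      then have "C1_curve_on A (\<lambda>t. \<gamma> (2 * t + 0)) {a..b}"
        by (rule C1_curve_on_affine) auto
      then show ?thesis
        by (rule C1_curve_on_cong[rotated]) (use 1 in \<open>auto simp: joinpaths_def\<close>)
    next
      case 2
      have "t \<notin> T'" if "t \<in> {2 * a - 1<..<2 * b - 1}" for t
        using dj[of "(t+1)/2"] that by auto
      then have "C1_curve_on A \<eta> {2 * a - 1..2 * b - 1}" using ab 2 by (intro c1') auto
      then have "C1_curve_on A (\<lambda>t. \<eta> (2 * t + - 1)) {a..b}"
        by (rule C1_curve_on_affine) auto
      then show ?thesis
      proof (rule C1_curve_on_cong[rotated])
        show "\<eta> (2 * t + - 1) = (\<gamma> +++ \<eta>) t" if "t \<in> {a..b}" for t
      \<comment> \<open>At 1/2 the first branch of \<open>+++\<close> applies, so agreement with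
        \<open>\<eta>\<close> rests on \<open>join\<close>.\<close>
      proof (cases "t = 1/2")
        case True
        show ?thesis unfolding True joinpaths_def using join by simp
      next
        case False
        then show ?thesis using 2 that by (auto simp: joinpaths_def)
      qed
      qed
    qed
  qed
qed

lemma
  assumes "smooth_atlas A"
  shows smooth_atlas_cover: "\<exists>c\<in>A. p \<in> fst c"
    and smooth_atlas_open: "(U, \<phi>) \<in> A \<Longrightarrow> open U"
    and smooth_atlas_open_image: "(U, \<phi>) \<in> A \<Longrightarrow> open (\<phi> ` U)"
    and smooth_atlas_homeomorphism: "(U, \<phi>) \<in> A \<Longrightarrow> homeomorphism U (\<phi> ` U) \<phi> (inv_into U \<phi>)"
    and smooth_atlas_transition:
      "(U, \<phi>) \<in> A \<Longrightarrow> (V, \<psi>) \<in> A \<Longrightarrow> smooth_on (\<phi> ` (U \<inter> V)) (\<psi> \<circ> inv_into U \<phi>)"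
proof -
  have "(\<Union>(U, \<phi>)\<in>A. U) = UNIV" using assms by (simp only: smooth_atlas_def)
  then have "p \<in> (\<Union>(U, \<phi>)\<in>A. U)" by simp
  then show "\<exists>c\<in>A. p \<in> fst c" by (force simp: case_prod_beta)
  note c = assms[unfolded smooth_atlas_def, THEN conjunct2]
  note 1 = c[THEN conjunct1] and 2 = c[THEN conjunct2]
  show "open U" "open (\<phi> ` U)" "homeomorphism U (\<phi> ` U) \<phi> (inv_into U \<phi>)" if "(U, \<phi>) \<in> A"
    using bspec[OF 1 that] by (simp_all only: prod.case)
  show "smooth_on (\<phi> ` (U \<inter> V)) (\<psi> \<circ> inv_into U \<phi>)" if "(U, \<phi>) \<in> A" "(V, \<psi>) \<in> A"
    using bspec[OF bspec[OF 2 that(1), unfolded prod.case] that(2)] by (simp only: prod.case)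
qed

lemma
  assumes "smooth_map A f"
  shows smooth_map_continuous: "continuous_on UNIV f"
    and smooth_map_chart: "(U, \<phi>) \<in> A \<Longrightarrow> (V, \<psi>) \<in> A \<Longrightarrow>
      smooth_on (\<phi> ` (U \<inter> f -` V)) (\<psi> \<circ> f \<circ> inv_into U \<phi>)"
proof -
  show "continuous_on UNIV f" using assms by (simp only: smooth_map_def)
  have 2: "\<forall>(U, \<phi>)\<in>A. \<forall>(V, \<psi>)\<in>A. smooth_on (\<phi> ` (U \<inter> f -` V)) (\<psi> \<circ> f \<circ> inv_into U \<phi>)"
    using assms unfolding smooth_map_def by (elim conjE)
  show "smooth_on (\<phi> ` (U \<inter> f -` V)) (\<psi> \<circ> f \<circ> inv_into U \<phi>)" if "(U, \<phi>) \<in> A" "(V, \<psi>) \<in> A"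
    using bspec[OF bspec[OF 2 that(1), unfolded prod.case] that(2)] by (simp only: prod.case)
qed

text \<open>A single \<open>D\<close> must work on the whole preimage of the target chart, which may
  meet many source charts. The derivative within \<open>{a..b}\<close> is a choice independent of
  source charts, unique because \<open>a < b\<close>; its continuity is checked near each
  \<open>t\<close>, where \<open>\<gamma>\<close> stays in one chart.\<close>

lemma C1_curve_on_smooth_map:
  assumes at: "smooth_atlas A" and f: "smooth_map A f" and \<gamma>: "C1_curve_on A \<gamma> {a..b}" and "a < b"
  shows "C1_curve_on A (f \<circ> \<gamma>) {a..b}"
  unfolding C1_curve_on_def
proof (intro conjI ballI, safe)
  have cf: "continuous_on UNIV f" by (rule smooth_map_continuous[OF f])
  have c\<gamma>: "continuous_on {a..b} \<gamma>" using \<gamma> by (simp add: C1_curve_on_def)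
  show "continuous_on {a..b} (f \<circ> \<gamma>)"
    by (rule continuous_on_compose[OF c\<gamma>]) (use cf continuous_on_subset in blast)
  fix V \<psi> assume V: "(V, \<psi>) \<in> A"
  let ?X = "{a..b} \<inter> (f \<circ> \<gamma>) -` V"
  let ?D = "\<lambda>t. vector_derivative (\<psi> \<circ> (f \<circ> \<gamma>)) (at t within {a..b})"
  have loc: "\<exists>N. open N \<and> t \<in> N \<and> continuous_on (?X \<inter> N) ?D \<and>
      ((\<psi> \<circ> (f \<circ> \<gamma>)) has_vector_derivative ?D t) (at t within {a..b})" if t: "t \<in> ?X" for t
  proof -
    obtain U \<phi> where U: "(U, \<phi>) \<in> A" "\<gamma> t \<in> U"
      using smooth_atlas_cover[OF at, of "\<gamma> t"] by auto
    have oU: "open U" and hom: "homeomorphism U (\<phi> ` U) \<phi> (inv_into U \<phi>)"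
      using smooth_atlas_open[OF at U(1)] smooth_atlas_homeomorphism[OF at U(1)] by auto
    obtain N where N: "open N" "N \<inter> {a..b} = \<gamma> -` U \<inter> {a..b}"
      using c\<gamma> oU unfolding continuous_on_open_invariant by metis
    obtain E where E: "continuous_on ({a..b} \<inter> \<gamma> -` U) E"
      "\<And>s. s\<in>{a..b} \<inter> \<gamma> -` U \<Longrightarrow> ((\<phi> \<circ> \<gamma>) has_vector_derivative E s) (at s within {a..b})"
      using \<gamma> U(1) unfolding C1_curve_on_def by blast
    let ?h = "\<psi> \<circ> f \<circ> inv_into U \<phi>"
    have sm: "smooth_on (\<phi> ` (U \<inter> f -` V)) ?h"
      by (rule smooth_map_chart[OF f U(1) V])
    let ?F = "\<lambda>s. frechet_derivative ?h (at ((\<phi> \<circ> \<gamma>) s)) (E s)"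
    have der: "((\<psi> \<circ> (f \<circ> \<gamma>)) has_vector_derivative ?F s) (at s within {a..b})" if s: "s \<in> ?X \<inter> N" for s
    proof -
      have sU: "s \<in> {a..b} \<inter> \<gamma> -` U" using s N(2) by auto
      have "((?h \<circ> (\<phi> \<circ> \<gamma>)) has_vector_derivative ?F s) (at s within {a..b})"
        by (rule smooth_on_chain[OF sm _ E(2)[OF sU]]) (use s sU in auto)
      then have "((?h \<circ> (\<phi> \<circ> \<gamma>)) has_vector_derivative ?F s) (at s within {a..b} \<inter> N)"
        by (rule has_vector_derivative_within_subset) auto
      then have "((\<psi> \<circ> (f \<circ> \<gamma>)) has_vector_derivative ?F s) (at s within {a..b} \<inter> N)"
      proof (rule has_vector_derivative_transform[rotated 2])
        show "s \<in> {a..b} \<inter> N" using s by auto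
        fix r assume "r \<in> {a..b} \<inter> N"
        then have "\<gamma> r \<in> U" using N(2) by auto
        then show "(\<psi> \<circ> (f \<circ> \<gamma>)) r = (?h \<circ> (\<phi> \<circ> \<gamma>)) r"
          using hom by (simp add: homeomorphism_def)
      qed
      moreover have "at s within {a..b} \<inter> N = at s within {a..b}"
        by (rule at_within_nhd[of _ N]) (use s N(1) in auto)
      ultimately show ?thesis by simp
    qed
    have eq: "?D s = ?F s" if "s \<in> ?X \<inter> N" for s
      using der[OF that] that \<open>a < b\<close> by (intro vector_derivative_within_closed_interval) auto
    have "continuous_on (?X \<inter> N) ?F"
    proof (rule smooth_on_chain_continuous[OF sm])
      show "continuous_on (?X \<inter> N) (\<phi> \<circ> \<gamma>)"
      proof (rule continuous_on_compose)
        show "continuous_on (?X \<inter> N) \<gamma>" by (rule continuous_on_subset[OF c\<gamma>]) auto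
        have "continuous_on U \<phi>" using hom by (simp add: homeomorphism_def)
        then show "continuous_on (\<gamma> ` (?X \<inter> N)) \<phi>"
          by (rule continuous_on_subset) (use N(2) in auto)
      qed
      show "(\<phi> \<circ> \<gamma>) ` (?X \<inter> N) \<subseteq> \<phi> ` (U \<inter> f -` V)" using N(2) by auto
      show "continuous_on (?X \<inter> N) E" by (rule continuous_on_subset[OF E(1)]) (use N(2) in auto)
    qed
    then have "continuous_on (?X \<inter> N) ?D"
      by (rule continuous_on_eq) (use eq in simp)
    moreover have "t \<in> N"
    proof -
      have "t \<in> \<gamma> -` U \<inter> {a..b}" using t U(2) by simp
      then show ?thesis unfolding N(2)[symmetric] by simp
    qed
    moreover have "((\<psi> \<circ> (f \<circ> \<gamma>)) has_vector_derivative ?D t) (at t within {a..b})"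
      using der[of t] eq[of t] t \<open>t \<in> N\<close> by (simp only: Int_iff simp_thms)
    ultimately show ?thesis using N(1) by (intro exI[of _ N] conjI)
  qed
  have "continuous_on ?X ?D"
    unfolding continuous_on_eq_continuous_within
  proof
    fix t assume t: "t \<in> ?X"
    obtain N where N: "open N" "t \<in> N" "continuous_on (?X \<inter> N) ?D" using loc[OF t] by blast
    then have "continuous (at t within ?X \<inter> N) ?D"
      using t by (simp add: continuous_on_eq_continuous_within)
    moreover have "at t within ?X \<inter> N = at t within ?X"
      by (rule at_within_nhd[of _ N]) (use N in auto)
    ultimately show "continuous (at t within ?X) ?D" by simp
  qed
  moreover have "\<forall>t\<in>?X. ((\<psi> \<circ> (f \<circ> \<gamma>)) has_vector_derivative ?D t) (at t within {a..b})"
    using loc by blast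
  ultimately show "\<exists>D. continuous_on ?X D \<and>
      (\<forall>t\<in>?X. ((\<psi> \<circ> (f \<circ> \<gamma>)) has_vector_derivative D t) (at t within {a..b}))"
    by (intro exI[of _ ?D] conjI)
qed

lemma piecewise_C1_curve_smooth_map:
  assumes "smooth_atlas A" and f: "smooth_map A f" and \<gamma>: "piecewise_C1_curve A \<gamma>"
  shows "piecewise_C1_curve A (f \<circ> \<gamma>)"
proof -
  obtain T where T: "finite T" and
    c1: "\<And>a b. 0 \<le> a \<Longrightarrow> a < b \<Longrightarrow> b \<le> 1 \<Longrightarrow> {a<..<b} \<inter> T = {} \<Longrightarrow> C1_curve_on A \<gamma> {a..b}"
    and cont: "continuous_on {0..1} \<gamma>"
    using \<gamma> unfolding piecewise_C1_curve_def by metis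
  show ?thesis
    unfolding piecewise_C1_curve_def
  proof (intro conjI exI[of _ T] allI impI T)
    show "continuous_on {0..1} (f \<circ> \<gamma>)"
      by (rule continuous_on_compose[OF cont continuous_on_subset[OF smooth_map_continuous[OF f] subset_UNIV]])
    fix a b :: real assume "0 \<le> a \<and> a < b \<and> b \<le> 1 \<and> {a<..<b} \<inter> T = {}"
    then show "C1_curve_on A (f \<circ> \<gamma>) {a..b}"
      using C1_curve_on_smooth_map[OF assms(1) f] c1 by simp
  qed
qed

section \<open>Length and geodesic distance\<close>

text \<open>The choice hidden in \<open>curve_speed\<close>, named so that it can be folded.\<close>

definition chart_at :: "('a, 'n::finite) chart set \<Rightarrow> 'a \<Rightarrow> ('a, 'n) chart" where
  "chart_at A p = (SOME c. c \<in> A \<and> p \<in> fst c)"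

text \<open>Away from the break points \<open>t\<close> is interior to an interval on which the
  curve is C1, so the derivative within it is the two-sided one that \<open>curve_speed\<close>
  takes.\<close>

lemma piecewise_C1_curve_differentiable:
  assumes "piecewise_C1_curve A \<gamma>"
  obtains T where "finite T"
    "\<And>t U \<phi>. 0 < t \<Longrightarrow> t < 1 \<Longrightarrow> t \<notin> T \<Longrightarrow> (U, \<phi>) \<in> A \<Longrightarrow> \<gamma> t \<in> U \<Longrightarrow>
       \<exists>v. ((\<phi> \<circ> \<gamma>) has_vector_derivative v) (at t)"
proof -
  obtain T where T: "finite T" and
    c1: "\<And>a b. 0 \<le> a \<Longrightarrow> a < b \<Longrightarrow> b \<le> 1 \<Longrightarrow> {a<..<b} \<inter> T = {} \<Longrightarrow> C1_curve_on A \<gamma> {a..b}"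
    using assms unfolding piecewise_C1_curve_def by metis
  show thesis
  proof (rule that[OF T])
    fix t U \<phi> assume t: "0 < t" "t < 1" "t \<notin> T" and U: "(U, \<phi>) \<in> A" "\<gamma> t \<in> U"
    have "open ({0<..<1} - T)" using T by (intro open_Diff finite_imp_closed) auto
    then obtain e where e: "e > 0" "ball t e \<subseteq> {0<..<1} - T"
      using t by (auto elim: openE)
    define a b where "a = t - e/2" and "b = t + e/2"
    have sub: "{a..b} \<subseteq> ball t e" using e(1) by (auto simp: a_def b_def dist_real_def)
    have ab: "a < t" "t < b" using e(1) by (auto simp: a_def b_def)
    have "a \<in> {a..b}" "b \<in> {a..b}" using ab by auto
    then have "a \<in> {0<..<1}" "b \<in> {0<..<1}" using sub e(2) by blast+
    moreover have "{a<..<b} \<inter> T = {}"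
    proof -
      have "{a<..<b} \<subseteq> {a..b}" by auto
      then show ?thesis using sub e(2) by blast
    qed
    ultimately have "C1_curve_on A \<gamma> {a..b}" using ab by (intro c1) auto
    then obtain D where "((\<phi> \<circ> \<gamma>) has_vector_derivative D t) (at t within {a..b})"
      using U ab unfolding C1_curve_on_def by fastforce
    moreover have "at t within {a..b} = at t"
      using ab by (intro at_within_interior) auto
    ultimately show "\<exists>v. ((\<phi> \<circ> \<gamma>) has_vector_derivative v) (at t)" by auto
  qed
qed

locale riemannian =
  fixes A :: "('a::{t2_space, second_countable_topology}, 'n::finite) chart set"
    and g :: "('a, 'n) chart \<Rightarrow> 'a \<Rightarrow> real ^ 'n \<Rightarrow> real ^ 'n \<Rightarrow> real"
  assumes riem: "riemannian_manifold A g"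
begin

lemma atlas: "smooth_atlas A"
  by (rule riem[unfolded riemannian_manifold_def, THEN conjunct1])

lemma
  assumes "(U, \<phi>) \<in> A" "p \<in> U"
  shows metric_bilinear: "bilinear (g (U, \<phi>) p)"
    and metric_nonneg: "0 \<le> g (U, \<phi>) p v v"
proof -
  note c = riem[unfolded riemannian_manifold_def, THEN conjunct2, THEN conjunct1]
  note 1 = bspec[OF bspec[OF c assms(1), unfolded prod.case] assms(2)]
  show bl: "bilinear (g (U, \<phi>) p)" by (rule 1[THEN conjunct1])
  show "0 \<le> g (U, \<phi>) p v v"
    using 1 bilinear_lzero[OF bl, of 0] by (cases "v = 0") (auto intro: less_imp_le)
qed

lemma metric_smooth:
  assumes "(U, \<phi>) \<in> A"
  shows "smooth_on (\<phi> ` U) (\<lambda>z. g (U, \<phi>) (inv_into U \<phi> z) v w)"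
proof -
  note c = riem[unfolded riemannian_manifold_def, THEN conjunct2, THEN conjunct2, THEN conjunct1]
  show ?thesis using bspec[OF c assms] by simp
qed

lemma metric_transition:
  assumes "(U, \<phi>) \<in> A" "(V, \<psi>) \<in> A" "p \<in> U" "p \<in> V"
  shows "g (V, \<psi>) p (frechet_derivative (\<psi> \<circ> inv_into U \<phi>) (at (\<phi> p)) v)
      (frechet_derivative (\<psi> \<circ> inv_into U \<phi>) (at (\<phi> p)) w) = g (U, \<phi>) p v w"
proof -
  note c = riem[unfolded riemannian_manifold_def, THEN conjunct2, THEN conjunct2, THEN conjunct2]
  note c' = bspec[OF bspec[OF c assms(1), unfolded prod.case] assms(2), unfolded prod.case]
  have "p \<in> U \<inter> V" using assms by simp
  from bspec[OF c' this] show ?thesis by (simp add: Let_def)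
qed

lemma chart_at: "chart_at A p \<in> A" "p \<in> fst (chart_at A p)"
proof -
  have "\<exists>c. c \<in> A \<and> p \<in> fst c" using smooth_atlas_cover[OF atlas] by blast
  from someI_ex[OF this] show "chart_at A p \<in> A" "p \<in> fst (chart_at A p)"
    unfolding chart_at_def by auto
qed

lemma metric_chart_at_nonneg: "0 \<le> g (chart_at A p) p v v"
  using metric_nonneg[of "fst (chart_at A p)" "snd (chart_at A p)" p] chart_at[of p] by simp

lemma curve_speed_nonneg: "0 \<le> curve_speed A g \<gamma> t"
  unfolding curve_speed_def Let_def chart_at_def[symmetric] by (simp add: metric_chart_at_nonneg)

text \<open>The case split accounts for a non-integrable speed, whose integral is 0 by
  convention.\<close>

lemma curve_length_nonneg: "0 \<le> curve_length A g \<gamma>"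
  unfolding curve_length_def
  by (cases "curve_speed A g \<gamma> integrable_on {0..1}")
     (auto intro!: integral_nonneg simp: curve_speed_nonneg not_integrable_integral)

lemma curve_speed_eq:
  assumes "((snd (chart_at A (\<gamma> t)) \<circ> \<gamma>) has_vector_derivative v) (at t)"
  shows "curve_speed A g \<gamma> t = sqrt (g (chart_at A (\<gamma> t)) (\<gamma> t) v v)"
  unfolding curve_speed_def Let_def chart_at_def[symmetric] vector_derivative_at[OF assms] ..

text \<open>Both speeds are taken at the same point, hence in the same chosen chart, and bilinearity
  extracts the factor. Agreement on an open set \<open>S\<close> suffices, as is needed for one half
  of a joined curve.\<close>

lemma curve_speed_affine:
  assumes S: "open S" "t \<in> S" "\<And>s. s \<in> S \<Longrightarrow> \<eta> s = \<gamma> (m * s + c)"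
    and der: "((snd (chart_at A (\<gamma> (m * t + c))) \<circ> \<gamma>) has_vector_derivative v) (at (m * t + c))"
  shows "curve_speed A g \<eta> t = \<bar>m\<bar> * curve_speed A g \<gamma> (m * t + c)"
proof -
  let ?c = "chart_at A (\<gamma> (m * t + c))"
  have "((\<lambda>t. m * t + c) has_vector_derivative m) (at t)"
    by (auto intro!: derivative_eq_intros)
  from vector_diff_chain_at[OF this der]
  have "((snd ?c \<circ> \<gamma> \<circ> (\<lambda>t. m * t + c)) has_vector_derivative m *\<^sub>R v) (at t)" .
  then have "((snd ?c \<circ> \<eta>) has_vector_derivative m *\<^sub>R v) (at t)"
    by (rule has_vector_derivative_transform_within_open[OF _ S(1,2)]) (simp add: S(3))
  then have "curve_speed A g \<eta> t = sqrt (g ?c (\<gamma> (m * t + c)) (m *\<^sub>R v) (m *\<^sub>R v))"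
    using curve_speed_eq[of \<eta> t] S(2,3) by simp
  also have "g ?c (\<gamma> (m * t + c)) (m *\<^sub>R v) (m *\<^sub>R v) = m\<^sup>2 * g ?c (\<gamma> (m * t + c)) v v"
  proof -
    have "bilinear (g ?c (\<gamma> (m * t + c)))"
      using metric_bilinear[of "fst ?c" "snd ?c"] chart_at by simp
    then show ?thesis by (simp add: bilinear_lmul bilinear_rmul power2_eq_square)
  qed
  finally show ?thesis
    using curve_speed_eq[OF der] by (simp add: real_sqrt_mult)
qed

lemma curve_length_reverse:
  assumes "piecewise_C1_curve A \<gamma>"
  shows "curve_length A g (\<lambda>t. \<gamma> (-1 * t + 1)) = curve_length A g \<gamma>"
proof -
  have rev: "(curve_speed A g (\<lambda>t. \<gamma> (-1 * t + 1)) has_integral i) {0..1}"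
    if \<gamma>: "piecewise_C1_curve A \<gamma>" and i: "(curve_speed A g \<gamma> has_integral i) {0..1}" for \<gamma> i
  proof -
    obtain T where T: "finite T"
      "\<And>t U \<phi>. 0 < t \<Longrightarrow> t < 1 \<Longrightarrow> t \<notin> T \<Longrightarrow> (U, \<phi>) \<in> A \<Longrightarrow> \<gamma> t \<in> U \<Longrightarrow>
       \<exists>v. ((\<phi> \<circ> \<gamma>) has_vector_derivative v) (at t)"
      using piecewise_C1_curve_differentiable[OF \<gamma>] by metis
    have "(\<lambda>x. 1 - x) ` {0..1} = {0..1::real}" by (simp add: image_diff_atLeastAtMost)
    then have 1: "((\<lambda>t. curve_speed A g \<gamma> (-1 * t + 1)) has_integral i) {0..1}"
      using has_integral_affinity[of "curve_speed A g \<gamma>" i 0 1 "-1" 1] i by simp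
    show ?thesis
    proof (rule has_integral_spike_finite[OF _ _ 1])
      show "finite ({0, 1} \<union> (\<lambda>t. 1 - t) ` T)" using T by simp
      fix t assume t: "t \<in> {0..1} - ({0, 1} \<union> (\<lambda>t. 1 - t) ` T)"
      have "1 - t \<notin> T"
      proof
        assume "1 - t \<in> T"
        then have "1 - (1 - t) \<in> (\<lambda>t. 1 - t) ` T" by (rule imageI)
        then show False using t by simp
      qed
      moreover have "0 < 1 - t" "1 - t < 1" using t by auto
      ultimately obtain v where
        "((snd (chart_at A (\<gamma> (-1 * t + 1))) \<circ> \<gamma>) has_vector_derivative v) (at (-1 * t + 1))"
        using T(2)[of "1 - t" "fst (chart_at A (\<gamma> (1 - t)))" "snd (chart_at A (\<gamma> (1 - t)))"] chart_at[of "\<gamma> (1 - t)"] by auto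
      from curve_speed_affine[OF open_UNIV UNIV_I _ this, of "\<lambda>t. \<gamma> (-1 * t + 1)"]
      show "curve_speed A g (\<lambda>t. \<gamma> (-1 * t + 1)) t = curve_speed A g \<gamma> (-1 * t + 1)" by simp
    qed
  qed
  \<comment> \<open>Reversing twice gives \<open>\<gamma>\<close> back, so \<open>rev\<close>
    applies in both directions and transfers integrability along with the value.\<close>
  have "(\<lambda>t. (\<lambda>s. \<gamma> (-1 * s + 1)) (-1 * t + 1)) = \<gamma>" by simp
  then have "(curve_speed A g (\<lambda>t. \<gamma> (-1 * t + 1)) has_integral i) {0..1} \<longleftrightarrow>
      (curve_speed A g \<gamma> has_integral i) {0..1}" for i
    using rev[OF assms, of i] rev[OF piecewise_C1_curve_reverse[OF assms], of i] by auto
  then show ?thesis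
    unfolding curve_length_def integral_def integrable_on_def by simp
qed

text \<open>Equality can fail: if just one of the two speeds is not integrable, neither is the
  joined one, and the left side is 0. The inequality is what the triangle inequality needs.\<close>

lemma curve_length_join:
  assumes \<gamma>: "piecewise_C1_curve A \<gamma>" and \<eta>: "piecewise_C1_curve A \<eta>"
  shows "curve_length A g (\<gamma> +++ \<eta>) \<le> curve_length A g \<gamma> + curve_length A g \<eta>"
proof (cases "curve_speed A g (\<gamma> +++ \<eta>) integrable_on {0..1}")
  case False
  \<comment> \<open>a non-integrable speed gives the junk length \<open>0\<close>\<close>
  then show ?thesis
    using curve_length_nonneg[of \<gamma>] curve_length_nonneg[of \<eta>]
    by (simp add: curve_length_def not_integrable_integral)
next
  case True
  let ?s = "curve_speed A g (\<gamma> +++ \<eta>)"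
  obtain T where T: "finite T"
    "\<And>t U \<phi>. 0 < t \<Longrightarrow> t < 1 \<Longrightarrow> t \<notin> T \<Longrightarrow> (U, \<phi>) \<in> A \<Longrightarrow> \<gamma> t \<in> U \<Longrightarrow>
     \<exists>v. ((\<phi> \<circ> \<gamma>) has_vector_derivative v) (at t)"
    using piecewise_C1_curve_differentiable[OF \<gamma>] by metis
  obtain T' where T': "finite T'"
    "\<And>t U \<phi>. 0 < t \<Longrightarrow> t < 1 \<Longrightarrow> t \<notin> T' \<Longrightarrow> (U, \<phi>) \<in> A \<Longrightarrow> \<eta> t \<in> U \<Longrightarrow>
     \<exists>v. ((\<phi> \<circ> \<eta>) has_vector_derivative v) (at t)"
    using piecewise_C1_curve_differentiable[OF \<eta>] by metis
  have "?s integrable_on {0..1/2}" "?s integrable_on {1/2..1}"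
    using True by (auto intro: integrable_subinterval_real)
  then obtain i j where i: "(?s has_integral i) {0..1/2}" and j: "(?s has_integral j) {1/2..1}"
    by (auto simp: integrable_on_def)
  have "(?s has_integral (i + j)) {0..1}"
    by (rule has_integral_combine[OF _ _ i j]) auto
  then have len: "curve_length A g (\<gamma> +++ \<eta>) = i + j"
    by (simp add: curve_length_def integral_unique)
  have "(curve_speed A g \<gamma> has_integral i) {0..1}"
  proof -
    have "(*) 2 ` {0..1/2::real} = {0..1}"
      using image_affinity_atLeastAtMost[of 2 0 0 "1/2::real"] by simp
    then have "((\<lambda>t. ?s (t / 2)) has_integral (2 * i)) {0..1}"
      using has_integral_affinity[of ?s i 0 "1/2" "1/2" 0] i by simp
    from has_integral_mult_right[OF this, of "1/2"]
    have 1: "((\<lambda>t. 1/2 * ?s (t / 2)) has_integral i) {0..1}" by simp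
    show ?thesis
    proof (rule has_integral_spike_finite[OF _ _ 1])
      show "finite ({0, 1} \<union> T)" using T by simp
      fix t assume t: "t \<in> {0..1} - ({0, 1} \<union> T)"
      then obtain v where
        "((snd (chart_at A (\<gamma> (2 * (t/2) + 0))) \<circ> \<gamma>) has_vector_derivative v) (at (2 * (t/2) + 0))"
        using T(2)[of t "fst (chart_at A (\<gamma> t))" "snd (chart_at A (\<gamma> t))"] chart_at[of "\<gamma> t"] by auto
      from curve_speed_affine[of "{..<1/2}", OF _ _ _ this, of "\<gamma> +++ \<eta>"] t
      show "curve_speed A g \<gamma> t = 1/2 * ?s (t / 2)" by (simp add: joinpaths_def)
    qed
  qed
  moreover have "(curve_speed A g \<eta> has_integral j) {0..1}"
  proof -
    have "(\<lambda>x. 2 * x - 1) ` {1/2..1::real} = {0..1}"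
      using image_affinity_atLeastAtMost[of 2 "-1" "1/2" "1::real"] by simp
    then have "((\<lambda>t. ?s (t / 2 + 1/2)) has_integral (2 * j)) {0..1}"
      using has_integral_affinity[of ?s j "1/2" 1 "1/2" "1/2"] j by simp
    from has_integral_mult_right[OF this, of "1/2"]
    have 1: "((\<lambda>t. 1/2 * ?s (t / 2 + 1/2)) has_integral j) {0..1}" by simp
    show ?thesis
    proof (rule has_integral_spike_finite[OF _ _ 1])
      show "finite ({0, 1} \<union> T')" using T' by simp
      fix t assume t: "t \<in> {0..1} - ({0, 1} \<union> T')"
      then obtain v where
        "((snd (chart_at A (\<eta> (2 * (t/2 + 1/2) + - 1))) \<circ> \<eta>) has_vector_derivative v) (at (2 * (t/2 + 1/2) + - 1))"
        using T'(2)[of t "fst (chart_at A (\<eta> t))" "snd (chart_at A (\<eta> t))"] chart_at[of "\<eta> t"] by auto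
      from curve_speed_affine[of "{1/2<..}", OF _ _ _ this, of "\<gamma> +++ \<eta>"] t
      show "curve_speed A g \<eta> t = 1/2 * ?s (t / 2 + 1/2)" by (simp add: joinpaths_def)
    qed
  qed
  ultimately show ?thesis
    unfolding len by (simp add: curve_length_def integral_unique)
qed

text \<open>The isometry law holds for all pairs of charts, so also for those chosen at
  \<open>\<gamma> t\<close> and \<open>f (\<gamma> t)\<close>; the speeds agree off the finitely
  many break points.\<close>

lemma curve_length_isometry:
  assumes f: "riemannian_isometry A g f" and \<gamma>: "piecewise_C1_curve A \<gamma>"
  shows "curve_length A g (f \<circ> \<gamma>) = curve_length A g \<gamma>"
proof -
  have sm: "smooth_map A f" using f unfolding riemannian_isometry_def by (elim conjE)
  obtain T where T: "finite T"
    "\<And>t U \<phi>. 0 < t \<Longrightarrow> t < 1 \<Longrightarrow> t \<notin> T \<Longrightarrow> (U, \<phi>) \<in> A \<Longrightarrow> \<gamma> t \<in> U \<Longrightarrow>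
     \<exists>v. ((\<phi> \<circ> \<gamma>) has_vector_derivative v) (at t)"
    using piecewise_C1_curve_differentiable[OF \<gamma>] by metis
  show ?thesis
    unfolding curve_length_def
  proof (rule integral_spike[of "{0, 1} \<union> T"])
    show "negligible ({0, 1} \<union> T)" using T(1) by (intro negligible_finite) simp
    fix t assume t: "t \<in> {0..1} - ({0, 1} \<union> T)"
    obtain U \<phi> where U: "chart_at A (\<gamma> t) = (U, \<phi>)" "(U, \<phi>) \<in> A" "\<gamma> t \<in> U"
      using chart_at[of "\<gamma> t"] by (metis prod.collapse)
    obtain V \<psi> where V: "chart_at A (f (\<gamma> t)) = (V, \<psi>)" "(V, \<psi>) \<in> A" "f (\<gamma> t) \<in> V"
      using chart_at[of "f (\<gamma> t)"] by (metis prod.collapse)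
    obtain v where v: "((\<phi> \<circ> \<gamma>) has_vector_derivative v) (at t)"
      using T(2)[OF _ _ _ U(2,3)] t by auto
    let ?h = "\<psi> \<circ> f \<circ> inv_into U \<phi>"
    let ?D = "frechet_derivative ?h (at (\<phi> (\<gamma> t)))"
    have hom: "homeomorphism U (\<phi> ` U) \<phi> (inv_into U \<phi>)"
      by (rule smooth_atlas_homeomorphism[OF atlas U(2)])
    have "((?h \<circ> (\<phi> \<circ> \<gamma>)) has_vector_derivative ?D v) (at t)"
      using smooth_on_chain[OF smooth_map_chart[OF sm U(2) V(2)] _ v] U(3) V(3) by auto
    moreover
    have "continuous (at t) \<gamma>"
    proof -
      have "continuous_on {0..1} \<gamma>" using \<gamma> by (simp add: piecewise_C1_curve_def)
      then show ?thesis using t by (intro continuous_on_interior[of "{0..1}"]) auto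
    qed
    then have "\<forall>\<^sub>F s in at t. \<gamma> s \<in> U"
      using smooth_atlas_open[OF atlas U(2)] U(3) unfolding continuous_at by (rule topological_tendstoD)
    then obtain N where N: "open N" "t \<in> N" "\<forall>s\<in>N. s \<noteq> t \<longrightarrow> s \<in> UNIV \<longrightarrow> \<gamma> s \<in> U"
      unfolding eventually_at_topological by blast
    ultimately have "((\<psi> \<circ> (f \<circ> \<gamma>)) has_vector_derivative ?D v) (at t)"
    proof (rule_tac has_vector_derivative_transform_within_open[OF _ N(1,2)])
      fix s assume "s \<in> N"
      then show "(?h \<circ> (\<phi> \<circ> \<gamma>)) s = (\<psi> \<circ> (f \<circ> \<gamma>)) s"
        using N(3) U(3) homeomorphism_apply1[OF hom] by (cases "s = t") simp_all
    qed
    then have sp: "curve_speed A g (f \<circ> \<gamma>) t = sqrt (g (V, \<psi>) (f (\<gamma> t)) (?D v) (?D v))"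
      using curve_speed_eq[of "f \<circ> \<gamma>" t] V(1) by simp
    note iso = f[unfolded riemannian_isometry_def, THEN conjunct2, THEN conjunct2, THEN conjunct2]
    note iso' = bspec[OF bspec[OF iso U(2), unfolded prod.case] V(2), unfolded prod.case]
    have "\<gamma> t \<in> U \<inter> f -` V" using U(3) V(3) by simp
    from bspec[OF iso' this] have "g (V, \<psi>) (f (\<gamma> t)) (?D v) (?D v) = g (U, \<phi>) (\<gamma> t) v v"
      by (simp add: Let_def)
    then show "curve_speed A g \<gamma> t = curve_speed A g (f \<circ> \<gamma>) t"
      using curve_speed_eq[of \<gamma> t] v U(1) sp by simp
  qed
qed

text \<open>The metric is continuous in the point for fixed vectors only. The sum of the absolute
  values of its matrix entries is bounded on \<open>K\<close> by some \<open>C\<close>, and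
  \<open>sqrt C\<close> is the required constant.\<close>

lemma metric_locally_bounded:
  assumes "(U, \<phi>) \<in> A" "K \<subseteq> \<phi> ` U" "compact K"
  obtains B where "0 < B" "\<And>z v. z \<in> K \<Longrightarrow> sqrt (g (U, \<phi>) (inv_into U \<phi> z) v v) \<le> B * norm v"
proof -
  let ?h = "\<lambda>z i j. g (U, \<phi>) (inv_into U \<phi> z) i j"
  have "continuous_on K (\<lambda>z. \<Sum>(i, j)\<in>Basis \<times> Basis. \<bar>?h z i j\<bar>)"
    unfolding case_prod_beta
    by (intro continuous_intros continuous_on_subset[OF smooth_on_continuous_on[OF metric_smooth]] assms)
  then have "bounded ((\<lambda>z. \<Sum>(i, j)\<in>Basis \<times> Basis. \<bar>?h z i j\<bar>) ` K)"
    using assms(3) compact_continuous_image compact_imp_bounded by blast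
  then obtain C where C: "0 < C" "\<And>z. z \<in> K \<Longrightarrow> \<bar>\<Sum>(i, j)\<in>Basis \<times> Basis. \<bar>?h z i j\<bar>\<bar> \<le> C"
    unfolding bounded_pos by auto
  show thesis
  proof
    show "0 < sqrt C" using C by simp
    fix z v assume z: "z \<in> K"
    have "inv_into U \<phi> z \<in> U" using z assms(2) by (meson inv_into_into subsetD)
    from metric_bilinear[OF assms(1) this] have bl: "bilinear (?h z)" .
    have "?h z v v = ?h z (\<Sum>i\<in>Basis. (v \<bullet> i) *\<^sub>R i) (\<Sum>j\<in>Basis. (v \<bullet> j) *\<^sub>R j)"
      by (simp add: euclidean_representation)
    also have "\<dots> = (\<Sum>(i, j)\<in>Basis \<times> Basis. ?h z ((v \<bullet> i) *\<^sub>R i) ((v \<bullet> j) *\<^sub>R j))"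
      by (rule bilinear_sum[OF bl])
    also have "\<dots> = (\<Sum>(i, j)\<in>Basis \<times> Basis. (v \<bullet> i) * (v \<bullet> j) * ?h z i j)"
      by (simp add: bilinear_lmul[OF bl] bilinear_rmul[OF bl] mult_ac)
    also have "\<dots> \<le> (\<Sum>(i, j)\<in>Basis \<times> Basis. (norm v)\<^sup>2 * \<bar>?h z i j\<bar>)"
    proof (rule sum_mono, clarify)
      fix i j :: "real ^ 'n" assume ij: "i \<in> Basis" "j \<in> Basis"
      have "(v \<bullet> i) * (v \<bullet> j) * ?h z i j \<le> \<bar>v \<bullet> i\<bar> * \<bar>v \<bullet> j\<bar> * \<bar>?h z i j\<bar>"
        by (metis abs_ge_self abs_mult)
      also have "\<dots> \<le> (norm v * norm v) * \<bar>?h z i j\<bar>"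
        by (intro mult_right_mono mult_mono Basis_le_norm ij) auto
      finally show "(v \<bullet> i) * (v \<bullet> j) * ?h z i j \<le> (norm v)\<^sup>2 * \<bar>?h z i j\<bar>"
        by (simp add: power2_eq_square)
    qed
    also have "\<dots> = (norm v)\<^sup>2 * (\<Sum>(i, j)\<in>Basis \<times> Basis. \<bar>?h z i j\<bar>)"
      by (simp add: sum_distrib_left case_prod_beta)
    also have "\<dots> \<le> (norm v)\<^sup>2 * C" using C(2)[OF z] by (intro mult_left_mono) auto
    finally have "sqrt (?h z v v) \<le> sqrt ((norm v)\<^sup>2 * C)" by (rule real_sqrt_le_mono)
    then show "sqrt (?h z v v) \<le> sqrt C * norm v" by (simp add: real_sqrt_mult mult.commute)
  qed
qed

text \<open>The curve is a straight segment in coordinates. Its speed is computed in the chosen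
  chart at each point and carried back to \<open>(U, \<phi>)\<close> by the transformation
  law.\<close>

lemma short_curve:
  assumes U: "(U, \<phi>) \<in> A" "x \<in> U" "y \<in> U"
    and seg: "closed_segment (\<phi> x) (\<phi> y) \<subseteq> \<phi> ` U"
    and B: "\<And>z v. z \<in> closed_segment (\<phi> x) (\<phi> y) \<Longrightarrow>
      sqrt (g (U, \<phi>) (inv_into U \<phi> z) v v) \<le> B * norm v"
  shows "\<exists>\<gamma>. piecewise_C1_curve A \<gamma> \<and> \<gamma> 0 = x \<and> \<gamma> 1 = y \<and>
    curve_length A g \<gamma> \<le> B * norm (\<phi> y - \<phi> x)"
proof -
  define v where "v = \<phi> y - \<phi> x"
  define l where "l = (\<lambda>t::real. \<phi> x + t *\<^sub>R v)"
  define \<gamma> where "\<gamma> = inv_into U \<phi> \<circ> l"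
  have hom: "homeomorphism U (\<phi> ` U) \<phi> (inv_into U \<phi>)"
    by (rule smooth_atlas_homeomorphism[OF atlas U(1)])
  have l_seg: "l t \<in> closed_segment (\<phi> x) (\<phi> y)" if "t \<in> {0..1}" for t
    using that by (auto simp: l_def v_def closed_segment_def algebra_simps intro!: exI[of _ t])
  have l_im: "l t \<in> \<phi> ` U" if "t \<in> {0..1}" for t using l_seg[OF that] seg by auto
  have \<phi>\<gamma>: "\<gamma> t \<in> U" "\<phi> (\<gamma> t) = l t" if "t \<in> {0..1}" for t
    using l_im[OF that] by (auto simp: \<gamma>_def f_inv_into_f inv_into_into)
  have cont_l: "continuous_on S l" for S unfolding l_def by (intro continuous_intros)
  have cont: "continuous_on {0..1} \<gamma>"
    unfolding \<gamma>_def
    by (rule continuous_on_compose[OF cont_l continuous_on_subset[of "\<phi> ` U"]])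
       (use hom l_im in \<open>auto simp: homeomorphism_def\<close>)
  let ?D = "\<lambda>\<psi> t. frechet_derivative (\<psi> \<circ> inv_into U \<phi>) (at (l t)) v"
  \<comment> \<open>The line \<open>l\<close> continues beyond the segment, so \<open>S\<close> is
    free: \<open>{a..b}\<close> serves for the C1 property, the whole real line for
    \<open>curve_speed\<close>, even at the end points.\<close>
  have der: "((\<psi> \<circ> \<gamma>) has_vector_derivative ?D \<psi> t) (at t within S)"
    if V: "(V, \<psi>) \<in> A" and t: "t \<in> {0..1}" "\<gamma> t \<in> V" for V \<psi> t S
  proof -
    have "l t \<in> \<phi> ` (U \<inter> V)" using \<phi>\<gamma>[OF t(1)] t(2) by (metis IntI imageI)
    moreover have "(l has_vector_derivative v) (at t within S)"
      unfolding l_def by (auto intro!: derivative_eq_intros)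
    ultimately have "((\<psi> \<circ> inv_into U \<phi> \<circ> l) has_vector_derivative ?D \<psi> t) (at t within S)"
      by (intro smooth_on_chain[OF smooth_atlas_transition[OF atlas U(1) V]])
    then show ?thesis by (simp add: \<gamma>_def comp_assoc)
  qed
  have "piecewise_C1_curve A \<gamma>"
    unfolding piecewise_C1_curve_def
  proof (intro conjI exI[of _ "{}"] allI impI cont)
    fix a b :: real assume ab: "0 \<le> a \<and> a < b \<and> b \<le> 1 \<and> {a<..<b} \<inter> {} = {}"
    have sub: "{a..b} \<subseteq> {0..1}" using ab by auto
    show "C1_curve_on A \<gamma> {a..b}"
      unfolding C1_curve_on_def
    proof (intro conjI ballI, unfold case_prod_beta, goal_cases)
      case 1
      show ?case by (rule continuous_on_subset[OF cont sub])
    next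
      case (2 c)
      then have c: "(fst c, snd c) \<in> A" by simp
      have "continuous_on ({a..b} \<inter> \<gamma> -` fst c) (?D (snd c))"
      proof (rule smooth_on_chain_continuous[OF smooth_atlas_transition[OF atlas U(1) c] cont_l])
        show "l ` ({a..b} \<inter> \<gamma> -` fst c) \<subseteq> \<phi> ` (U \<inter> fst c)"
        proof (rule image_subsetI)
          fix t assume t: "t \<in> {a..b} \<inter> \<gamma> -` fst c"
          then have t': "t \<in> {0..1}" using sub by blast
          show "l t \<in> \<phi> ` (U \<inter> fst c)"
            unfolding \<phi>\<gamma>(2)[OF t', symmetric] using \<phi>\<gamma>(1)[OF t'] t by simp
        qed
      qed simp
      moreover have "\<forall>t\<in>{a..b} \<inter> \<gamma> -` fst c. ((snd c \<circ> \<gamma>) has_vector_derivative ?D (snd c) t) (at t within {a..b})"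
        using der[OF c] sub by auto
      ultimately show ?case by blast
    qed
  qed (simp)
  moreover have "\<gamma> 0 = x" "\<gamma> 1 = y"
    using U(2,3) homeomorphism_apply1[OF hom] by (simp_all add: \<gamma>_def l_def v_def)
  moreover have "curve_length A g \<gamma> \<le> B * norm v"
  proof -
    have speed: "curve_speed A g \<gamma> t \<le> B * norm v" if t: "t \<in> {0..1}" for t
    proof -
      obtain V \<psi> where V: "chart_at A (\<gamma> t) = (V, \<psi>)" "(V, \<psi>) \<in> A" "\<gamma> t \<in> V"
        using chart_at[of "\<gamma> t"] by (metis prod.collapse)
      have "curve_speed A g \<gamma> t = sqrt (g (V, \<psi>) (\<gamma> t) (?D \<psi> t) (?D \<psi> t))"
        using curve_speed_eq[of \<gamma> t] der[OF V(2) t V(3)] V(1) by simp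
      also have "g (V, \<psi>) (\<gamma> t) (?D \<psi> t) (?D \<psi> t) = g (U, \<phi>) (\<gamma> t) v v"
        using metric_transition[OF U(1) V(2) \<phi>\<gamma>(1)[OF t] V(3)] \<phi>\<gamma>(2)[OF t] by simp
      also have "sqrt (g (U, \<phi>) (\<gamma> t) v v) \<le> B * norm v"
        using B[OF l_seg[OF t]] by (simp add: \<gamma>_def)
      finally show ?thesis .
    qed
    \<comment> \<open>The sign of \<open>B\<close> is not given, so it is read off from the speed at
      0. The fact covers the default length 0.\<close>
    have nn: "0 \<le> B * norm v"
      using speed[of 0] curve_speed_nonneg[of \<gamma> 0] by simp
    show ?thesis
    proof (cases "curve_speed A g \<gamma> integrable_on {0..1}")
      case True
      have "integral {0..1} (curve_speed A g \<gamma>) \<le> (1 - 0) *\<^sub>R (B * norm v)"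
        using has_integral_const_real[of "B * norm v" 0 1] speed
        by (intro has_integral_le[OF integrable_integral[OF True]]) auto
      then show ?thesis by (simp add: curve_length_def)
    qed (use nn in \<open>simp add: curve_length_def not_integrable_integral\<close>)
  qed
  ultimately show ?thesis unfolding v_def by blast
qed

lemma short_curves:
  assumes "0 < e"
  obtains W where "open W" "x \<in> W"
    "\<And>y. y \<in> W \<Longrightarrow> \<exists>\<gamma>. piecewise_C1_curve A \<gamma> \<and> \<gamma> 0 = x \<and> \<gamma> 1 = y \<and> curve_length A g \<gamma> < e"
proof -
  obtain U \<phi> where U: "(U, \<phi>) \<in> A" "x \<in> U"
    using smooth_atlas_cover[OF atlas, of x] by auto
  have hom: "homeomorphism U (\<phi> ` U) \<phi> (inv_into U \<phi>)"
    by (rule smooth_atlas_homeomorphism[OF atlas U(1)])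
  obtain r where r: "0 < r" "cball (\<phi> x) r \<subseteq> \<phi> ` U"
    using smooth_atlas_open_image[OF atlas U(1)] U(2) by (meson image_eqI open_contains_cball)
  obtain B where B: "0 < B" "\<And>z v. z \<in> cball (\<phi> x) r \<Longrightarrow>
      sqrt (g (U, \<phi>) (inv_into U \<phi> z) v v) \<le> B * norm v"
    using metric_locally_bounded[OF U(1) r(2) compact_cball] by metis
  \<comment> \<open>The radius \<open>r\<close> keeps the segment inside the chart, and
    \<open>e / B\<close> makes its length less than \<open>e\<close>.\<close>
  let ?W = "U \<inter> \<phi> -` ball (\<phi> x) (min r (e / B))"
  show thesis
  proof
    show "open ?W"
      using hom smooth_atlas_open[OF atlas U(1)]
      by (intro continuous_open_preimage) (auto simp: homeomorphism_def)
    show "x \<in> ?W" using U(2) r(1) B(1) assms by simp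
    fix y assume y: "y \<in> ?W"
    then have y': "y \<in> U" "norm (\<phi> y - \<phi> x) < r" "norm (\<phi> y - \<phi> x) < e / B"
      by (auto simp: dist_norm norm_minus_commute)
    have seg: "closed_segment (\<phi> x) (\<phi> y) \<subseteq> cball (\<phi> x) r"
      using y' r(1) by (intro closed_segment_subset) (auto simp: dist_norm norm_minus_commute)
    obtain \<gamma> where \<gamma>: "piecewise_C1_curve A \<gamma>" "\<gamma> 0 = x" "\<gamma> 1 = y"
      "curve_length A g \<gamma> \<le> B * norm (\<phi> y - \<phi> x)"
      using short_curve[OF U y'(1), of B] seg r(2) B(2) by (meson subsetD subset_trans)
    have "B * norm (\<phi> y - \<phi> x) < e" using y'(3) B(1) by (simp add: field_simps)
    then show "\<exists>\<gamma>. piecewise_C1_curve A \<gamma> \<and> \<gamma> 0 = x \<and> \<gamma> 1 = y \<and> curve_length A g \<gamma> < e"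
      using \<gamma> by (intro exI[of _ \<gamma>]) auto
  qed
qed

end

section \<open>The geodesic distance: triangle inequality, invariance, continuity\<close>

locale connected_riemannian = riemannian A g
  for A :: "('a::{t2_space, second_countable_topology}, 'n::finite) chart set"
    and g :: "('a, 'n) chart \<Rightarrow> 'a \<Rightarrow> real ^ 'n \<Rightarrow> real ^ 'n \<Rightarrow> real" +
  assumes conn: "connected (UNIV :: 'a set)"
begin

text \<open>Being joined by a curve is an equivalence relation with open classes, so connectedness
  leaves one class. This makes the infimum in \<open>geodesic_dist\<close> range over a nonempty
  set.\<close>

lemma curve_exists:
  fixes x y :: 'a
  shows "\<exists>\<gamma>. piecewise_C1_curve A \<gamma> \<and> \<gamma> 0 = x \<and> \<gamma> 1 = y"
proof -
  define R where "R = (\<lambda>x y. \<exists>\<gamma>. piecewise_C1_curve A \<gamma> \<and> \<gamma> 0 = x \<and> \<gamma> 1 = y)"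
  have R_loc: "\<exists>W. open W \<and> y \<in> W \<and> (\<forall>z\<in>W. R y z)" for y
    using short_curves[of 1 y] unfolding R_def by (metis zero_less_one)
  have R_sym: "R z y" if yz: "R y z" for y z
  proof -
    obtain \<gamma> where "piecewise_C1_curve A \<gamma>" "\<gamma> 0 = y" "\<gamma> 1 = z" using yz unfolding R_def by blast
    then show ?thesis
      unfolding R_def using piecewise_C1_curve_reverse by (intro exI[of _ "\<lambda>t. \<gamma> (-1 * t + 1)"]) auto
  qed
  have R_trans: "R y w" if yzw: "R y z" "R z w" for y z w
  proof -
    obtain \<gamma> \<eta> where "piecewise_C1_curve A \<gamma>" "\<gamma> 0 = y" "\<gamma> 1 = z"
      "piecewise_C1_curve A \<eta>" "\<eta> 0 = z" "\<eta> 1 = w" using yzw unfolding R_def by blast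
    then show ?thesis
      unfolding R_def using piecewise_C1_curve_join[of A \<gamma> \<eta>]
      by (intro exI[of _ "\<gamma> +++ \<eta>"]) (simp add: joinpaths_def)
  qed
  have "open {y. R x y}"
  proof (subst open_subopen, rule ballI)
    fix y assume "y \<in> {y. R x y}"
    moreover obtain W where "open W" "y \<in> W" "\<forall>z\<in>W. R y z" using R_loc by blast
    ultimately show "\<exists>T. open T \<and> y \<in> T \<and> T \<subseteq> {y. R x y}"
      using R_trans[of x y] by (intro exI[of _ W]) auto
  qed
  moreover have "open {y. \<not> R x y}"
  proof (subst open_subopen, rule ballI)
    fix y assume "y \<in> {y. \<not> R x y}"
    moreover obtain W where "open W" "y \<in> W" "\<forall>z\<in>W. R y z" using R_loc by blast
    ultimately show "\<exists>T. open T \<and> y \<in> T \<and> T \<subseteq> {y. \<not> R x y}"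
      using R_trans[of x _ y] R_sym[of y] by (intro exI[of _ W]) auto
  qed
  moreover have "R x x" using R_loc by blast
  moreover have "{y. R x y} \<union> {y. \<not> R x y} = UNIV" "{y. R x y} \<inter> {y. \<not> R x y} = {}" by auto
  ultimately have "{y. \<not> R x y} = {}"
    using connectedD[OF conn, of "{y. R x y}" "{y. \<not> R x y}"] by auto
  then show ?thesis unfolding R_def by blast
qed

abbreviation d where "d \<equiv> geodesic_dist A g"

lemma dist_le:
  assumes "piecewise_C1_curve A \<gamma>"
  shows "d (\<gamma> 0) (\<gamma> 1) \<le> curve_length A g \<gamma>"
  unfolding geodesic_dist_def
  by (rule cInf_lower) (use assms in \<open>auto intro!: bdd_belowI[of _ 0] simp: curve_length_nonneg\<close>)

lemma dist_greatest:
  assumes "\<And>\<gamma>. piecewise_C1_curve A \<gamma> \<Longrightarrow> \<gamma> 0 = x \<Longrightarrow> \<gamma> 1 = y \<Longrightarrow> c \<le> curve_length A g \<gamma>"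
  shows "c \<le> d x y"
  unfolding geodesic_dist_def
  by (rule cInf_greatest) (use curve_exists[of x y] assms in auto)

lemma dist_nonneg: "0 \<le> d x y"
  by (rule dist_greatest) (rule curve_length_nonneg)

lemma dist_sym: "d x y = d y x"
proof -
  have "d x y \<le> d y x" for x y
  proof (rule dist_greatest)
    fix \<gamma> assume "piecewise_C1_curve A \<gamma>" "\<gamma> 0 = y" "\<gamma> 1 = x"
    then show "d x y \<le> curve_length A g \<gamma>"
      using dist_le[OF piecewise_C1_curve_reverse, of \<gamma>] curve_length_reverse[of \<gamma>] by simp
  qed
  then show ?thesis by (simp add: order_antisym)
qed

text \<open>The infimum over each leg is taken separately, by \<open>dist_greatest\<close> with the
  other leg moved to the left side.\<close>

lemma dist_triangle: "d x z \<le> d x y + d y z"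
proof -
  have "d x z - curve_length A g \<eta> \<le> d x y"
    if \<eta>: "piecewise_C1_curve A \<eta>" "\<eta> 0 = y" "\<eta> 1 = z" for \<eta>
  proof (rule dist_greatest)
    fix \<gamma> assume \<gamma>: "piecewise_C1_curve A \<gamma>" "\<gamma> 0 = x" "\<gamma> 1 = y"
    have "d x z \<le> curve_length A g (\<gamma> +++ \<eta>)"
      using dist_le[OF piecewise_C1_curve_join[OF \<gamma>(1) \<eta>(1)]] \<gamma>(2,3) \<eta>(2,3)
      by (simp add: joinpaths_def)
    then show "d x z - curve_length A g \<eta> \<le> curve_length A g \<gamma>"
      using curve_length_join[OF \<gamma>(1) \<eta>(1)] by simp
  qed
  then have "d x z - d x y \<le> d y z" by (intro dist_greatest) (simp add: algebra_simps)
  then show ?thesis by simp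
qed

text \<open>Curves are transported by \<open>f\<close> and by \<open>inv f\<close>. The length of
  \<open>inv f \<circ> \<gamma>\<close> is found by applying \<open>f\<close> to it again, so
  invariance under \<open>f\<close> serves both directions.\<close>

lemma dist_isometry:
  assumes f: "riemannian_isometry A g f"
  shows "d (f x) (f y) = d x y"
proof (rule order_antisym)
  have bij: "bij f" and sm: "smooth_map A f" "smooth_map A (inv f)"
    by (rule f[unfolded riemannian_isometry_def, THEN conjunct1]
        f[unfolded riemannian_isometry_def, THEN conjunct2, THEN conjunct1]
        f[unfolded riemannian_isometry_def, THEN conjunct2, THEN conjunct2, THEN conjunct1])+
  show "d (f x) (f y) \<le> d x y"
  proof (rule dist_greatest)
    fix \<gamma> assume "piecewise_C1_curve A \<gamma>" "\<gamma> 0 = x" "\<gamma> 1 = y"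
    then show "d (f x) (f y) \<le> curve_length A g \<gamma>"
      using dist_le[OF piecewise_C1_curve_smooth_map[OF atlas sm(1)], of \<gamma>] curve_length_isometry[OF f, of \<gamma>] by simp
  qed
  show "d x y \<le> d (f x) (f y)"
  proof (rule dist_greatest)
    fix \<gamma> assume \<gamma>: "piecewise_C1_curve A \<gamma>" "\<gamma> 0 = f x" "\<gamma> 1 = f y"
    let ?\<eta> = "inv f \<circ> \<gamma>"
    have \<eta>: "piecewise_C1_curve A ?\<eta>" by (rule piecewise_C1_curve_smooth_map[OF atlas sm(2) \<gamma>(1)])
    have "f \<circ> ?\<eta> = \<gamma>" using bij by (auto simp: bij_is_surj surj_f_inv_f)
    then have "curve_length A g ?\<eta> = curve_length A g \<gamma>" using curve_length_isometry[OF f \<eta>] by simp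
    moreover have "?\<eta> 0 = x" "?\<eta> 1 = y" using \<gamma>(2,3) bij by (simp_all add: bij_is_inj)
    ultimately show "d x y \<le> curve_length A g \<gamma>" using dist_le[OF \<eta>] by simp
  qed
qed

text \<open>Short curves make the distance from a point small on a neighbourhood in the manifold
  topology; moving both arguments changes the distance by at most the two displacements.\<close>

lemma dist_continuous: "continuous_on UNIV (\<lambda>(x, y). d x y)"
  unfolding continuous_on_eq_continuous_at[OF open_UNIV]
proof
  fix p :: "'a \<times> 'a"
  obtain x y where p: "p = (x, y)" by (cases p)
  have "\<forall>\<^sub>F q in at p. dist (case q of (x, y) \<Rightarrow> d x y) (d x y) < e" if "0 < e" for e
  proof -
    obtain W where W: "open W" "x \<in> W" "\<And>z. z \<in> W \<Longrightarrow> \<exists>\<gamma>. piecewise_C1_curve A \<gamma> \<and> \<gamma> 0 = x \<and> \<gamma> 1 = z \<and> curve_length A g \<gamma> < e/2"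
      using short_curves[of "e/2" x] \<open>0 < e\<close> by (metis half_gt_zero)
    obtain W' where W': "open W'" "y \<in> W'" "\<And>z. z \<in> W' \<Longrightarrow> \<exists>\<gamma>. piecewise_C1_curve A \<gamma> \<and> \<gamma> 0 = y \<and> \<gamma> 1 = z \<and> curve_length A g \<gamma> < e/2"
      using short_curves[of "e/2" y] \<open>0 < e\<close> by (metis half_gt_zero)
    have "dist (d x' y') (d x y) < e" if "x' \<in> W" "y' \<in> W'" for x' y'
    proof -
      have "d x x' < e/2" using W(3)[OF that(1)] dist_le by (metis order_le_less_trans)
      moreover have "d y y' < e/2" using W'(3)[OF that(2)] dist_le by (metis order_le_less_trans)
      moreover have "d x y \<le> d x x' + d x' y' + d y' y" "d x' y' \<le> d x' x + d x y + d y y'"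
        using dist_triangle[of x y x'] dist_triangle[of x' y y'] dist_triangle[of x' y' x]
          dist_triangle[of x y' y] by linarith+
      ultimately show ?thesis using dist_sym[of x' x] dist_sym[of y' y] by (simp add: dist_real_def)
    qed
    then show ?thesis
      unfolding p eventually_at_topological using W(1,2) W'(1,2)
      by (intro exI[of _ "W \<times> W'"]) (auto intro: open_Times)
  qed
  then show "isCont (\<lambda>(x, y). d x y) p"
    unfolding continuous_at tendsto_iff by (simp add: p)
qed

end

section \<open>Integral operators on a compact space\<close>

text \<open>No metric is at hand, so equicontinuity is stated with neighbourhoods. A diagonal
  subsequence converges on a countable dense set, and finitely many neighbourhoods, each containing
  a dense point, make it uniformly Cauchy.\<close>

lemma Arzela_Ascoli_compact_space:
  fixes F :: "nat \<Rightarrow> 'a::second_countable_topology \<Rightarrow> real"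
  assumes comp: "compact (UNIV :: 'a set)"
    and bdd: "\<And>n x. \<bar>F n x\<bar> \<le> B"
    and equi: "\<And>x e. 0 < e \<Longrightarrow> \<exists>W. open W \<and> x \<in> W \<and> (\<forall>n. \<forall>y\<in>W. \<bar>F n y - F n x\<bar> \<le> e)"
  obtains r h where "strict_mono (r :: nat \<Rightarrow> nat)" "uniform_limit UNIV (\<lambda>n. F (r n)) h sequentially"
proof -
  obtain D :: "'a set" where D: "countable D" "\<And>X. open X \<Longrightarrow> X \<noteq> {} \<Longrightarrow> \<exists>d\<in>D. d \<in> X"
    using countable_dense_setE by blast
  obtain r where r: "strict_mono (r :: nat \<Rightarrow> nat)" "\<And>x. x \<in> D \<Longrightarrow> \<exists>l. (\<lambda>n. F (r n) x) \<longlonglongrightarrow> l"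
    using function_convergent_subsequence[OF D(1), of F B] bdd by (metis real_norm_def)
  have "uniformly_Cauchy_on UNIV (\<lambda>n. F (r n))"
    unfolding uniformly_Cauchy_on_def
  proof (intro allI impI)
    fix e :: real assume "0 < e"
    \<comment> \<open>Five differences of at most \<open>e/6\<close> lead from
      \<open>F (r m) y\<close> to \<open>F (r n) y\<close>, by way of \<open>x\<close> and the dense
      point \<open>d x\<close>.\<close>
    then have e6: "0 < e/6" by simp
    have "\<exists>W. open W \<and> x \<in> W \<and> (\<forall>n. \<forall>y\<in>W. \<bar>F n y - F n x\<bar> \<le> e/6)" for x
      using equi[OF e6] by blast
    then obtain W where W: "\<And>x. open (W x)" "\<And>x. x \<in> W x"
      "\<And>x n y. y \<in> W x \<Longrightarrow> \<bar>F n y - F n x\<bar> \<le> e/6"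
      by metis
    have "UNIV \<subseteq> (\<Union>x\<in>UNIV. W x)" using W(2) by blast
    with compactE_image[OF comp, of UNIV W] W(1)
    obtain X where X: "finite X" "UNIV \<subseteq> (\<Union>x\<in>X. W x)" by metis
    have "\<exists>d\<in>D. d \<in> W x" for x using D(2)[OF W(1)] W(2) by blast
    then obtain d where d: "\<And>x. d x \<in> D" "\<And>x. d x \<in> W x" by metis
    have "\<exists>M. \<forall>m\<ge>M. \<forall>n\<ge>M. \<bar>F (r m) (d x) - F (r n) (d x)\<bar> < e/6" for x
    proof -
      have "Cauchy (\<lambda>n. F (r n) (d x))"
        using r(2)[OF d(1)] LIMSEQ_imp_Cauchy by blast
      from metric_CauchyD[OF this e6] show ?thesis by (simp add: dist_real_def)
    qed
    then obtain M where M: "\<And>x m n. m \<ge> M x \<Longrightarrow> n \<ge> M x \<Longrightarrow> \<bar>F (r m) (d x) - F (r n) (d x)\<bar> < e/6"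
      by metis
    have "dist (F (r m) y) (F (r n) y) < e" if "m \<ge> Max (M ` X)" "n \<ge> Max (M ` X)" for m n y
    proof -
      obtain x where x: "x \<in> X" "y \<in> W x" using X(2) by blast
      have "M x \<le> Max (M ` X)" using X(1) x(1) by (intro Max_ge) auto
      then have "m \<ge> M x" "n \<ge> M x" using that by linarith+
      then show ?thesis
        using M[of x m n] W(3)[OF x(2), of "r m"] W(3)[OF x(2), of "r n"]
          W(3)[OF d(2), of "r m" x] W(3)[OF d(2), of "r n" x]
        unfolding dist_real_def by linarith
    qed
    then show "\<exists>M. \<forall>x\<in>UNIV. \<forall>m\<ge>M. \<forall>n\<ge>M. dist (F (r m) x) (F (r n) x) < e" by blast
  qed
  then have "uniformly_convergent_on UNIV (\<lambda>n. F (r n))" by (rule Cauchy_uniformly_convergent)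
  then show thesis using that[OF r(1)] unfolding uniformly_convergent_on_def by blast
qed

locale compact_measure_space = finite_measure \<mu>
  for \<mu> :: "'a::{t2_space, second_countable_topology} measure" +
  assumes sets_eq: "sets \<mu> = sets borel" and comp: "compact (UNIV :: 'a set)"
begin

lemma space_eq [simp]: "space \<mu> = UNIV"
  using sets_eq_imp_space_eq[OF sets_eq] by simp

lemma continuous_imp_measurable:
  "continuous_on UNIV f \<Longrightarrow> f \<in> borel_measurable \<mu>" for f :: "'a \<Rightarrow> 'b::topological_space"
  unfolding measurable_cong_sets[OF sets_eq refl] by (rule borel_measurable_continuous_onI)

lemma continuous_bounded:
  fixes f :: "'a \<Rightarrow> real"
  assumes "continuous_on UNIV f"
  obtains B where "0 < B" "\<And>x. \<bar>f x\<bar> \<le> B"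
  using compact_imp_bounded[OF compact_continuous_image[OF assms comp]] unfolding bounded_pos by auto

lemma continuous_imp_integrable:
  fixes f :: "'a \<Rightarrow> real"
  assumes "continuous_on UNIV f"
  shows "integrable \<mu> f"
proof -
  obtain B where "\<And>x. \<bar>f x\<bar> \<le> B" using continuous_bounded[OF assms] by metis
  then show ?thesis by (intro integrable_const_bound[of _ B] continuous_imp_measurable assms) auto
qed

lemma continuous_imp_L2:
  assumes "continuous_on UNIV f"
  shows "in_L2 \<mu> f"
  unfolding in_L2_def
  by (intro conjI continuous_imp_measurable continuous_imp_integrable continuous_intros assms)

lemma L2_measurable: "in_L2 \<mu> f \<Longrightarrow> f \<in> borel_measurable \<mu>"
  unfolding in_L2_def by (rule conjunct1)

lemma L2_square_integrable: "in_L2 \<mu> f \<Longrightarrow> integrable \<mu> (\<lambda>x. (f x)\<^sup>2)"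
  unfolding in_L2_def by (rule conjunct2)

lemma L2_mult_integrable:
  assumes "in_L2 \<mu> f" "in_L2 \<mu> h"
  shows "integrable \<mu> (\<lambda>x. f x * h x)"
proof (rule Bochner_Integration.integrable_bound)
  show "integrable \<mu> (\<lambda>x. (f x)\<^sup>2 + (h x)\<^sup>2)" using assms unfolding in_L2_def by simp
  show "(\<lambda>x. f x * h x) \<in> borel_measurable \<mu>"
    by (intro borel_measurable_times L2_measurable assms)
  have "\<bar>a * b\<bar> \<le> a\<^sup>2 + b\<^sup>2" for a b :: real
  proof -
    have "2 * \<bar>a\<bar> * \<bar>b\<bar> \<le> a\<^sup>2 + b\<^sup>2" using sum_squares_bound[of "\<bar>a\<bar>" "\<bar>b\<bar>"] by simp
    moreover have "0 \<le> \<bar>a\<bar> * \<bar>b\<bar>" by simp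
    ultimately show ?thesis unfolding abs_mult by linarith
  qed
  then show "AE x in \<mu>. norm (f x * h x) \<le> norm ((f x)\<^sup>2 + (h x)\<^sup>2)" by simp
qed

lemma L2_const: "in_L2 \<mu> (\<lambda>x. c)"
  unfolding in_L2_def by simp

lemma L2_integrable:
  assumes "in_L2 \<mu> f"
  shows "integrable \<mu> f"
  using L2_mult_integrable[OF assms L2_const[of 1]] by simp

lemma L2_scale: "in_L2 \<mu> f \<Longrightarrow> in_L2 \<mu> (\<lambda>x. c * f x)"
  unfolding in_L2_def by (auto simp: power_mult_distrib)

lemma L2_add:
  assumes "in_L2 \<mu> f" "in_L2 \<mu> h"
  shows "in_L2 \<mu> (\<lambda>x. f x + h x)"
  unfolding in_L2_def
proof
  show "(\<lambda>x. f x + h x) \<in> borel_measurable \<mu>"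
    by (intro borel_measurable_add L2_measurable assms)
  have "integrable \<mu> (\<lambda>x. (f x)\<^sup>2 + (h x)\<^sup>2 + 2 * (f x * h x))"
    by (intro Bochner_Integration.integrable_add integrable_mult_right
        L2_square_integrable L2_mult_integrable assms)
  then show "integrable \<mu> (\<lambda>x. (f x + h x)\<^sup>2)" by (simp add: power2_sum mult.assoc)
qed

lemma L2_diff:
  assumes "in_L2 \<mu> f" "in_L2 \<mu> h"
  shows "in_L2 \<mu> (\<lambda>x. f x - h x)"
  using L2_add[OF assms(1) L2_scale[OF assms(2), of "-1"]] by simp

section \<open>The L2 pairing on representatives\<close>

definition ip :: "('a \<Rightarrow> real) \<Rightarrow> ('a \<Rightarrow> real) \<Rightarrow> real" where
  "ip f h = (\<integral>x. f x * h x \<partial>\<mu>)"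

lemma ip_commute: "ip f h = ip h f"
  unfolding ip_def by (simp add: mult.commute)

lemma ip_self: "ip f f = (\<integral>x. (f x)\<^sup>2 \<partial>\<mu>)"
  unfolding ip_def by (simp add: power2_eq_square)

lemma ip_nonneg: "0 \<le> ip f f"
  unfolding ip_self by (rule integral_nonneg_AE) simp

lemma ip_add:
  assumes "in_L2 \<mu> f" "in_L2 \<mu> h" "in_L2 \<mu> k"
  shows "ip (\<lambda>x. f x + h x) k = ip f k + ip h k" "ip k (\<lambda>x. f x + h x) = ip k f + ip k h"
  unfolding ip_def using L2_mult_integrable assms
  by (simp_all add: algebra_simps Bochner_Integration.integral_add)

lemma ip_diff:
  assumes "in_L2 \<mu> f" "in_L2 \<mu> h" "in_L2 \<mu> k"
  shows "ip (\<lambda>x. f x - h x) k = ip f k - ip h k" "ip k (\<lambda>x. f x - h x) = ip k f - ip k h"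
  unfolding ip_def using L2_mult_integrable assms
  by (simp_all add: algebra_simps Bochner_Integration.integral_diff)

lemma ip_scale: "ip (\<lambda>x. c * f x) h = c * ip f h" "ip f (\<lambda>x. c * h x) = c * ip f h"
  unfolding ip_def by (simp_all add: mult.assoc mult.left_commute)

lemma ip_AE_cong:
  assumes "in_L2 \<mu> f" "in_L2 \<mu> f'" "in_L2 \<mu> h" "AE x in \<mu>. f x = f' x"
  shows "ip f h = ip f' h"
  unfolding ip_def using assms L2_mult_integrable
  by (intro integral_cong_AE) (auto simp: in_L2_def)

lemma ip_self_eq_0_iff:
  assumes "in_L2 \<mu> f"
  shows "ip f f = 0 \<longleftrightarrow> (AE x in \<mu>. f x = 0)"
  unfolding ip_self using assms unfolding in_L2_def
  by (subst integral_nonneg_eq_0_iff_AE) auto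

lemma ip_Cauchy_Schwarz:
  assumes "in_L2 \<mu> f" "in_L2 \<mu> h"
  shows "(ip f h)\<^sup>2 \<le> ip f f * ip h h"
proof (cases "ip h h = 0")
  case True
  then have "AE x in \<mu>. f x * h x = 0" using ip_self_eq_0_iff[OF assms(2)] by auto
  then have "ip f h = 0" unfolding ip_def by (rule integral_eq_zero_AE)
  then show ?thesis using ip_nonneg by simp
next
  case False
  then have pos: "0 < ip h h" using ip_nonneg[of h] by simp
  define s where "s = ip f h / ip h h"
  have "0 \<le> ip (\<lambda>x. f x - s * h x) (\<lambda>x. f x - s * h x)" by (rule ip_nonneg)
  also have "\<dots> = ip f f - 2 * s * ip f h + s * s * ip h h"
    using assms by (simp add: ip_diff ip_scale L2_scale L2_diff ip_commute[of h f] algebra_simps)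
  also have "\<dots> = ip f f - (ip f h)\<^sup>2 / ip h h"
    using pos by (simp add: s_def field_simps power2_eq_square)
  finally show ?thesis using pos by (simp add: field_simps)
qed

lemma L2_integral_abs_le:
  assumes "in_L2 \<mu> f"
  shows "(\<integral>x. \<bar>f x\<bar> \<partial>\<mu>)\<^sup>2 \<le> measure \<mu> UNIV * ip f f"
proof -
  have "in_L2 \<mu> (\<lambda>x. \<bar>f x\<bar>)" using assms unfolding in_L2_def by auto
  from ip_Cauchy_Schwarz[OF this L2_const[of 1]]
  show ?thesis by (simp add: ip_def power2_eq_square mult.commute flip: abs_mult)
qed

section \<open>Operators with a continuous symmetric kernel\<close>

definition kop :: "('a \<Rightarrow> 'a \<Rightarrow> real) \<Rightarrow> ('a \<Rightarrow> real) \<Rightarrow> 'a \<Rightarrow> real" where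
  "kop k f x = (\<integral>y. k x y * f y \<partial>\<mu>)"

definition sym_kernel :: "('a \<Rightarrow> 'a \<Rightarrow> real) \<Rightarrow> bool" where
  "sym_kernel k \<longleftrightarrow> continuous_on UNIV (\<lambda>(x, y). k x y) \<and> (\<forall>x y. k x y = k y x)"

lemma kernel_commute: "sym_kernel k \<Longrightarrow> k x y = k y x"
  unfolding sym_kernel_def by blast

lemma kernel_continuous: "sym_kernel k \<Longrightarrow> continuous_on UNIV (k x)"
  using continuous_on_compose2[of UNIV "\<lambda>(x, y). k x y" UNIV "\<lambda>y. (x, y)"]
  unfolding sym_kernel_def by (simp add: continuous_on_Pair)

lemma kernel_bounded:
  assumes "sym_kernel k"
  obtains B where "0 < B" "\<And>x y. \<bar>k x y\<bar> \<le> B"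
proof -
  have "compact (UNIV :: ('a \<times> 'a) set)"
    using compact_Times[OF comp comp] by simp
  moreover have "continuous_on UNIV (\<lambda>(x, y). k x y)" using assms by (simp add: sym_kernel_def)
  ultimately have "bounded (range (\<lambda>(x, y). k x y))"
    using compact_continuous_image compact_imp_bounded by blast
  then show thesis using that unfolding bounded_pos by auto
qed

text \<open>Compactness in \<open>y\<close> makes the neighbourhood uniform. Hence the images under
  K of functions with bounded L1 norm are equicontinuous.\<close>

lemma kernel_equicontinuous:
  assumes "sym_kernel k" "0 < e"
  shows "\<exists>W. open W \<and> x \<in> W \<and> (\<forall>x'\<in>W. \<forall>y. \<bar>k x' y - k x y\<bar> \<le> e)"
proof -
  have "continuous_on (UNIV \<times> UNIV) (\<lambda>(x, y). k x y)" using assms by (simp add: sym_kernel_def)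
  from continuous_on_prod_compactE[OF this comp UNIV_I assms(2), of x]
  obtain W where "x \<in> W" "open W" "\<forall>x'\<in>W \<inter> UNIV. \<forall>y\<in>UNIV. dist (k x' y) (k x y) \<le> e"
    by (metis (no_types, lifting) case_prod_conv)
  then show ?thesis by (intro exI[of _ W]) (simp add: dist_real_def)
qed

lemma kernel_mult_integrable:
  assumes "sym_kernel k" "integrable \<mu> f"
  shows "integrable \<mu> (\<lambda>y. k x y * f y)"
proof -
  obtain B where B: "\<And>x y. \<bar>k x y\<bar> \<le> B" using kernel_bounded[OF assms(1)] by metis
  show ?thesis
  proof (rule Bochner_Integration.integrable_bound)
    show "integrable \<mu> (\<lambda>y. B * f y)" using assms(2) by simp
    show "(\<lambda>y. k x y * f y) \<in> borel_measurable \<mu>"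
      using continuous_imp_measurable[OF kernel_continuous[OF assms(1)]] assms(2) by measurable
    show "AE y in \<mu>. norm (k x y * f y) \<le> norm (B * f y)"
      using order_trans[OF B abs_ge_self] by (simp add: abs_mult mult_right_mono)
  qed
qed

lemma kop_add:
  assumes "sym_kernel k" "integrable \<mu> f" "integrable \<mu> h"
  shows "kop k (\<lambda>x. f x + h x) x = kop k f x + kop k h x"
  unfolding kop_def using kernel_mult_integrable assms
  by (simp add: algebra_simps Bochner_Integration.integral_add)

lemma kop_diff:
  assumes "sym_kernel k" "integrable \<mu> f" "integrable \<mu> h"
  shows "kop k (\<lambda>x. f x - h x) x = kop k f x - kop k h x"
  unfolding kop_def using kernel_mult_integrable assms
  by (simp add: algebra_simps Bochner_Integration.integral_diff)

lemma kop_scale: "kop k (\<lambda>x. c * f x) x = c * kop k f x"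
  unfolding kop_def by (simp add: mult.left_commute)

lemma kop_bound:
  assumes B: "\<And>x y. \<bar>k x y\<bar> \<le> B" and k: "sym_kernel k" and f: "integrable \<mu> f"
  shows "\<bar>kop k f x\<bar> \<le> B * (\<integral>y. \<bar>f y\<bar> \<partial>\<mu>)"
proof -
  have "\<bar>kop k f x\<bar> \<le> (\<integral>y. \<bar>k x y * f y\<bar> \<partial>\<mu>)"
    unfolding kop_def using integral_norm_bound[of \<mu> "\<lambda>y. k x y * f y"] by simp
  also have "\<dots> \<le> (\<integral>y. B * \<bar>f y\<bar> \<partial>\<mu>)"
  proof (rule integral_mono)
    show "integrable \<mu> (\<lambda>y. \<bar>k x y * f y\<bar>)"
      by (intro integrable_abs kernel_mult_integrable[OF k f])
    show "\<bar>k x y * f y\<bar> \<le> B * \<bar>f y\<bar>" for y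
      using B[of x y] by (simp add: abs_mult mult_right_mono)
  qed (use f in simp)
  finally show ?thesis by simp
qed

lemma kop_equicontinuous:
  assumes W: "\<And>y. \<bar>k x' y - k x y\<bar> \<le> e" and k: "sym_kernel k" and f: "integrable \<mu> f"
  shows "\<bar>kop k f x' - kop k f x\<bar> \<le> e * (\<integral>y. \<bar>f y\<bar> \<partial>\<mu>)"
proof -
  have "kop k f x' - kop k f x = (\<integral>y. k x' y * f y - k x y * f y \<partial>\<mu>)"
    unfolding kop_def using kernel_mult_integrable[OF k f] by simp
  then have "\<bar>kop k f x' - kop k f x\<bar> \<le> (\<integral>y. \<bar>k x' y * f y - k x y * f y\<bar> \<partial>\<mu>)"
    using integral_norm_bound[of \<mu> "\<lambda>y. k x' y * f y - k x y * f y"] by simp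
  also have "\<dots> \<le> (\<integral>y. e * \<bar>f y\<bar> \<partial>\<mu>)"
  proof (rule integral_mono)
    show "integrable \<mu> (\<lambda>y. \<bar>k x' y * f y - k x y * f y\<bar>)"
      by (intro integrable_abs Bochner_Integration.integrable_diff kernel_mult_integrable[OF k f])
    show "\<bar>k x' y * f y - k x y * f y\<bar> \<le> e * \<bar>f y\<bar>" for y
      using W[of y] by (simp add: abs_mult left_diff_distrib[symmetric] mult_right_mono)
  qed (use f in simp)
  finally show ?thesis by simp
qed

lemma kop_continuous:
  assumes k: "sym_kernel k" and f: "integrable \<mu> f"
  shows "continuous_on UNIV (kop k f)"
  unfolding continuous_on_eq_continuous_at[OF open_UNIV] continuous_at tendsto_iff
proof (intro ballI allI impI)
  fix x and e :: real assume "0 < e"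
  define I where "I = (\<integral>y. \<bar>f y\<bar> \<partial>\<mu>)"
  have I: "0 \<le> I" unfolding I_def by (rule integral_nonneg_AE) simp
  have "0 < e / (I + 1)" using I \<open>0 < e\<close> by simp
  from kernel_equicontinuous[OF k this] obtain W where
    W: "open W" "x \<in> W" "\<And>x' y. x' \<in> W \<Longrightarrow> \<bar>k x' y - k x y\<bar> \<le> e / (I + 1)" by metis
  have "dist (kop k f x') (kop k f x) < e" if "x' \<in> W" for x'
  proof -
    have "\<bar>kop k f x' - kop k f x\<bar> \<le> e / (I + 1) * I"
      using kop_equicontinuous[OF W(3)[OF that] k f] by (simp add: I_def)
    also have "\<dots> < e" using I \<open>0 < e\<close> by (simp add: field_simps)
    finally show ?thesis by (simp add: dist_real_def)
  qed
  then show "\<forall>\<^sub>F x' in at x. dist (kop k f x') (kop k f x) < e"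
    using W(1,2) unfolding eventually_at_topological by blast
qed

lemma kop_L2: "sym_kernel k \<Longrightarrow> integrable \<mu> f \<Longrightarrow> in_L2 \<mu> (kop k f)"
  by (intro continuous_imp_L2 kop_continuous)

text \<open>Fubini, with the integrand dominated by a multiple of \<open>f x * h y\<close>. As the
  kernel is bounded this works on L1, so that squares of L2 functions may be inserted later.\<close>

lemma kop_symmetric:
  assumes k: "sym_kernel k" and f: "integrable \<mu> f" and h: "integrable \<mu> h"
  shows "ip (kop k f) h = ip f (kop k h)"
proof -
  interpret P: pair_sigma_finite \<mu> \<mu> ..
  obtain B where B: "\<And>x y. \<bar>k x y\<bar> \<le> B" using kernel_bounded[OF k] by metis
  have km: "(\<lambda>(x, y). k x y) \<in> borel_measurable (\<mu> \<Otimes>\<^sub>M \<mu>)"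
  proof -
    \<comment> \<open>By second countability the product of the Borel algebras is the Borel algebra
      of the product, so a continuous kernel is jointly measurable.\<close>
    have "sets (\<mu> \<Otimes>\<^sub>M \<mu>) = sets (borel \<Otimes>\<^sub>M borel)" by (intro sets_pair_measure_cong sets_eq)
    also have "\<dots> = sets (borel :: ('a \<times> 'a) measure)" by (simp only: borel_prod)
    finally have eq: "sets (\<mu> \<Otimes>\<^sub>M \<mu>) = sets (borel :: ('a \<times> 'a) measure)" .
    show ?thesis
      unfolding measurable_cong_sets[OF eq refl]
      by (rule borel_measurable_continuous_onI) (use k in \<open>simp add: sym_kernel_def\<close>)
  qed
  have fm [measurable]: "f \<in> borel_measurable \<mu>" and hm [measurable]: "h \<in> borel_measurable \<mu>"
    using f h by auto
  have int: "integrable (\<mu> \<Otimes>\<^sub>M \<mu>) (\<lambda>p. f (fst p) * h (snd p))"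
  proof (rule P.Fubini_integrable)
    show "integrable \<mu> (\<lambda>x. \<integral>y. norm (f (fst (x, y)) * h (snd (x, y))) \<partial>\<mu>)"
      using f by (simp add: abs_mult)
    show "AE x in \<mu>. integrable \<mu> (\<lambda>y. f (fst (x, y)) * h (snd (x, y)))" using h by simp
  qed measurable
  have "integrable (\<mu> \<Otimes>\<^sub>M \<mu>) (\<lambda>(x, y). k x y * f x * h y)"
  proof (rule Bochner_Integration.integrable_bound)
    show "integrable (\<mu> \<Otimes>\<^sub>M \<mu>) (\<lambda>p. B * (f (fst p) * h (snd p)))" using int by simp
    show "(\<lambda>(x, y). k x y * f x * h y) \<in> borel_measurable (\<mu> \<Otimes>\<^sub>M \<mu>)"
      using km by measurable
    show "AE p in \<mu> \<Otimes>\<^sub>M \<mu>. norm (case p of (x, y) \<Rightarrow> k x y * f x * h y)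
        \<le> norm (B * (f (fst p) * h (snd p)))"
      using order_trans[OF B abs_ge_self]
      by (simp add: case_prod_beta abs_mult mult.assoc mult_right_mono)
  qed
  from P.Fubini_integral[OF this]
  have "(\<integral>y. \<integral>x. k x y * f x * h y \<partial>\<mu> \<partial>\<mu>) = (\<integral>x. \<integral>y. k x y * f x * h y \<partial>\<mu> \<partial>\<mu>)" .
  moreover have "(\<integral>x. k x y * f x * h y \<partial>\<mu>) = kop k f y * h y" for y
    unfolding kop_def using kernel_commute[OF k] by simp
  moreover have "(\<integral>y. k x y * f x * h y \<partial>\<mu>) = f x * kop k h x" for x
    unfolding kop_def by (simp add: mult.assoc mult.left_commute)
  ultimately show ?thesis unfolding ip_def by (simp only:)
qed

lemma kop_ip_bound:
  assumes k: "sym_kernel k"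
  obtains C where "0 < C" "\<And>f. in_L2 \<mu> f \<Longrightarrow> \<bar>ip (kop k f) f\<bar> \<le> C * ip f f"
proof -
  obtain B where B: "0 < B" "\<And>x y. \<bar>k x y\<bar> \<le> B" using kernel_bounded[OF k] by metis
  show thesis
  proof
    \<comment> \<open>The summand 1 keeps the constant positive even if the measure is zero.\<close>
    show "0 < B * measure \<mu> UNIV + 1" using B(1) by (simp add: add_nonneg_pos)
    fix f assume f: "in_L2 \<mu> f"
    note fi = L2_integrable[OF f]
    define I where "I = (\<integral>x. \<bar>f x\<bar> \<partial>\<mu>)"
    have "\<bar>ip (kop k f) f\<bar> \<le> (\<integral>x. \<bar>kop k f x * f x\<bar> \<partial>\<mu>)"
      unfolding ip_def using integral_norm_bound[of \<mu> "\<lambda>x. kop k f x * f x"] by simp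
    also have "\<dots> \<le> (\<integral>x. (B * I) * \<bar>f x\<bar> \<partial>\<mu>)"
    proof (rule integral_mono)
      show "integrable \<mu> (\<lambda>x. \<bar>kop k f x * f x\<bar>)"
        by (intro integrable_abs L2_mult_integrable kop_L2 k fi f)
      show "\<bar>kop k f x * f x\<bar> \<le> (B * I) * \<bar>f x\<bar>" for x
        using kop_bound[OF B(2) k fi, of x] by (simp add: abs_mult mult_right_mono I_def)
    qed (use fi in simp)
    also have "\<dots> = B * I\<^sup>2" by (simp add: I_def power2_eq_square)
    also have "\<dots> \<le> B * (measure \<mu> UNIV * ip f f)"
      using L2_integral_abs_le[OF f] B(1) by (simp add: I_def)
    also have "\<dots> \<le> (B * measure \<mu> UNIV + 1) * ip f f"
      using ip_nonneg[of f] by (simp add: algebra_simps)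
    finally show "\<bar>ip (kop k f) f\<bar> \<le> (B * measure \<mu> UNIV + 1) * ip f f" .
  qed
qed

section \<open>The supremum of the quadratic form as an eigenvalue\<close>

lemma kop_scale_ip: "ip (kop k (\<lambda>x. c * f x)) (\<lambda>x. c * f x) = c\<^sup>2 * ip (kop k f) f"
proof -
  have "kop k (\<lambda>x. c * f x) = (\<lambda>x. c * kop k f x)" by (rule ext) (rule kop_scale)
  then show ?thesis by (simp add: ip_scale power2_eq_square)
qed

text \<open>An almost maximizer \<open>f\<close> of the quadratic form is an almost eigenvector: the first variation
  in the direction of the residual \<open>K f - m f\<close> would otherwise push the form above \<open>m\<close>.\<close>

lemma almost_eigenvector:
  assumes k: "sym_kernel k" and f: "in_L2 \<mu> f" and le: "ip f f \<le> 1" and m: "0 \<le> m"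
    and C: "0 < C" "\<And>f. in_L2 \<mu> f \<Longrightarrow> \<bar>ip (kop k f) f\<bar> \<le> C * ip f f"
    and top: "\<And>f. in_L2 \<mu> f \<Longrightarrow> ip (kop k f) f \<le> m * ip f f"
  defines "\<psi> \<equiv> \<lambda>x. kop k f x - m * f x"
  shows "ip \<psi> \<psi> \<le> (m + C) * (m - ip (kop k f) f)"
proof -
  note kf = kop_L2[OF k L2_integrable[OF f]]
  have \<psi>: "in_L2 \<mu> \<psi>" unfolding \<psi>_def by (intro L2_diff L2_scale f kf)
  note k\<psi> = kop_L2[OF k L2_integrable[OF \<psi>]]
  \<comment> \<open>This step length maximizes \<open>2 * s - s\<^sup>2 * (m + C)\<close>, the
    coefficient of \<open>p\<close> gained by moving from \<open>f\<close> to
    \<open>f + s \<psi>\<close>.\<close>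
  define s where "s = 1 / (m + C)"
  have s: "0 < s" using m C(1) by (simp add: s_def)
  define p where "p = ip \<psi> \<psi>"
  have sym: "ip (kop k \<psi>) f = ip (kop k f) \<psi>"
    using kop_symmetric[OF k L2_integrable[OF \<psi>] L2_integrable[OF f]] ip_commute by simp
  have p: "p = ip (kop k f) \<psi> - m * ip f \<psi>"
  proof -
    have "p = ip (\<lambda>x. kop k f x - m * f x) \<psi>" unfolding p_def by (subst (1) \<psi>_def) simp
    then show ?thesis by (simp add: ip_diff ip_scale kf f \<psi> L2_scale)
  qed
  have "kop k (\<lambda>x. f x + s * \<psi> x) = (\<lambda>x. kop k f x + s * kop k \<psi> x)"
    using L2_integrable f \<psi> by (intro ext) (simp add: kop_add[OF k] kop_scale)
  then have "ip (kop k (\<lambda>x. f x + s * \<psi> x)) (\<lambda>x. f x + s * \<psi> x)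
      = ip (kop k f) f + 2 * s * ip (kop k f) \<psi> + s\<^sup>2 * ip (kop k \<psi>) \<psi>"
    using f \<psi> kf k\<psi> by (simp add: ip_add ip_scale L2_scale L2_add sym power2_eq_square algebra_simps)
  moreover have "ip (\<lambda>x. f x + s * \<psi> x) (\<lambda>x. f x + s * \<psi> x) = ip f f + 2 * s * ip f \<psi> + s\<^sup>2 * p"
    using f \<psi> by (simp add: ip_add ip_scale L2_scale L2_add ip_commute[of \<psi> f] power2_eq_square
        p_def algebra_simps)
  ultimately have "ip (kop k f) f + 2 * s * ip (kop k f) \<psi> + s\<^sup>2 * ip (kop k \<psi>) \<psi>
      \<le> m * (ip f f + 2 * s * ip f \<psi> + s\<^sup>2 * p)"
    using top[of "\<lambda>x. f x + s * \<psi> x"] f \<psi> by (simp add: L2_add L2_scale)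
  moreover have "m * ip f f \<le> m" using le m by (simp add: mult_left_le)
  moreover have "- (C * p) \<le> ip (kop k \<psi>) \<psi>" using C(2)[OF \<psi>] unfolding p_def by linarith
  then have "s\<^sup>2 * (- (C * p)) \<le> s\<^sup>2 * ip (kop k \<psi>) \<psi>" by (intro mult_left_mono) auto
  ultimately have "2 * s * p \<le> (m - ip (kop k f) f) + s\<^sup>2 * ((m + C) * p)"
    unfolding p by (simp add: algebra_simps)
  also have "s\<^sup>2 * ((m + C) * p) = s * p" using m C(1) by (simp add: s_def power2_eq_square)
  finally have "s * p \<le> m - ip (kop k f) f" by (simp add: mult.commute)
  then show ?thesis using m C(1) unfolding s_def p_def by (simp add: field_simps)
qed

text \<open>For a maximizing sequence \<open>f n\<close> the images \<open>G n = K (f n)\<close> are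
  bounded and equicontinuous, so a subsequence converges uniformly to some \<open>h\<close>. The
  residuals \<open>G n - m f n\<close> tend to 0 in L2, which yields \<open>K h = m h\<close>.
  Taking the limit of \<open>K (f n)\<close> instead of \<open>f n\<close> gives a continuous
  eigenfunction and an equation at every point.\<close>

lemma top_eigenvalue:
  assumes k: "sym_kernel k" and f0: "in_L2 \<mu> f0" "0 < ip (kop k f0) f0"
  obtains m e where "0 < m" "continuous_on UNIV e" "kop k e = (\<lambda>x. m * e x)" "ip e e = 1"
    "\<And>f. in_L2 \<mu> f \<Longrightarrow> ip (kop k f) f \<le> m * ip f f"
proof -
  obtain B where B: "0 < B" "\<And>x y. \<bar>k x y\<bar> \<le> B" using kernel_bounded[OF k] by metis
  obtain C where C: "0 < C" "\<And>f. in_L2 \<mu> f \<Longrightarrow> \<bar>ip (kop k f) f\<bar> \<le> C * ip f f"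
    using kop_ip_bound[OF k] by metis
  \<comment> \<open>The unit ball, not the sphere: it contains 0, so the supremum is over a nonempty
    set. That \<open>m\<close> is positive comes from \<open>f0\<close>.\<close>
  define R where "R = {ip (kop k f) f | f. in_L2 \<mu> f \<and> ip f f \<le> 1}"
  define m where "m = Sup R"
  have bdd: "bdd_above R"
  proof (rule bdd_aboveI)
    fix a assume "a \<in> R"
    then obtain f where f: "in_L2 \<mu> f" "ip f f \<le> 1" "a = ip (kop k f) f" unfolding R_def by auto
    have "a \<le> C * ip f f" using C(2)[OF f(1)] f(3) by simp
    also have "\<dots> \<le> C" using f(2) C(1) by (simp add: mult_left_le)
    finally show "a \<le> C" .
  qed
  have top: "ip (kop k f) f \<le> m * ip f f" if f: "in_L2 \<mu> f" for f
  proof (cases "ip f f = 0")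
    case True
    then show ?thesis using C(2)[OF f] by simp
  next
    case False
    then have pos: "0 < ip f f" using ip_nonneg[of f] by simp
    define c where "c = 1 / sqrt (ip f f)"
    have c2: "c\<^sup>2 = 1 / ip f f" using pos by (simp add: c_def power_divide)
    have "ip (\<lambda>x. c * f x) (\<lambda>x. c * f x) = c\<^sup>2 * ip f f" by (simp add: ip_scale power2_eq_square)
    then have "ip (kop k (\<lambda>x. c * f x)) (\<lambda>x. c * f x) \<in> R"
      unfolding R_def using L2_scale[OF f, of c] pos c2 by auto
    then have "c\<^sup>2 * ip (kop k f) f \<le> m"
      unfolding m_def kop_scale_ip using bdd by (rule cSup_upper)
    then show ?thesis using pos by (simp add: c2 field_simps)
  qed
  have "0 < m * ip f0 f0" using top[OF f0(1)] f0(2) by linarith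
  then have m: "0 < m" using ip_nonneg[of f0] by (simp add: zero_less_mult_iff)
  have "R \<noteq> {}" unfolding R_def using L2_const[of 0] by (auto simp: ip_def intro!: exI[of _ "\<lambda>x. 0"])
  then have "\<exists>f. in_L2 \<mu> f \<and> ip f f \<le> 1 \<and> m - inverse (real (Suc n)) < ip (kop k f) f" for n
    using less_cSup_iff[OF _ bdd, of "m - inverse (real (Suc n))"] unfolding m_def[symmetric]
    by (auto simp: R_def)
  then obtain f where f: "\<And>n. in_L2 \<mu> (f n)" "\<And>n. ip (f n) (f n) \<le> 1"
    "\<And>n. m - inverse (real (Suc n)) < ip (kop k (f n)) (f n)" by metis
  define G where "G = (\<lambda>n. kop k (f n))"
  define \<psi> where "\<psi> = (\<lambda>n x. G n x - m * f n x)"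
  define I where "I = sqrt (measure \<mu> UNIV)"
  have abs_le: "(\<integral>x. \<bar>h x\<bar> \<partial>\<mu>) \<le> I * sqrt (ip h h)" if "in_L2 \<mu> h" for h
    using real_le_rsqrt[OF L2_integral_abs_le[OF that]] by (simp add: I_def real_sqrt_mult)
  have I: "0 \<le> I" by (simp add: I_def)
  have fI: "(\<integral>x. \<bar>f n x\<bar> \<partial>\<mu>) \<le> I" for n
    using abs_le[OF f(1)[of n]] f(2)[of n] I mult_left_le[of "sqrt (ip (f n) (f n))" I] by simp
  have Gc: "continuous_on UNIV (G n)" for n
    unfolding G_def by (intro kop_continuous k L2_integrable f)
  have GL: "in_L2 \<mu> (G n)" for n by (rule continuous_imp_L2[OF Gc])
  have \<psi>L: "in_L2 \<mu> (\<psi> n)" for n unfolding \<psi>_def by (intro L2_diff L2_scale GL f)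
  have Gb: "\<bar>G n x\<bar> \<le> B * I" for n x
  proof -
    have "\<bar>G n x\<bar> \<le> B * (\<integral>x. \<bar>f n x\<bar> \<partial>\<mu>)"
      unfolding G_def by (rule kop_bound[OF B(2) k L2_integrable[OF f(1)]])
    also have "\<dots> \<le> B * I" using fI B(1) by simp
    finally show ?thesis .
  qed
  have equi: "\<exists>W. open W \<and> x \<in> W \<and> (\<forall>n. \<forall>y\<in>W. \<bar>G n y - G n x\<bar> \<le> e)" if "0 < e" for x e
  proof -
    have pos: "0 < e / (I + 1)" using that I by simp
    obtain W where W: "open W" "x \<in> W" "\<And>x' y. x' \<in> W \<Longrightarrow> \<bar>k x' y - k x y\<bar> \<le> e / (I + 1)"
      using kernel_equicontinuous[OF k pos] by metis
    have "\<bar>G n y - G n x\<bar> \<le> e" if "y \<in> W" for n y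
    proof -
      have "\<bar>G n y - G n x\<bar> \<le> e / (I + 1) * (\<integral>x. \<bar>f n x\<bar> \<partial>\<mu>)"
        unfolding G_def by (rule kop_equicontinuous[OF W(3)[OF that] k L2_integrable[OF f(1)]])
      also have "\<dots> \<le> e / (I + 1) * (I + 1)"
        using fI[of n] pos by (intro mult_left_mono) auto
      also have "\<dots> = e" using I by simp
      finally show ?thesis .
    qed
    then show ?thesis using W(1,2) by blast
  qed
  obtain r h where r: "strict_mono (r :: nat \<Rightarrow> nat)"
    and h: "uniform_limit UNIV (\<lambda>n. G (r n)) h sequentially"
    using Arzela_Ascoli_compact_space[OF comp Gb equi] by metis
  have hc: "continuous_on UNIV h"
    by (rule uniform_limit_theorem[OF _ h]) (use Gc in auto)
  have h_lim: "(\<lambda>n. G (r n) x) \<longlonglongrightarrow> h x" for x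
    by (rule tendsto_uniform_limitI[OF h]) simp
  have "(\<lambda>n. inverse (real (Suc n))) \<longlonglongrightarrow> 0" by (rule LIMSEQ_inverse_real_of_nat)
  then have inv: "(\<lambda>n. inverse (real (Suc (r n)))) \<longlonglongrightarrow> 0"
    using LIMSEQ_subseq_LIMSEQ[OF _ r] by (simp add: o_def)
  have "ip (\<psi> n) (\<psi> n) \<le> (m + C) * inverse (real (Suc n))" for n
  proof -
    have "ip (\<psi> n) (\<psi> n) \<le> (m + C) * (m - ip (kop k (f n)) (f n))"
      unfolding \<psi>_def G_def using almost_eigenvector[OF k f(1,2) _ C top] m by simp
    also have "\<dots> \<le> (m + C) * inverse (real (Suc n))"
      using f(3)[of n] m C(1) by (intro mult_left_mono) auto
    finally show ?thesis .
  qed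
  then have \<psi>0: "(\<lambda>n. ip (\<psi> (r n)) (\<psi> (r n))) \<longlonglongrightarrow> 0"
    using tendsto_mult_right_zero[OF inv, of "m + C"] ip_nonneg
    by (intro tendsto_sandwich[OF _ _ tendsto_const tendsto_mult_right_zero[OF inv, of "m + C"]]) auto
  have K\<psi>: "(\<lambda>n. kop k (\<psi> (r n)) x) \<longlonglongrightarrow> 0" for x
  proof (rule Lim_null_comparison)
    show "\<forall>\<^sub>F n in sequentially. norm (kop k (\<psi> (r n)) x) \<le> B * (I * sqrt (ip (\<psi> (r n)) (\<psi> (r n))))"
    proof (rule always_eventually, rule allI)
      fix n
      have "\<bar>kop k (\<psi> (r n)) x\<bar> \<le> B * (\<integral>x. \<bar>\<psi> (r n) x\<bar> \<partial>\<mu>)"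
        by (rule kop_bound[OF B(2) k L2_integrable[OF \<psi>L]])
      also have "\<dots> \<le> B * (I * sqrt (ip (\<psi> (r n)) (\<psi> (r n))))"
        using abs_le[OF \<psi>L] B(1) by (intro mult_left_mono) auto
      finally show "norm (kop k (\<psi> (r n)) x) \<le> B * (I * sqrt (ip (\<psi> (r n)) (\<psi> (r n))))" by simp
    qed
    show "(\<lambda>n. B * (I * sqrt (ip (\<psi> (r n)) (\<psi> (r n))))) \<longlonglongrightarrow> 0"
      using \<psi>0 by (intro tendsto_mult_right_zero) (metis tendsto_real_sqrt real_sqrt_zero)
  qed
  have hb: "\<bar>h x\<bar> \<le> B * I" for x
    by (rule LIMSEQ_le_const2[OF tendsto_rabs[OF h_lim]]) (use Gb in auto)
  have KG: "(\<lambda>n. kop k (G (r n)) x) \<longlonglongrightarrow> kop k h x" for x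
    unfolding kop_def
  proof (rule integral_dominated_convergence[where w = "\<lambda>_. B * (B * I)"])
    show "(\<lambda>y. k x y * h y) \<in> borel_measurable \<mu>"
      "(\<lambda>y. k x y * G (r n) y) \<in> borel_measurable \<mu>" for n
      by (intro continuous_imp_measurable continuous_intros kernel_continuous k hc Gc)+
    show "AE y in \<mu>. (\<lambda>n. k x y * G (r n) y) \<longlonglongrightarrow> k x y * h y"
      by (intro always_eventually allI tendsto_mult_left h_lim)
    show "AE y in \<mu>. norm (k x y * G (r n) y) \<le> B * (B * I)" for n
      using B Gb by (intro always_eventually allI) (auto simp: abs_mult intro!: mult_mono)
  qed simp
  have Kh: "kop k h x = m * h x" for x
  proof -
    \<comment> \<open>K is applied to the residual, and \<open>K (f (r n))\<close> is
      \<open>G (r n)\<close>.\<close>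
    have "kop k (G (r n)) x = kop k (\<psi> (r n)) x + m * G (r n) x" for n
    proof -
      have "kop k (\<psi> (r n)) x = kop k (G (r n)) x - m * kop k (f (r n)) x"
        unfolding \<psi>_def
        using kop_diff[OF k L2_integrable[OF GL] L2_integrable[OF L2_scale[OF f(1)]]]
        by (simp add: kop_scale)
      then show ?thesis by (simp add: G_def)
    qed
    then have "(\<lambda>n. kop k (G (r n)) x) \<longlonglongrightarrow> 0 + m * h x"
      using tendsto_add[OF K\<psi>[of x] tendsto_mult_left[OF h_lim[of x], of m]] by simp
    then show ?thesis using LIMSEQ_unique[OF KG[of x]] by simp
  qed
  have "(\<lambda>n. ip (G (r n)) (G (r n))) \<longlonglongrightarrow> ip h h"
    unfolding ip_def
  proof (rule integral_dominated_convergence[where w = "\<lambda>_. (B * I) * (B * I)"])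
    show "(\<lambda>y. h y * h y) \<in> borel_measurable \<mu>"
      "(\<lambda>y. G (r n) y * G (r n) y) \<in> borel_measurable \<mu>" for n
      by (intro continuous_imp_measurable continuous_intros hc Gc)+
    show "AE y in \<mu>. (\<lambda>n. G (r n) y * G (r n) y) \<longlonglongrightarrow> h y * h y"
      by (intro always_eventually allI tendsto_mult h_lim)
    show "AE y in \<mu>. norm (G (r n) y * G (r n) y) \<le> (B * I) * (B * I)" for n
      unfolding real_norm_def abs_mult using Gb B(1) I
      by (intro always_eventually allI mult_mono) auto
  qed simp
  moreover have "(\<lambda>n. (m - inverse (real (Suc (r n))))\<^sup>2) \<longlonglongrightarrow> (m - 0)\<^sup>2"
    by (intro tendsto_intros inv)
  \<comment> \<open>This keeps \<open>h\<close> away from 0: by Cauchy-Schwarz and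
    \<open>ip (f n) (f n) \<le> 1\<close>, the norm of \<open>G n\<close> is at least the value of
    the form at \<open>f n\<close>, which tends to \<open>m\<close>. Squaring needs the lower bound
    to be nonnegative, hence only eventually.\<close>
  moreover have "\<forall>\<^sub>F n in sequentially. (m - inverse (real (Suc (r n))))\<^sup>2 \<le> ip (G (r n)) (G (r n))"
  proof -
    have "\<forall>\<^sub>F n in sequentially. inverse (real (Suc (r n))) < m"
      using order_tendstoD(2)[OF inv m] .
    then show ?thesis
    proof eventually_elim
      case (elim n)
      have "(m - inverse (real (Suc (r n))))\<^sup>2 \<le> (ip (G (r n)) (f (r n)))\<^sup>2"
        using elim f(3)[of "r n"] by (intro power_mono) (auto simp: G_def)
      also have "\<dots> \<le> ip (G (r n)) (G (r n)) * ip (f (r n)) (f (r n))"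
        by (rule ip_Cauchy_Schwarz[OF GL f(1)])
      also have "\<dots> \<le> ip (G (r n)) (G (r n))"
        using f(2) ip_nonneg by (simp add: mult_left_le)
      finally show ?case .
    qed
  qed
  ultimately have "(m - 0)\<^sup>2 \<le> ip h h"
    using tendsto_le[OF sequentially_bot] by blast
  moreover have "0 < (m - 0)\<^sup>2" using m by simp
  ultimately have pos: "0 < ip h h" by linarith
  define c where "c = 1 / sqrt (ip h h)"
  show thesis
  proof (rule that[OF m, of "\<lambda>x. c * h x"])
    show "continuous_on UNIV (\<lambda>x. c * h x)" by (intro continuous_intros hc)
    show "kop k (\<lambda>x. c * h x) = (\<lambda>x. m * (c * h x))" by (simp add: fun_eq_iff kop_scale Kh)
    have "c\<^sup>2 * ip h h = 1" using pos by (simp add: c_def power_divide)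
    then show "ip (\<lambda>x. c * h x) (\<lambda>x. c * h x) = 1" by (simp add: ip_scale power2_eq_square mult.assoc)
  qed (rule top)
qed

end

section \<open>Spectral bound for mean zero functions\<close>

context compact_measure_space
begin

text \<open>The kernel of K minus \<open>c\<close> times the orthogonal projection onto
  \<open>e\<close>, if \<open>e\<close> is a unit vector.\<close>

definition deflate :: "('a \<Rightarrow> 'a \<Rightarrow> real) \<Rightarrow> real \<Rightarrow> ('a \<Rightarrow> real) \<Rightarrow> 'a \<Rightarrow> 'a \<Rightarrow> real" where
  "deflate k c e x y = k x y - c * (e x * e y)"

lemma sym_kernel_deflate:
  assumes k: "sym_kernel k" and e: "continuous_on UNIV e"
  shows "sym_kernel (deflate k c e)"
proof -
  have "continuous_on UNIV (\<lambda>p. e (fst p))" "continuous_on UNIV (\<lambda>p. e (snd p))"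
    using continuous_on_compose2[OF e continuous_on_fst[OF continuous_on_id]]
      continuous_on_compose2[OF e continuous_on_snd[OF continuous_on_id]] by simp_all
  then have "continuous_on UNIV (\<lambda>p. (case p of (x, y) \<Rightarrow> k x y) - c * (e (fst p) * e (snd p)))"
    using k unfolding sym_kernel_def by (intro continuous_intros) auto
  then show ?thesis
    using k unfolding sym_kernel_def deflate_def by (simp add: case_prod_beta mult.commute)
qed

lemma kop_deflate:
  assumes k: "sym_kernel k" and e: "continuous_on UNIV e" and f: "in_L2 \<mu> f"
  shows "kop (deflate k c e) f x = kop k f x - c * ip e f * e x"
proof -
  have "kop (deflate k c e) f x = (\<integral>y. k x y * f y - (c * e x) * (e y * f y) \<partial>\<mu>)"
    unfolding kop_def deflate_def by (simp add: algebra_simps)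
  also have "\<dots> = (\<integral>y. k x y * f y \<partial>\<mu>) - (\<integral>y. (c * e x) * (e y * f y) \<partial>\<mu>)"
    by (intro Bochner_Integration.integral_diff kernel_mult_integrable[OF k L2_integrable[OF f]]
        integrable_mult_right L2_mult_integrable continuous_imp_L2 e f)
  finally show ?thesis by (simp add: kop_def ip_def)
qed

text \<open>The square of the Hilbert-Schmidt norm. It serves as a budget that limits how many
  eigenvectors can be split off.\<close>

definition hs :: "('a \<Rightarrow> 'a \<Rightarrow> real) \<Rightarrow> real" where
  "hs k = (\<integral>x. \<integral>y. (k x y)\<^sup>2 \<partial>\<mu> \<partial>\<mu>)"

lemma hs_nonneg: "0 \<le> hs k"
  unfolding hs_def by (intro integral_nonneg_AE always_eventually allI) simp

text \<open>In each row the eigenvector equation evaluates the cross term,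
  \<open>ip (k x) e = c * e x\<close>, so the square loses \<open>c\<^sup>2 * (e x)\<^sup>2\<close>;
  the unit norm of \<open>e\<close> completes the sum.\<close>

lemma hs_deflate:
  assumes k: "sym_kernel k" and e: "continuous_on UNIV e" "kop k e = (\<lambda>x. c * e x)" "ip e e = 1"
  shows "hs (deflate k c e) = hs k - c\<^sup>2"
proof -
  have row: "(\<integral>y. (deflate k c e x y)\<^sup>2 \<partial>\<mu>) = (\<integral>y. (k x y)\<^sup>2 \<partial>\<mu>) - c\<^sup>2 * (e x * e x)" for x
  proof -
    note kx = continuous_imp_L2[OF kernel_continuous[OF k, of x]] and eL = continuous_imp_L2[OF e(1)]
    have "(\<integral>y. (deflate k c e x y)\<^sup>2 \<partial>\<mu>)
        = ip (\<lambda>y. k x y - (c * e x) * e y) (\<lambda>y. k x y - (c * e x) * e y)"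
      unfolding deflate_def ip_self by (simp add: mult.assoc)
    also have "ip (\<lambda>y. k x y - b * e y) (\<lambda>y. k x y - b * e y)
        = ip (k x) (k x) - 2 * b * ip (k x) e + b * b * ip e e" for b
    proof -
      have "ip (\<lambda>y. k x y - b * e y) (\<lambda>y. k x y - b * e y)
          = ip (k x) (k x) - b * ip (k x) e - (b * ip (k x) e - b * (b * ip e e))"
        using kx eL by (simp add: ip_diff ip_scale L2_scale L2_diff ip_commute[of e "k x"] right_diff_distrib)
      then show ?thesis by (simp add: algebra_simps)
    qed
    also have "ip (k x) e = c * e x" using fun_cong[OF e(2), of x] by (simp add: ip_def kop_def)
    finally show ?thesis
      unfolding e(3) unfolding ip_self by (simp add: power2_eq_square algebra_simps)
  qed
  have "integrable \<mu> (\<lambda>x. \<integral>y. (k x y)\<^sup>2 \<partial>\<mu>)"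
  proof -
    have "continuous_on UNIV (\<lambda>p. (case p of (x, y) \<Rightarrow> k x y)\<^sup>2)"
      using k unfolding sym_kernel_def by (intro continuous_intros) auto
    then have "sym_kernel (\<lambda>x y. (k x y)\<^sup>2)"
      using k unfolding sym_kernel_def by (simp add: case_prod_beta)
    from continuous_imp_integrable[OF kop_continuous[OF this, of "\<lambda>_. 1"]]
    show ?thesis by (simp add: kop_def[abs_def])
  qed
  moreover have "integrable \<mu> (\<lambda>x. c\<^sup>2 * (e x * e x))"
    by (intro integrable_mult_right L2_mult_integrable continuous_imp_L2 e)
  ultimately show ?thesis
    using e(3) unfolding hs_def row by (simp add: Bochner_Integration.integral_diff ip_def)
qed

lemma deflate_eigenvector:
  assumes k: "sym_kernel k" and e: "continuous_on UNIV e" "kop k e = (\<lambda>x. c * e x)" "ip e e = 1"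
  shows "kop (deflate k c e) e = (\<lambda>x. 0)"
  using kop_deflate[OF k e(1) continuous_imp_L2[OF e(1)]] e(2,3) by auto

text \<open>Deflation creates no new nonzero eigenvalue: the deflated operator is symmetric and
  kills \<open>e\<close>, so its eigenvectors for \<open>b \<noteq> 0\<close> are orthogonal to
  \<open>e\<close>, and there it agrees with K.\<close>

lemma deflate_other_eigenvector:
  assumes k: "sym_kernel k" and e: "continuous_on UNIV e" "kop k e = (\<lambda>x. c * e x)" "ip e e = 1"
    and f: "continuous_on UNIV f" "kop (deflate k c e) f = (\<lambda>x. b * f x)" "b \<noteq> 0"
  shows "ip e f = 0" "kop k f = (\<lambda>x. b * f x)"
proof -
  note fi = continuous_imp_integrable[OF f(1)] and ei = continuous_imp_integrable[OF e(1)]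
  have "b * ip f e = ip (kop (deflate k c e) f) e" by (simp add: f(2) ip_scale)
  also have "\<dots> = ip f (kop (deflate k c e) e)"
    by (rule kop_symmetric[OF sym_kernel_deflate[OF k e(1)] fi ei])
  also have "\<dots> = 0" by (simp add: deflate_eigenvector[OF k e] ip_def)
  finally show 0: "ip e f = 0" using f(3) ip_commute by simp
  show "kop k f = (\<lambda>x. b * f x)"
    using kop_deflate[OF k e(1) continuous_imp_L2[OF f(1)], of c] 0 f(2) by (simp add: fun_eq_iff)
qed

text \<open>The weak form is what polarization delivers, and two kernels acting alike on
  \<open>h\<close> share it by rewriting; \<open>null_vector_AE\<close> recovers the pointwise
  meaning.\<close>

definition null_vector :: "('a \<Rightarrow> 'a \<Rightarrow> real) \<Rightarrow> ('a \<Rightarrow> real) \<Rightarrow> bool" where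
  "null_vector k h \<longleftrightarrow> in_L2 \<mu> h \<and> (\<forall>p. in_L2 \<mu> p \<longrightarrow> ip (kop k h) p = 0)"

lemma null_vectorI: "in_L2 \<mu> h \<Longrightarrow> kop k h = (\<lambda>x. 0) \<Longrightarrow> null_vector k h"
  unfolding null_vector_def by (simp add: ip_def)

lemma null_vector_AE:
  assumes "sym_kernel k" "null_vector k h"
  shows "AE x in \<mu>. kop k h x = 0"
proof -
  have "in_L2 \<mu> (kop k h)"
    using assms by (intro kop_L2 L2_integrable) (auto simp: null_vector_def)
  then show ?thesis
    using assms(2) ip_self_eq_0_iff unfolding null_vector_def by blast
qed

text \<open>Polarization: the form at \<open>f + p\<close> leaves twice the mixed term.\<close>

lemma quadratic_form_zero:
  assumes k: "sym_kernel k" and zero: "\<And>f. in_L2 \<mu> f \<Longrightarrow> ip (kop k f) f = 0" and f: "in_L2 \<mu> f"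
  shows "null_vector k f"
  unfolding null_vector_def
proof (intro conjI allI impI f)
  fix p assume p: "in_L2 \<mu> p"
  note L = f p kop_L2[OF k L2_integrable[OF f]] kop_L2[OF k L2_integrable[OF p]]
  have "ip (kop k p) f = ip (kop k f) p"
    using kop_symmetric[OF k L2_integrable[OF p] L2_integrable[OF f]] ip_commute by simp
  moreover have "kop k (\<lambda>x. f x + p x) = (\<lambda>x. kop k f x + kop k p x)"
    by (rule ext) (rule kop_add[OF k L2_integrable[OF f] L2_integrable[OF p]])
  then have "ip (kop k (\<lambda>x. f x + p x)) (\<lambda>x. f x + p x)
     = ip (kop k f) f + ip (kop k f) p + (ip (kop k p) f + ip (kop k p) p)"
    using L by (simp add: ip_add L2_add)
  ultimately show "ip (kop k f) p = 0" using zero[OF L2_add[OF f p]] zero[OF f] zero[OF p] by simp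
qed

text \<open>If the form is negative at \<open>f\<close>, the top eigenvalue of the kernel
  \<open>- k\<close> is used.\<close>

lemma nonzero_eigenvalue:
  assumes k: "sym_kernel k" and f: "in_L2 \<mu> f" "ip (kop k f) f \<noteq> 0"
  obtains c e where "c \<noteq> 0" "continuous_on UNIV e" "kop k e = (\<lambda>x. c * e x)" "ip e e = 1"
proof (cases "0 < ip (kop k f) f")
  case True
  then show thesis using top_eigenvalue[OF k f(1)] that by (metis less_numeral_extra(3))
next
  case False
  let ?k = "\<lambda>x y. - k x y"
  have neg: "kop ?k h = (\<lambda>x. - kop k h x)" for h unfolding kop_def by simp
  have "sym_kernel ?k"
    using k continuous_on_minus[of UNIV "\<lambda>(x, y). k x y"] unfolding sym_kernel_def
    by (simp add: case_prod_beta)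
  moreover have "0 < ip (kop ?k f) f" using False f(2) unfolding neg by (simp add: ip_def)
  ultimately obtain m e where "0 < m" "continuous_on UNIV e" "kop ?k e = (\<lambda>x. m * e x)" "ip e e = 1"
    using top_eigenvalue[OF _ f(1)] by metis
  moreover from this(3) have "kop k e = (\<lambda>x. - m * e x)"
    unfolding neg fun_eq_iff by (metis minus_minus mult_minus_left)
  ultimately show thesis using that[of "-m" e] by simp
qed

text \<open>Each deflation lowers \<open>hs\<close> by at least \<open>q\<^sup>2\<close>, so finitely many of them exhaust the kernel;
  \<open>h\<close> is the projection of \<open>f\<close> onto the null space.\<close>

lemma negative_spectrum:
  assumes "sym_kernel k" "q < 0" "hs k \<le> real n * q\<^sup>2"
    and "\<And>c e. c \<noteq> 0 \<Longrightarrow> continuous_on UNIV e \<Longrightarrow> kop k e = (\<lambda>x. c * e x) \<Longrightarrow> ip e e = 1 \<Longrightarrow> c \<le> q"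
    and "in_L2 \<mu> f"
  shows "\<exists>h. null_vector k h \<and> (\<forall>p. null_vector k p \<longrightarrow> ip h p = ip f p) \<and>
    ip (kop k f) f \<le> q * (ip f f - ip h h)"
  using assms
proof (induction n arbitrary: k f)
  case (0 k f)
  show ?case
  proof (cases "\<forall>f. in_L2 \<mu> f \<longrightarrow> ip (kop k f) f = 0")
    case True
    then show ?thesis using quadratic_form_zero[OF 0(1)] 0(5) by (intro exI[of _ f]) auto
  next
    case False
    then obtain c e where e: "c \<noteq> 0" "continuous_on UNIV e" "kop k e = (\<lambda>x. c * e x)" "ip e e = 1"
      using nonzero_eigenvalue[OF 0(1)] by metis
    \<comment> \<open>For \<open>n = 0\<close> the budget is spent: one more deflation would make
      \<open>hs\<close> negative.\<close>
    have "0 < c\<^sup>2" using e(1) by simp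
    then have False
      using hs_deflate[OF 0(1) e(2-4)] hs_nonneg[of "deflate k c e"] 0(3)[simplified] by linarith
    then show ?thesis ..
  qed
next
  case (Suc n k f)
  show ?case
  proof (cases "\<forall>f. in_L2 \<mu> f \<longrightarrow> ip (kop k f) f = 0")
    case True
    then show ?thesis using quadratic_form_zero[OF Suc(2)] Suc(6) by (intro exI[of _ f]) auto
  next
    case False
    note k = Suc(2) and f = Suc(6)
    obtain c e where e: "c \<noteq> 0" "continuous_on UNIV e" "kop k e = (\<lambda>x. c * e x)" "ip e e = 1"
      using False nonzero_eigenvalue[OF k] by metis
    have c: "c \<le> q" by (rule Suc(5)[OF e])
    define k' where "k' = deflate k c e"
    define a where "a = ip e f"
    define f' where "f' = (\<lambda>x. f x - a * e x)"
    note eL = continuous_imp_L2[OF e(2)]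
    have f': "in_L2 \<mu> f'" unfolding f'_def by (intro L2_diff L2_scale f eL)
    have k': "sym_kernel k'" unfolding k'_def by (rule sym_kernel_deflate[OF k e(2)])
    have kop_k': "kop k' h x = kop k h x - c * ip e h * e x" if "in_L2 \<mu> h" for h x
      unfolding k'_def by (rule kop_deflate[OF k e(2) that])
    have k'e: "kop k' e = (\<lambda>x. 0)" unfolding k'_def by (rule deflate_eigenvector[OF k e(2-4)])
    \<comment> \<open>Both numbers are negative, so \<open>c \<le> q\<close> means a larger square;
      the deflation therefore uses up at least one unit of the budget.\<close>
    have "q\<^sup>2 \<le> c\<^sup>2" using c Suc(3) by (simp add: abs_le_square_iff[symmetric])
    then have hs': "hs k' \<le> real n * q\<^sup>2"
      using hs_deflate[OF k e(2-4)] Suc(4) by (simp add: k'_def algebra_simps)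
    have eig': "b \<le> q" if "b \<noteq> 0" "continuous_on UNIV w" "kop k' w = (\<lambda>x. b * w x)" "ip w w = 1" for b w
      using Suc(5)[OF that(1,2) deflate_other_eigenvector(2)[OF k e(2-4) that(2) _ that(1)] that(4)]
        that(3) by (simp add: k'_def)
    have "\<exists>h. null_vector k' h \<and> (\<forall>p. null_vector k' p \<longrightarrow> ip h p = ip f' p) \<and>
        ip (kop k' f') f' \<le> q * (ip f' f' - ip h h)"
      by (rule Suc(1)[OF k' Suc(3) hs' _ f']) (rule eig')
    then obtain h where h: "null_vector k' h"
      "\<And>p. null_vector k' p \<Longrightarrow> ip h p = ip f' p" "ip (kop k' f') f' \<le> q * (ip f' f' - ip h h)"
      by blast
    have hL: "in_L2 \<mu> h" using h(1) by (simp add: null_vector_def)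
    have "ip f' e = 0"
      unfolding f'_def using f eL e(4) by (simp add: ip_diff ip_scale L2_scale a_def ip_commute[of f e])
    \<comment> \<open>\<open>e\<close> is a null vector of \<open>k'\<close>, so the projection
      property of \<open>h\<close> can be tested on it.\<close>
    then have he: "ip e h = 0"
      using h(2)[OF null_vectorI[OF eL k'e]] ip_commute[of e h] by simp
    have eq_null: "null_vector k p \<longleftrightarrow> null_vector k' p" if "in_L2 \<mu> p" "ip e p = 0" for p
    proof -
      have "kop k' p = kop k p" using kop_k'[OF that(1)] that(2) by (simp add: fun_eq_iff)
      then show ?thesis by (simp add: null_vector_def)
    qed
    have "null_vector k h" using eq_null[OF hL he] h(1) by simp
    moreover have "ip h p = ip f p" if p: "null_vector k p" for p
    proof -
      have pL: "in_L2 \<mu> p" using p by (simp add: null_vector_def)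
      \<comment> \<open>As \<open>c \<noteq> 0\<close>, symmetry makes every null vector of
        \<open>k\<close> orthogonal to \<open>e\<close>, where \<open>k\<close> and
        \<open>k'\<close> agree.\<close>
      have "c * ip e p = ip (kop k e) p" by (simp add: e(3) ip_scale)
      also have "\<dots> = ip (kop k p) e"
        using kop_symmetric[OF k L2_integrable[OF eL] L2_integrable[OF pL]] ip_commute by simp
      also have "\<dots> = 0" using p eL by (simp add: null_vector_def)
      finally have ep: "ip e p = 0" using e(1) by simp
      then have "ip h p = ip f' p" using h(2) eq_null[OF pL] p by simp
      also have "\<dots> = ip f p" unfolding f'_def using f eL pL ep by (simp add: ip_diff ip_scale L2_scale)
      finally show ?thesis .
    qed
    moreover have "ip (kop k f) f \<le> q * (ip f f - ip h h)"
    proof -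
      note L = f f' eL kop_L2[OF k' L2_integrable[OF f']]
      have "kop k' f' x = kop k' f x" for x
        unfolding f'_def using fun_cong[OF k'e, of x]
        by (subst kop_diff[OF k' L2_integrable[OF f] L2_integrable[OF L2_scale[OF eL]]]) (simp add: kop_scale)
      then have "kop k f = (\<lambda>x. kop k' f' x + (c * a) * e x)"
        using kop_k'[OF f] by (simp add: fun_eq_iff a_def)
      \<comment> \<open>The form and the norm both split along \<open>f = f' + a e\<close>. The
        \<open>e\<close> part contributes \<open>c * a\<^sup>2 \<le> q * a\<^sup>2\<close>; the
        induction hypothesis bounds the rest.\<close>
      then have "ip (kop k f) f = ip (kop k' f') f + c * a\<^sup>2"
        using L by (simp add: ip_add ip_scale L2_scale a_def power2_eq_square)
      also have "ip (kop k' f') f = ip (kop k' f') f'"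
      proof -
        have "ip (kop k' f') e = 0"
          using kop_symmetric[OF k' L2_integrable[OF f'] L2_integrable[OF eL]] k'e by (simp add: ip_def)
        moreover have "ip w f' = ip w f - a * ip w e" if "in_L2 \<mu> w" for w
          unfolding f'_def using that f eL by (simp add: ip_diff ip_scale L2_scale)
        ultimately show ?thesis using L(4) by simp
      qed
      also have "ip f' f' = ip f f - a\<^sup>2"
        unfolding f'_def using f eL e(4)
        by (simp add: ip_diff ip_scale L2_scale L2_diff ip_commute[of f e] a_def power2_eq_square)
      then have "ip (kop k' f') f' + c * a\<^sup>2 \<le> q * (ip f f - a\<^sup>2 - ip h h) + q * a\<^sup>2"
        using h(3) mult_right_mono[OF c, of "a\<^sup>2"] by simp
      finally show ?thesis by (simp add: algebra_simps)
    qed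
    ultimately show ?thesis by blast
  qed
qed

end

section \<open>Symmetric Markov kernels: harmonic functions and spectral gap\<close>

locale markov_kernel = compact_measure_space \<mu>
  for \<mu> :: "'a::{t2_space, second_countable_topology} measure" +
  fixes k :: "'a \<Rightarrow> 'a \<Rightarrow> real"
  assumes kernel: "sym_kernel k" and kernel_nonneg: "0 \<le> k x y"
    and kernel_integral: "(\<integral>y. k x y \<partial>\<mu>) = 1" and kernel_diag: "0 < k x x"
    and full_support: "open W \<Longrightarrow> W \<noteq> {} \<Longrightarrow> emeasure \<mu> W \<noteq> 0"
    and connected_space: "connected (UNIV :: 'a set)"
begin

lemma kop_const: "kop k (\<lambda>_. c) = (\<lambda>_. c)"
  unfolding kop_def using kernel_integral by simp

lemma total_pos: "0 < measure \<mu> UNIV"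
  using full_support[of UNIV] measure_nonneg[of \<mu> UNIV] by (simp add: emeasure_eq_measure less_le)

text \<open>Where \<open>e\<close> attains its maximum, the nonnegative function
  \<open>k x y * (e x - e y)\<close> has integral 0, so \<open>e\<close> is also maximal wherever
  \<open>k x\<close> is positive, in particular near \<open>x\<close>. The set of maximum points is
  thus open and closed.\<close>

lemma harmonic_imp_constant:
  assumes e: "continuous_on UNIV e" "kop k e = e"
  shows "\<exists>c. e = (\<lambda>_. c)"
proof -
  obtain x0 where x0: "\<And>y. e y \<le> e x0"
    using continuous_attains_sup[OF comp _ e(1)] by auto
  define S where "S = {x. e x = e x0}"
  have "closed S"
    unfolding S_def using continuous_closed_preimage_constant[OF e(1) closed_UNIV, of "e x0"] by simp
  moreover have "open S"
  proof (subst open_subopen, rule ballI)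
    fix x assume x: "x \<in> S"
    define W where "W = {y. 0 < k x y}"
    have "open W" unfolding W_def
      using open_Collect_less[OF continuous_on_const kernel_continuous[OF kernel]] .
    have "x \<in> W" using kernel_diag by (simp add: W_def)
    let ?h = "\<lambda>y. k x y * (e x - e y)"
    have hc: "continuous_on UNIV ?h"
      by (intro continuous_intros kernel_continuous[OF kernel] e(1))
    have nn: "0 \<le> ?h y" for y using kernel_nonneg x0[of y] x by (simp add: S_def)
    have "(\<integral>y. ?h y \<partial>\<mu>) = (\<integral>y. k x y * e x \<partial>\<mu>) - (\<integral>y. k x y * e y \<partial>\<mu>)"
      unfolding right_diff_distrib
      by (intro Bochner_Integration.integral_diff kernel_mult_integrable[OF kernel]
          continuous_imp_integrable continuous_intros e(1))
    also have "\<dots> = 0" using fun_cong[OF e(2), of x] kernel_integral by (simp add: kop_def)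
    finally have "AE y in \<mu>. ?h y = 0"
      using integral_nonneg_eq_0_iff_AE[OF continuous_imp_integrable[OF hc]] nn by simp
    moreover have op: "open {y. ?h y \<noteq> 0}"
      by (rule open_Collect_neq[OF hc continuous_on_const])
    then have "{y \<in> space \<mu>. ?h y \<noteq> 0} \<in> sets \<mu>" by (simp add: sets_eq)
    ultimately have null: "emeasure \<mu> {y. ?h y \<noteq> 0} = 0"
      using AE_iff_measurable[OF _ refl, of \<mu> "\<lambda>y. ?h y = 0"] by simp
    \<comment> \<open>An open null set is empty by full support, which upgrades the equation from
      almost everywhere to everywhere.\<close>
    from op have "?h y = 0" for y using full_support null by auto

    have "W \<subseteq> S"
    proof
      fix y assume "y \<in> W"
      then have "k x y \<noteq> 0" by (simp add: W_def)
      with \<open>\<And>y. ?h y = 0\<close>[of y] x show "y \<in> S" by (simp add: S_def)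
    qed
    then show "\<exists>T. open T \<and> x \<in> T \<and> T \<subseteq> S" using \<open>open W\<close> \<open>x \<in> W\<close> by blast
  qed
  ultimately have "S = UNIV"
    using connected_space x0 unfolding connected_clopen by (force simp: S_def)
  then show ?thesis unfolding S_def by blast
qed

text \<open>The product \<open>f x * f y\<close> is at most the mean of the two squares; integrated
  against a symmetric kernel with row integrals 1, each square gives back
  \<open>ip f f\<close>.\<close>

lemma quadratic_form_le:
  assumes f: "in_L2 \<mu> f"
  shows "ip (kop k f) f \<le> ip f f"
proof -
  let ?s = "\<lambda>y. (f y)\<^sup>2"
  note s = L2_square_integrable[OF f]
  have ks: "integrable \<mu> (kop k ?s)"
    by (intro continuous_imp_integrable kop_continuous kernel s)
  have pw: "kop k f x * f x \<le> (?s x + kop k ?s x) / 2" for x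
  proof -
    have "kop k f x * f x = (\<integral>y. k x y * (f y * f x) \<partial>\<mu>)" unfolding kop_def by (simp add: mult.assoc[symmetric])
    also have "\<dots> \<le> (\<integral>y. k x y * ((?s x + ?s y) / 2) \<partial>\<mu>)"
    proof (rule integral_mono)
      show "integrable \<mu> (\<lambda>y. k x y * (f y * f x))" "integrable \<mu> (\<lambda>y. k x y * ((?s x + ?s y) / 2))"
        using L2_integrable[OF f] s by (auto intro!: kernel_mult_integrable[OF kernel])
      show "k x y * (f y * f x) \<le> k x y * ((?s x + ?s y) / 2)" for y
        using sum_squares_bound[of "f y" "f x"] kernel_nonneg by (intro mult_left_mono) auto
    qed
    also have "\<dots> = kop k (\<lambda>y. ?s x / 2 + ?s y / 2) x" unfolding kop_def by (simp add: add_divide_distrib)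
    also have "\<dots> = (?s x + kop k ?s x) / 2"
      using s by (simp add: kop_add[OF kernel] kop_const kop_scale[of k "1/2" ?s, simplified] add_divide_distrib)
    finally show ?thesis .
  qed
  have "ip (kop k f) f \<le> (\<integral>x. (?s x + kop k ?s x) / 2 \<partial>\<mu>)"
    unfolding ip_def
    using L2_mult_integrable[OF kop_L2[OF kernel L2_integrable[OF f]] f] s ks pw by (intro integral_mono) auto
  also have "\<dots> = (ip f f + (\<integral>x. kop k ?s x \<partial>\<mu>)) / 2" using s ks by (simp add: ip_self)
  also have "(\<integral>x. kop k ?s x \<partial>\<mu>) = ip f f"
    using kop_symmetric[OF kernel s, of "\<lambda>_. 1"] by (simp add: kop_const ip_def power2_eq_square)
  finally show ?thesis by simp
qed

text \<open>The eigenvectors produced for nonzero eigenvalues are continuous, but null vectors of K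
  are merely square integrable, so the value 0 has a hypothesis of its own, up to null sets. For
  \<open>0 \<le> q\<close> the top eigenvalue decides; for \<open>q < 0\<close> the finite splitting
  of \<open>negative_spectrum\<close> does.\<close>

lemma spectral_gap:
  assumes eig: "\<And>c e. c \<noteq> 1 \<Longrightarrow> continuous_on UNIV e \<Longrightarrow> kop k e = (\<lambda>x. c * e x) \<Longrightarrow> ip e e = 1 \<Longrightarrow> c \<le> q"
    and zero: "\<And>h. in_L2 \<mu> h \<Longrightarrow> AE x in \<mu>. kop k h x = 0 \<Longrightarrow> \<not> (AE x in \<mu>. h x = 0) \<Longrightarrow> 0 \<le> q"
    and f: "in_L2 \<mu> f" "(\<integral>x. f x \<partial>\<mu>) = 0"
  shows "ip (kop k f) f \<le> q * ip f f"
proof -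
  define r where "r = 1 / sqrt (measure \<mu> UNIV)"
  define e0 where "e0 = (\<lambda>_::'a. r)"
  have r: "r \<noteq> 0" "r\<^sup>2 * measure \<mu> UNIV = 1" using total_pos by (simp_all add: r_def power_divide)
  have e0: "continuous_on UNIV e0" "kop k e0 = (\<lambda>x. 1 * e0 x)" "ip e0 e0 = 1"
    unfolding e0_def using r by (simp_all add: kop_const ip_def power2_eq_square mult.commute)
  have ip_e0: "ip e0 h = r * (\<integral>x. h x \<partial>\<mu>)" for h unfolding e0_def ip_def by simp
  \<comment> \<open>Splitting off the constants turns zero mean into orthogonality to
    \<open>e0\<close> and removes the eigenvalue 1, which \<open>eig\<close> leaves out.\<close>
  define k0 where "k0 = deflate k 1 e0"
  have k0: "sym_kernel k0" unfolding k0_def by (rule sym_kernel_deflate[OF kernel e0(1)])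
  have kop_k0: "kop k0 h = kop k h" if "in_L2 \<mu> h" "ip e0 h = 0" for h
    unfolding k0_def using kop_deflate[OF kernel e0(1) that(1), of 1] that(2) by (simp add: fun_eq_iff)
  have fe0: "ip e0 f = 0" using f(2) by (simp add: ip_e0)
  have eig0: "c \<le> q" if e: "c \<noteq> 0" "continuous_on UNIV e" "kop k0 e = (\<lambda>x. c * e x)" "ip e e = 1" for c e
  proof -
    note oth = deflate_other_eigenvector[OF kernel e0 e(2) e(3)[unfolded k0_def] e(1)]
    \<comment> \<open>An eigenfunction of \<open>k0\<close> for the value 1 would be harmonic, hence
      constant, and also orthogonal to the constants.\<close>
    have "c \<noteq> 1"
    proof
      assume "c = 1"
      then obtain b where "e = (\<lambda>_. b)" using harmonic_imp_constant[OF e(2)] oth(2) by auto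
      then have "b = 0" using oth(1) r(1) total_pos by (simp add: ip_e0)
      then show False using e(4) \<open>e = (\<lambda>_. b)\<close> by (simp add: ip_def)
    qed
    then show ?thesis using eig[OF _ e(2) oth(2) e(4)] by simp
  qed
  show ?thesis
  proof (cases "0 \<le> q")
    case True
    show ?thesis
    proof (cases "0 < ip (kop k0 f) f")
      case pos: True
      obtain m e where "0 < m" "continuous_on UNIV e" "kop k0 e = (\<lambda>x. m * e x)" "ip e e = 1"
        "\<And>f. in_L2 \<mu> f \<Longrightarrow> ip (kop k0 f) f \<le> m * ip f f"
        using top_eigenvalue[OF k0 f(1) pos] by metis
      then have "m \<le> q" "ip (kop k0 f) f \<le> m * ip f f" using eig0[of m e] f(1) by simp_all
      then show ?thesis
        using kop_k0[OF f(1) fe0] mult_right_mono[OF \<open>m \<le> q\<close> ip_nonneg[of f]] by simp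
    next
      case False
      then show ?thesis
        using kop_k0[OF f(1) fe0] mult_nonneg_nonneg[OF True ip_nonneg[of f]] by simp
    qed
  next
    case False
    then have q: "q < 0" by simp
    obtain n :: nat where "hs k0 / q\<^sup>2 \<le> real n" using real_arch_simple by blast
    then have "hs k0 \<le> real n * q\<^sup>2" using q by (simp add: divide_le_eq)
    have "\<exists>h. null_vector k0 h \<and> (\<forall>p. null_vector k0 p \<longrightarrow> ip h p = ip f p) \<and>
        ip (kop k0 f) f \<le> q * (ip f f - ip h h)"
      by (rule negative_spectrum[OF k0 q \<open>hs k0 \<le> real n * q\<^sup>2\<close> _ f(1)]) (rule eig0)
    then obtain h where h: "null_vector k0 h" "\<And>p. null_vector k0 p \<Longrightarrow> ip h p = ip f p"
      "ip (kop k0 f) f \<le> q * (ip f f - ip h h)" by blast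
    have hL: "in_L2 \<mu> h" using h(1) by (simp add: null_vector_def)
    have "null_vector k0 e0"
      unfolding k0_def by (rule null_vectorI[OF continuous_imp_L2[OF e0(1)] deflate_eigenvector[OF kernel e0]])
    \<comment> \<open>\<open>h\<close> inherits zero mean from \<open>f\<close> because
      \<open>e0\<close> is a null vector of \<open>k0\<close>. So \<open>k\<close> and
      \<open>k0\<close> agree on \<open>h\<close>, and \<open>zero\<close> with \<open>q < 0\<close>
      forces \<open>h\<close> to vanish almost everywhere.\<close>
    then have "ip e0 h = 0" using h(2) fe0 ip_commute by metis
    then have "AE x in \<mu>. kop k h x = 0"
      using null_vector_AE[OF k0 h(1)] kop_k0[OF hL] by simp
    then have "AE x in \<mu>. h x = 0" using zero[OF hL] q by linarith
    then have "ip h h = 0" using ip_self_eq_0_iff[OF hL] by simp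
    then show ?thesis using h(3) kop_k0[OF f(1) fe0] by simp
  qed
qed

end

section \<open>Decay of solutions\<close>

text \<open>The Lipschitz bound \<open>B\<close> dominates the difference quotients. Derivatives are
  taken within \<open>S\<close> to include the end points of a time interval, and along sequences
  because dominated convergence is sequential.\<close>

lemma has_real_derivative_integral:
  fixes f :: "real \<Rightarrow> 'a \<Rightarrow> real"
  assumes deriv: "\<And>x. x \<in> space M \<Longrightarrow> ((\<lambda>t. f t x) has_real_derivative f' x) (at t within S)"
    and lip: "\<And>r x. r \<in> S \<Longrightarrow> \<bar>f r x - f t x\<bar> \<le> B x * \<bar>r - t\<bar>"
    and B: "integrable M B" and t: "t \<in> S" and int: "\<And>r. r \<in> S \<Longrightarrow> integrable M (f r)"
  shows "((\<lambda>t. \<integral>x. f t x \<partial>M) has_real_derivative (\<integral>x. f' x \<partial>M)) (at t within S)"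
  unfolding has_field_derivative_iff tendsto_at_iff_sequentially
proof (intro allI impI)
  fix X :: "nat \<Rightarrow> real" assume X: "\<forall>i. X i \<in> S - {t}" "X \<longlonglongrightarrow> t"
  let ?q = "\<lambda>i x. (f (X i) x - f t x) / (X i - t)"
  have lim: "(\<lambda>i. ?q i x) \<longlonglongrightarrow> f' x" if "x \<in> space M" for x
    using deriv[OF that] X unfolding has_field_derivative_iff tendsto_at_iff_sequentially o_def by blast
  have meas: "?q i \<in> borel_measurable M" for i
    using int[of "X i"] int[OF t] X(1) by (intro borel_measurable_divide borel_measurable_diff) auto
  have "(\<lambda>i. \<integral>x. ?q i x \<partial>M) \<longlonglongrightarrow> (\<integral>x. f' x \<partial>M)"
  proof (rule integral_dominated_convergence[OF _ meas B])
    show "f' \<in> borel_measurable M" by (rule borel_measurable_LIMSEQ_real[OF lim meas])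
    show "AE x in M. (\<lambda>i. ?q i x) \<longlonglongrightarrow> f' x" using lim by (rule AE_I2)
    show "AE x in M. norm (?q i x) \<le> B x" for i
      using lip[of "X i"] X(1) by (intro AE_I2) (auto simp: divide_le_eq)
  qed
  moreover have "(\<integral>x. ?q i x \<partial>M) = ((\<integral>x. f (X i) x \<partial>M) - (\<integral>x. f t x \<partial>M)) / (X i - t)" for i
    using int[of "X i"] int[OF t] X(1) by (simp add: Bochner_Integration.integral_diff)
  ultimately show "((\<lambda>y. ((\<integral>x. f y x \<partial>M) - (\<integral>x. f t x \<partial>M)) / (y - t)) \<circ> X) \<longlonglongrightarrow> (\<integral>x. f' x \<partial>M)"
    by (simp only: o_def)
qed

context markov_kernel
begin

abbreviation L where "L \<equiv> \<lambda>u x. kop k u x - u x"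

text \<open>The eigenvalue equation makes the form of K equal to \<open>(1 - c) * ip u u\<close>,
  which \<open>quadratic_form_le\<close> bounds by \<open>ip u u\<close>.\<close>

lemma eigenvalue_pos:
  assumes "L2_eigenvalue_minus \<mu> L c" "c \<noteq> 0"
  shows "0 < c"
proof -
  obtain u where u: "in_L2 \<mu> u" "\<not> (AE x in \<mu>. u x = 0)" "AE x in \<mu>. - (kop k u x - u x) = c * u x"
    using assms(1) unfolding L2_eigenvalue_minus_def by blast
  have "AE x in \<mu>. kop k u x = (1 - c) * u x"
    using u(3) by eventually_elim (simp add: algebra_simps)
  then have "ip (kop k u) u = (1 - c) * ip u u"
    using ip_AE_cong[OF kop_L2[OF kernel L2_integrable[OF u(1)]] L2_scale[OF u(1)] u(1)]
    by (simp add: ip_scale)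
  then have "0 \<le> c * ip u u" using quadratic_form_le[OF u(1)] by (simp add: algebra_simps)
  moreover have "0 < ip u u" using ip_self_eq_0_iff[OF u(1)] u(2) ip_nonneg[of u] by simp
  ultimately show ?thesis using assms(2) by (simp add: zero_le_mult_iff)
qed

text \<open>An eigenvalue \<open>c\<close> of K is an eigenvalue \<open>1 - c\<close> of -L. A
  nontrivial null vector of K makes 1 an eigenvalue of -L, hence \<open>lam \<le> 1\<close>, which
  is the condition \<open>zero\<close> of \<open>spectral_gap\<close>.\<close>

lemma first_eigenvalue_gap:
  assumes lam: "first_nonzero_eigenvalue \<mu> L lam" and f: "in_L2 \<mu> f" "(\<integral>x. f x \<partial>\<mu>) = 0"
  shows "ip (kop k f) f \<le> (1 - lam) * ip f f"
proof (rule spectral_gap[OF _ _ f])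
  have le: "lam \<le> c" if "L2_eigenvalue_minus \<mu> L c" "c \<noteq> 0" for c
    using lam that unfolding first_nonzero_eigenvalue_def by blast
  fix c e assume e: "c \<noteq> 1" "continuous_on UNIV e" "kop k e = (\<lambda>x. c * e x)" "ip e e = 1"
  note eL = continuous_imp_L2[OF e(2)]
  have "L2_eigenvalue_minus \<mu> L (1 - c)"
    unfolding L2_eigenvalue_minus_def
    using eL ip_self_eq_0_iff[OF eL] e(3,4) by (intro exI[of _ e]) (auto simp: algebra_simps)
  then show "c \<le> 1 - lam" using le[of "1 - c"] e(1) by simp
next
  fix h assume h: "in_L2 \<mu> h" "AE x in \<mu>. kop k h x = 0" "\<not> (AE x in \<mu>. h x = 0)"
  have "AE x in \<mu>. - (kop k h x - h x) = 1 * h x" using h(2) by eventually_elim simp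
  then have "L2_eigenvalue_minus \<mu> L 1" unfolding L2_eigenvalue_minus_def using h(1,3) by blast
  then show "0 \<le> 1 - lam" using lam unfolding first_nonzero_eigenvalue_def by simp
qed

end

section \<open>Regularity and energy of the L1 solution on a bounded time interval\<close>

locale evolution = markov_kernel \<mu> k
  for \<mu> :: "'a::{t2_space, second_countable_topology} measure" and k +
  fixes u0 :: "'a \<Rightarrow> real" and u :: "real \<Rightarrow> 'a \<Rightarrow> real" and T :: real
  assumes initial: "in_L2 \<mu> u0" and solution: "cauchy_solution \<mu> L u0 u" and T: "0 < T"
begin

definition m where "m = mean_value \<mu> u0"

text \<open>The exponential absorbs the term -u of L, and K fixes constants, so the equation becomes
  w' = K w.\<close>

definition w :: "real \<Rightarrow> 'a \<Rightarrow> real" where "w t x = exp t * (u t x - m)"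

definition f0 :: "'a \<Rightarrow> real" where "f0 x = u0 x - m"

lemma u_integrable: "0 \<le> t \<Longrightarrow> integrable \<mu> (u t)"
  using solution unfolding cauchy_solution_def by blast

lemma u_continuous: "0 \<le> t \<Longrightarrow> ((\<lambda>r. L1_norm \<mu> (\<lambda>x. u r x - u t x)) \<longlongrightarrow> 0) (at t within {0..})"
  using solution unfolding cauchy_solution_def by blast

lemma u_derivative:
  "0 < t \<Longrightarrow> ((\<lambda>r. L1_norm \<mu> (\<lambda>x. (u r x - u t x) / (r - t) - L (u t) x)) \<longlongrightarrow> 0) (at t)"
  using solution unfolding cauchy_solution_def by blast

lemma u_initial: "AE x in \<mu>. u 0 x = u0 x"
  using solution unfolding cauchy_solution_def by blast

lemma f0_L2: "in_L2 \<mu> f0"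
  unfolding f0_def[abs_def] by (intro L2_diff initial L2_const)

lemma f0_mean: "(\<integral>x. f0 x \<partial>\<mu>) = 0"
  unfolding f0_def m_def mean_value_def using L2_integrable[OF initial] total_pos by simp

lemma w_integrable: "0 \<le> t \<Longrightarrow> integrable \<mu> (w t)"
  unfolding w_def[abs_def] using u_integrable by simp

lemma w_initial: "AE x in \<mu>. w 0 x = f0 x"
  using u_initial by eventually_elim (simp add: w_def f0_def)

lemma bounded_mult_integrable:
  fixes \<psi> :: "'a \<Rightarrow> real"
  assumes \<psi>: "\<psi> \<in> borel_measurable \<mu>" "\<And>x. \<bar>\<psi> x\<bar> \<le> C" and h: "integrable \<mu> h"
  shows "integrable \<mu> (\<lambda>x. \<psi> x * h x)" "\<bar>\<integral>x. \<psi> x * h x \<partial>\<mu>\<bar> \<le> C * L1_norm \<mu> h"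
proof -
  have pw: "\<bar>\<psi> x * h x\<bar> \<le> C * \<bar>h x\<bar>" for x
    using \<psi>(2)[of x] by (simp add: abs_mult mult_right_mono)
  show int: "integrable \<mu> (\<lambda>x. \<psi> x * h x)"
  proof (rule Bochner_Integration.integrable_bound)
    show "integrable \<mu> (\<lambda>x. C * \<bar>h x\<bar>)" using h by simp
    show "(\<lambda>x. \<psi> x * h x) \<in> borel_measurable \<mu>" using \<psi>(1) h by (intro borel_measurable_times) auto
    show "AE x in \<mu>. norm (\<psi> x * h x) \<le> norm (C * \<bar>h x\<bar>)"
      using order_trans[OF pw abs_ge_self] by simp
  qed
  have "\<bar>\<integral>x. \<psi> x * h x \<partial>\<mu>\<bar> \<le> (\<integral>x. \<bar>\<psi> x * h x\<bar> \<partial>\<mu>)"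
    using integral_norm_bound[of \<mu> "\<lambda>x. \<psi> x * h x"] by simp
  also have "\<dots> \<le> (\<integral>x. C * \<bar>h x\<bar> \<partial>\<mu>)"
    using int h pw by (intro integral_mono) auto
  finally show "\<bar>\<integral>x. \<psi> x * h x \<partial>\<mu>\<bar> \<le> C * L1_norm \<mu> h" by (simp add: L1_norm_def)
qed

lemma kop_w: "0 \<le> t \<Longrightarrow> kop k (w t) x = exp t * (kop k (u t) x - m)"
  unfolding w_def[abs_def] kop_scale
  using kop_diff[OF kernel u_integrable[of t], of "\<lambda>_. m"] by (simp add: kop_const)

text \<open>Testing against bounded functions reduces the \<open>L\<^sup>1\<close>-valued equation to scalar ones.\<close>

lemma
  fixes \<psi> :: "'a \<Rightarrow> real"
  assumes \<psi>: "\<psi> \<in> borel_measurable \<mu>" "\<And>x. \<bar>\<psi> x\<bar> \<le> C"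
  shows test_continuous: "continuous_on {0..} (\<lambda>t. \<integral>x. \<psi> x * w t x \<partial>\<mu>)"
    and test_derivative: "0 < t \<Longrightarrow>
      ((\<lambda>t. \<integral>x. \<psi> x * w t x \<partial>\<mu>) has_real_derivative (\<integral>x. \<psi> x * kop k (w t) x \<partial>\<mu>)) (at t)"
proof -
  note int = bounded_mult_integrable(1)[OF \<psi>] and bd = bounded_mult_integrable(2)[OF \<psi>]
  define a where "a = (\<lambda>t. \<integral>x. \<psi> x * u t x \<partial>\<mu>)"
  define p where "p = (\<integral>x. \<psi> x \<partial>\<mu>)"
  have \<psi>i: "integrable \<mu> \<psi>" using int[of "\<lambda>_. 1"] by simp
  have w_eq: "(\<integral>x. \<psi> x * w t x \<partial>\<mu>) = exp t * (a t - m * p)" if "0 \<le> t" for t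
  proof -
    have "(\<integral>x. \<psi> x * w t x \<partial>\<mu>) = (\<integral>x. exp t * (\<psi> x * u t x - m * \<psi> x) \<partial>\<mu>)"
      unfolding w_def by (simp add: algebra_simps)
    also have "\<dots> = exp t * (a t - m * p)"
      using int[OF u_integrable[OF that]] \<psi>i by (simp add: a_def p_def)
    finally show ?thesis .
  qed
  have a_diff: "a r - a t = (\<integral>x. \<psi> x * (u r x - u t x) \<partial>\<mu>)" if "0 \<le> r" "0 \<le> t" for r t
    unfolding a_def right_diff_distrib
    by (rule Bochner_Integration.integral_diff[symmetric]) (intro int u_integrable that)+
  have "continuous_on {0..} a"
    unfolding continuous_on
  proof
    fix t :: real assume "t \<in> {0..}"
    then have t: "0 \<le> t" by simp
    show "(a \<longlongrightarrow> a t) (at t within {0..})"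
    proof (rule LIM_zero_cancel, rule Lim_null_comparison)
      show "((\<lambda>r. C * L1_norm \<mu> (\<lambda>x. u r x - u t x)) \<longlongrightarrow> 0) (at t within {0..})"
        by (rule tendsto_mult_right_zero[OF u_continuous[OF t]])
      show "\<forall>\<^sub>F r in at t within {0..}. norm (a r - a t) \<le> C * L1_norm \<mu> (\<lambda>x. u r x - u t x)"
        unfolding eventually_at_filter
        using a_diff[OF _ t] bd u_integrable t by (intro always_eventually) auto
    qed
  qed
  then have "continuous_on {0..} (\<lambda>t. exp t * (a t - m * p))" by (intro continuous_intros)
  then show "continuous_on {0..} (\<lambda>t. \<integral>x. \<psi> x * w t x \<partial>\<mu>)"
    by (rule continuous_on_eq) (simp add: w_eq)
  show "((\<lambda>t. \<integral>x. \<psi> x * w t x \<partial>\<mu>) has_real_derivative (\<integral>x. \<psi> x * kop k (w t) x \<partial>\<mu>)) (at t)"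
    if t: "0 < t" for t
  proof -
    have t0: "0 \<le> t" using t by simp
    define b where "b = (\<integral>x. \<psi> x * L (u t) x \<partial>\<mu>)"
    have ki: "integrable \<mu> (kop k (u t))"
      by (intro continuous_imp_integrable kop_continuous kernel u_integrable t0)
    have Li: "integrable \<mu> (L (u t))" using ki u_integrable[OF t0] by simp
    \<comment> \<open>Integrability of \<open>u r\<close> is known for nonnegative times
      only.\<close>
    have pos: "\<forall>\<^sub>F r in at t. 0 < r"
      using t by (intro eventually_at_topological[THEN iffD2] exI[of _ "{0<..}"]) auto
    have da: "(a has_real_derivative b) (at t)"
      unfolding has_field_derivative_iff
    proof (rule LIM_zero_cancel, rule Lim_null_comparison)
      show "((\<lambda>r. C * L1_norm \<mu> (\<lambda>x. (u r x - u t x) / (r - t) - L (u t) x)) \<longlongrightarrow> 0) (at t)"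
        by (rule tendsto_mult_right_zero[OF u_derivative[OF t]])
      show "\<forall>\<^sub>F r in at t. norm ((a r - a t) / (r - t) - b)
          \<le> C * L1_norm \<mu> (\<lambda>x. (u r x - u t x) / (r - t) - L (u t) x)"
        using pos
      proof eventually_elim
        case (elim r)
        have ri: "integrable \<mu> (\<lambda>x. (u r x - u t x) / (r - t))"
          using u_integrable[of r] u_integrable[OF t0] elim by simp
        have "(a r - a t) / (r - t) - b
            = (\<integral>x. \<psi> x * (u r x - u t x) / (r - t) \<partial>\<mu>) - (\<integral>x. \<psi> x * L (u t) x \<partial>\<mu>)"
          using elim t0 by (simp add: a_diff b_def)
        also have "\<dots> = (\<integral>x. \<psi> x * ((u r x - u t x) / (r - t)) - \<psi> x * L (u t) x \<partial>\<mu>)"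
          using int[OF ri] int[OF Li] by (subst Bochner_Integration.integral_diff) simp_all
        also have "\<dots> = (\<integral>x. \<psi> x * ((u r x - u t x) / (r - t) - L (u t) x) \<partial>\<mu>)"
          by (simp only: right_diff_distrib)
        finally show ?case
          using bd[OF Bochner_Integration.integrable_diff[OF ri Li]] by simp
      qed
    qed
    have "(\<integral>x. \<psi> x * kop k (w t) x \<partial>\<mu>) = (\<integral>x. exp t * (\<psi> x * kop k (u t) x - m * \<psi> x) \<partial>\<mu>)"
      unfolding kop_w[OF t0] by (simp add: algebra_simps)
    also have "\<dots> = exp t * ((\<integral>x. \<psi> x * kop k (u t) x \<partial>\<mu>) - m * p)"
      using int[OF ki] \<psi>i by (simp add: p_def)
    \<comment> \<open>K is L plus the identity.\<close>
    also have "(\<integral>x. \<psi> x * kop k (u t) x \<partial>\<mu>) = b + a t"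
      unfolding b_def a_def right_diff_distrib using int[OF ki] int[OF u_integrable[OF t0]]
      by (simp add: Bochner_Integration.integral_diff)
    finally have eq: "(\<integral>x. \<psi> x * kop k (w t) x \<partial>\<mu>) = exp t * (a t - m * p) + b * exp t"
      by (simp add: algebra_simps)
    have "((\<lambda>t. exp t * (a t - m * p)) has_real_derivative (\<integral>x. \<psi> x * kop k (w t) x \<partial>\<mu>)) (at t)"
      unfolding eq by (auto intro!: derivative_eq_intros da)
    then show ?thesis
      by (rule has_field_derivative_transform_within_open[of _ _ _ "{0<..}"]) (use t w_eq in auto)
  qed
qed

text \<open>Continuity in L1 makes the norm continuous in time, hence bounded on the compact
  interval \<open>{0..T}\<close>.\<close>

lemma w_L1_bounded: obtains D where "0 < D" "\<And>t. t \<in> {0..T} \<Longrightarrow> (\<integral>x. \<bar>w t x\<bar> \<partial>\<mu>) \<le> D"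
proof -
  define n where "n = (\<lambda>t. \<integral>x. \<bar>u t x\<bar> \<partial>\<mu>)"
  have "continuous_on {0..} n"
    unfolding continuous_on
  proof
    fix t :: real assume "t \<in> {0..}"
    then have t: "0 \<le> t" by simp
    have "norm (n r - n t) \<le> L1_norm \<mu> (\<lambda>x. u r x - u t x)" if r: "0 \<le> r" for r
    proof -
      have "n r - n t = (\<integral>x. \<bar>u r x\<bar> - \<bar>u t x\<bar> \<partial>\<mu>)"
        unfolding n_def using u_integrable r t by simp
      also have "\<bar>\<dots>\<bar> \<le> (\<integral>x. \<bar>\<bar>u r x\<bar> - \<bar>u t x\<bar>\<bar> \<partial>\<mu>)"
        using integral_norm_bound[of \<mu> "\<lambda>x. \<bar>u r x\<bar> - \<bar>u t x\<bar>"] by simp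
      also have "\<dots> \<le> (\<integral>x. \<bar>u r x - u t x\<bar> \<partial>\<mu>)"
        using u_integrable r t by (intro integral_mono) auto
      finally show ?thesis by (simp add: L1_norm_def)
    qed
    then have "\<forall>\<^sub>F r in at t within {0..}. norm (n r - n t) \<le> L1_norm \<mu> (\<lambda>x. u r x - u t x)"
      unfolding eventually_at_filter by (intro always_eventually) auto
    then show "(n \<longlongrightarrow> n t) (at t within {0..})"
      by (intro LIM_zero_cancel[OF Lim_null_comparison[OF _ u_continuous[OF t]]])
  qed
  then have "continuous_on {0..T} n" by (rule continuous_on_subset) auto
  then have "bounded (n ` {0..T})" by (intro compact_imp_bounded compact_continuous_image) auto
  then obtain E where E: "0 < E" "\<And>t. t \<in> {0..T} \<Longrightarrow> \<bar>n t\<bar> \<le> E" unfolding bounded_pos by auto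
  show thesis
  proof
    let ?D = "exp T * (E + \<bar>m\<bar> * measure \<mu> UNIV)"
    show "0 < ?D" using E(1) by (intro mult_pos_pos add_pos_nonneg) auto
    fix t assume t: "t \<in> {0..T}"
    have "(\<integral>x. \<bar>w t x\<bar> \<partial>\<mu>) \<le> (\<integral>x. exp T * (\<bar>u t x\<bar> + \<bar>m\<bar>) \<partial>\<mu>)"
    proof (rule integral_mono)
      show "integrable \<mu> (\<lambda>x. \<bar>w t x\<bar>)" using w_integrable t by simp
      show "integrable \<mu> (\<lambda>x. exp T * (\<bar>u t x\<bar> + \<bar>m\<bar>))" using u_integrable t by simp
      show "\<bar>w t x\<bar> \<le> exp T * (\<bar>u t x\<bar> + \<bar>m\<bar>)" for x
        unfolding w_def abs_mult using t by (intro mult_mono) auto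
    qed
    also have "\<dots> = exp T * (n t + \<bar>m\<bar> * measure \<mu> UNIV)"
      using u_integrable t by (simp add: n_def mult.commute)
    also have "\<dots> \<le> ?D" using E(2)[OF t] by simp
    finally show "(\<integral>x. \<bar>w t x\<bar> \<partial>\<mu>) \<le> ?D" .
  qed
qed

text \<open>The candidate for \<open>w t - f0\<close>: the integrated equation read at each point.
  This is meaningful although \<open>w s\<close> matters only up to null sets, since K turns it into
  a continuous function.\<close>

definition Z :: "real \<Rightarrow> 'a \<Rightarrow> real" where "Z t x = integral {0..t} (\<lambda>s. kop k (w s) x)"

text \<open>The row \<open>k x\<close> is itself a bounded test function.\<close>

lemma kop_w_continuous_time: "continuous_on {0..} (\<lambda>s. kop k (w s) x)"
proof -
  obtain B where "\<And>x y. \<bar>k x y\<bar> \<le> B" using kernel_bounded[OF kernel] by metis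
  then show ?thesis
    unfolding kop_def
    by (intro test_continuous continuous_imp_measurable kernel_continuous kernel)
qed

lemma Z_derivative:
  assumes "t \<in> {0..T}"
  shows "((\<lambda>t. Z t x) has_real_derivative kop k (w t) x) (at t within {0..T})"
  unfolding Z_def
  by (rule integral_has_real_derivative[OF continuous_on_subset[OF kop_w_continuous_time] assms]) auto

lemma Z_0 [simp]: "Z 0 x = 0"
  unfolding Z_def by simp

text \<open>The constant is the bound of the kernel times the bound of the L1 norm, so it is uniform
  in \<open>x\<close>. It supplies the dominating functions for differentiating integrals in
  time.\<close>

lemma Z_lipschitz:
  obtains D where "0 < D"
    "\<And>r t x. r \<in> {0..T} \<Longrightarrow> t \<in> {0..T} \<Longrightarrow> \<bar>Z r x - Z t x\<bar> \<le> D * \<bar>r - t\<bar>"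
proof -
  obtain B where B: "0 < B" "\<And>x y. \<bar>k x y\<bar> \<le> B" using kernel_bounded[OF kernel] by metis
  obtain E where E: "0 < E" "\<And>t. t \<in> {0..T} \<Longrightarrow> (\<integral>x. \<bar>w t x\<bar> \<partial>\<mu>) \<le> E" using w_L1_bounded by metis
  have bd: "norm (kop k (w t) x) \<le> B * E" if "t \<in> {0..T}" for t x
  proof -
    have "\<bar>kop k (w t) x\<bar> \<le> B * (\<integral>x. \<bar>w t x\<bar> \<partial>\<mu>)"
      using kop_bound[OF B(2) kernel w_integrable] that by simp
    also have "\<dots> \<le> B * E" using E(2)[OF that] B(1) by simp
    finally show ?thesis by simp
  qed
  show thesis
  proof
    show "0 < B * E" using B(1) E(1) by simp
    fix r t x assume rt: "r \<in> {0..T}" "t \<in> {0..T}"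
    show "\<bar>Z r x - Z t x\<bar> \<le> (B * E) * \<bar>r - t\<bar>"
      using field_differentiable_bound[OF convex_real_interval(5) Z_derivative bd rt] by simp
  qed
qed

lemma Z_continuous:
  assumes t: "t \<in> {0..T}"
  shows "continuous_on UNIV (Z t)"
  unfolding continuous_on_eq_continuous_at[OF open_UNIV] continuous_at tendsto_iff
proof (intro ballI allI impI)
  fix x and e :: real assume "0 < e"
  obtain E where E: "0 < E" "\<And>t. t \<in> {0..T} \<Longrightarrow> (\<integral>x. \<bar>w t x\<bar> \<partial>\<mu>) \<le> E" using w_L1_bounded by metis
  \<comment> \<open>Chosen so that \<open>c * E * T\<close> is \<open>e / 2\<close>.\<close>
  define c where "c = e / (2 * E * T)"
  have c: "0 < c" using \<open>0 < e\<close> E(1) T by (simp add: c_def)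
  obtain W where W: "open W" "x \<in> W" "\<And>x' y. x' \<in> W \<Longrightarrow> \<bar>k x' y - k x y\<bar> \<le> c"
    using kernel_equicontinuous[OF kernel c] by metis
  have cont: "continuous_on {0..t} (\<lambda>s. kop k (w s) x)" for x
    by (rule continuous_on_subset[OF kop_w_continuous_time]) auto
  have "dist (Z t x') (Z t x) < e" if x': "x' \<in> W" for x'
  proof -
    have "Z t x' - Z t x = integral {0..t} (\<lambda>s. kop k (w s) x' - kop k (w s) x)"
      unfolding Z_def
      by (rule Henstock_Kurzweil_Integration.integral_diff[symmetric]) (intro integrable_continuous_real cont)+
    also have "norm \<dots> \<le> (c * E) * (t - 0)"
    proof (rule integral_bound)
      show "continuous_on {0..t} (\<lambda>s. kop k (w s) x' - kop k (w s) x)"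
        by (intro continuous_intros cont)
      fix s assume s: "s \<in> {0..t}"
      have "\<bar>kop k (w s) x' - kop k (w s) x\<bar> \<le> c * (\<integral>x. \<bar>w s x\<bar> \<partial>\<mu>)"
        using kop_equicontinuous[OF W(3)[OF x'] kernel w_integrable] s by simp
      also have "\<dots> \<le> c * E" using E(2)[of s] s t c by simp
      finally show "norm (kop k (w s) x' - kop k (w s) x) \<le> c * E" by simp
    qed (use t in simp)
    also have "\<dots> \<le> (c * E) * T" using t c E(1) by simp
    also have "\<dots> = e / 2" using E(1) T by (simp add: c_def)
    finally show ?thesis using \<open>0 < e\<close> by (simp add: dist_real_def)
  qed
  then show "\<forall>\<^sub>F x' in at x. dist (Z t x') (Z t x) < e"
    using W(1,2) unfolding eventually_at_topological by blast
qed

text \<open>Tested against a fixed bounded function, \<open>w\<close> and \<open>Z\<close> have the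
  same time derivative, so the pairing with \<open>w - f0 - Z\<close> stays at its initial value 0.
  With the sign of that difference at time \<open>t\<close> as test function, the pairing at
  \<open>t\<close> is its L1 norm.\<close>

lemma w_eq:
  assumes t: "t \<in> {0..T}"
  shows "AE x in \<mu>. w t x = f0 x + Z t x"
proof -
  define h where "h = (\<lambda>s x. w s x - f0 x - Z s x)"
  define \<psi> where "\<psi> = (\<lambda>x. sgn (h t x))"
  have Zi: "integrable \<mu> (Z s)" if "s \<in> {0..T}" for s
    by (rule continuous_imp_integrable[OF Z_continuous[OF that]])
  have f0i: "integrable \<mu> f0" by (rule L2_integrable[OF f0_L2])
  have hi: "integrable \<mu> (h s)" if "s \<in> {0..T}" for s
    unfolding h_def using w_integrable[of s] f0i Zi[OF that] that by simp
  have "h t \<in> borel_measurable \<mu>" using hi[OF t] by simp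
  then have "\<psi> \<in> borel_measurable \<mu>" unfolding \<psi>_def by measurable
  moreover have "\<bar>\<psi> x\<bar> \<le> 1" for x unfolding \<psi>_def by (simp add: sgn_if)
  ultimately have \<psi>: "\<psi> \<in> borel_measurable \<mu>" "\<And>x. \<bar>\<psi> x\<bar> \<le> 1" by blast+
  note int = bounded_mult_integrable(1)[OF \<psi>]
  obtain D where D: "0 < D"
    "\<And>r t x. r \<in> {0..T} \<Longrightarrow> t \<in> {0..T} \<Longrightarrow> \<bar>Z r x - Z t x\<bar> \<le> D * \<bar>r - t\<bar>" using Z_lipschitz by metis
  have dZ: "((\<lambda>s. \<integral>x. \<psi> x * Z s x \<partial>\<mu>) has_real_derivative (\<integral>x. \<psi> x * kop k (w s) x \<partial>\<mu>)) (at s within {0..T})"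
    if s: "s \<in> {0..T}" for s
  proof (rule has_real_derivative_integral[where B = "\<lambda>_. D"])
    show "((\<lambda>s. \<psi> x * Z s x) has_real_derivative \<psi> x * kop k (w s) x) (at s within {0..T})" for x
      by (intro DERIV_cmult Z_derivative s)
    show "\<bar>\<psi> x * Z r x - \<psi> x * Z s x\<bar> \<le> D * \<bar>r - s\<bar>" if "r \<in> {0..T}" for r x
    proof -
      have "\<bar>\<psi> x\<bar> * \<bar>Z r x - Z s x\<bar> \<le> 1 * (D * \<bar>r - s\<bar>)"
        using D \<psi>(2) that s by (intro mult_mono) auto
      then show ?thesis by (simp add: abs_mult flip: right_diff_distrib)
    qed
  qed (use s int Zi in auto)
  define \<phi> where "\<phi> = (\<lambda>s. (\<integral>x. \<psi> x * w s x \<partial>\<mu>) - (\<integral>x. \<psi> x * Z s x \<partial>\<mu>))"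
  have "\<phi> t = \<phi> 0"
  proof (rule DERIV_isconst2[OF T])
    have "continuous_on {0..T} (\<lambda>s. \<integral>x. \<psi> x * w s x \<partial>\<mu>)"
      by (rule continuous_on_subset[OF test_continuous[OF \<psi>]]) auto
    moreover have "continuous_on {0..T} (\<lambda>s. \<integral>x. \<psi> x * Z s x \<partial>\<mu>)"
      using DERIV_continuous_on[OF dZ] .
    ultimately show "continuous_on {0..T} \<phi>" unfolding \<phi>_def by (rule continuous_on_diff)
    fix s assume s: "0 < s" "s < T"
    then have "at s within {0..T} = at s" by (intro at_within_interior) auto
    then show "(\<phi> has_real_derivative 0) (at s)"
      unfolding \<phi>_def using DERIV_diff[OF test_derivative[OF \<psi> s(1)], of _ "\<integral>x. \<psi> x * kop k (w s) x \<partial>\<mu>"]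
        dZ[of s] s by fastforce
  qed (use t in auto)
  moreover have "(\<integral>x. \<psi> x * h s x \<partial>\<mu>) = \<phi> s - (\<integral>x. \<psi> x * f0 x \<partial>\<mu>)" if "s \<in> {0..T}" for s
    unfolding h_def \<phi>_def right_diff_distrib
    using int[OF w_integrable[of s]] int[OF f0i] int[OF Zi[OF that]] that by simp
  moreover have "(\<integral>x. \<psi> x * h 0 x \<partial>\<mu>) = 0"
    by (rule integral_eq_zero_AE) (use w_initial in \<open>eventually_elim, simp add: h_def\<close>)
  ultimately have "(\<integral>x. \<psi> x * h t x \<partial>\<mu>) = 0" using t T by simp
  then have "(\<integral>x. \<bar>h t x\<bar> \<partial>\<mu>) = 0" by (simp add: \<psi>_def abs_sgn mult.commute)
  then have "AE x in \<mu>. \<bar>h t x\<bar> = 0"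
    using hi[OF t] by (subst (asm) integral_nonneg_eq_0_iff_AE) auto
  then show ?thesis by eventually_elim (simp add: h_def)
qed

text \<open>The representative of \<open>w t\<close> that is square integrable and differentiable in
  time at every point; the energy estimate is made for it.\<close>

definition y :: "real \<Rightarrow> 'a \<Rightarrow> real" where "y t x = f0 x + Z t x"

lemma y_L2: "t \<in> {0..T} \<Longrightarrow> in_L2 \<mu> (y t)"
  unfolding y_def[abs_def] by (intro L2_add f0_L2 continuous_imp_L2 Z_continuous)

lemma kop_w_eq_kop_y:
  assumes "t \<in> {0..T}"
  shows "kop k (w t) x = kop k (y t) x"
  unfolding kop_def
proof (rule integral_cong_AE)
  note k = continuous_imp_measurable[OF kernel_continuous[OF kernel, of x]]
  have wm: "w t \<in> borel_measurable \<mu>" using w_integrable[of t] assms by simp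
  show "(\<lambda>z. k x z * w t z) \<in> borel_measurable \<mu>" "(\<lambda>z. k x z * y t z) \<in> borel_measurable \<mu>"
    by (intro borel_measurable_times k wm L2_measurable[OF y_L2[OF assms]])+
  show "AE z in \<mu>. k x z * w t z = k x z * y t z"
    using w_eq[OF assms] by eventually_elim (simp add: y_def)
qed

lemma y_derivative:
  assumes "t \<in> {0..T}"
  shows "((\<lambda>t. y t x) has_real_derivative kop k (y t) x) (at t within {0..T})"
proof -
  have "((\<lambda>t. f0 x + Z t x) has_real_derivative 0 + kop k (w t) x) (at t within {0..T})"
    by (intro DERIV_add DERIV_const Z_derivative assms)
  moreover have "(\<lambda>t. y t x) = (\<lambda>t. f0 x + Z t x)" by (simp add: y_def)
  ultimately show ?thesis by (simp add: kop_w_eq_kop_y[OF assms])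
qed

text \<open>K is symmetric and fixes 1, so the integral \<open>P\<close> satisfies
  \<open>P' = P\<close>, and it starts from 0.\<close>

lemma y_mean:
  assumes t: "t \<in> {0..T}"
  shows "(\<integral>x. y t x \<partial>\<mu>) = 0"
proof -
  obtain D where D: "0 < D"
    "\<And>r t x. r \<in> {0..T} \<Longrightarrow> t \<in> {0..T} \<Longrightarrow> \<bar>Z r x - Z t x\<bar> \<le> D * \<bar>r - t\<bar>" using Z_lipschitz by metis
  let ?P = "\<lambda>s. \<integral>x. y s x \<partial>\<mu>"
  have dP: "(?P has_real_derivative ?P s) (at s within {0..T})" if s: "s \<in> {0..T}" for s
  proof -
    have "(?P has_real_derivative (\<integral>x. kop k (y s) x \<partial>\<mu>)) (at s within {0..T})"
    proof (rule has_real_derivative_integral[where B = "\<lambda>_. D"])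
      show "\<bar>y r x - y s x\<bar> \<le> D * \<bar>r - s\<bar>" if "r \<in> {0..T}" for r x
        using D(2)[OF that s, of x] by (simp add: y_def)
    qed (use s y_derivative L2_integrable[OF y_L2] in auto)
    also have "(\<integral>x. kop k (y s) x \<partial>\<mu>) = ?P s"
      using kop_symmetric[OF kernel L2_integrable[OF y_L2[OF s]], of "\<lambda>_. 1"] by (simp add: kop_const ip_def)
    finally show ?thesis .
  qed
  have dE: "((\<lambda>s. ?P s * exp (- s)) has_real_derivative 0) (at s within {0..T})" if "s \<in> {0..T}" for s
    by (rule derivative_eq_intros dP[OF that] refl | simp)+
  have "?P t * exp (- t) = ?P 0 * exp (- 0)"
  proof (rule DERIV_isconst2[OF T, of "\<lambda>s. ?P s * exp (- s)"])
    show "continuous_on {0..T} (\<lambda>s. ?P s * exp (- s))" using DERIV_continuous_on[OF dE] .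
    fix s assume s: "0 < s" "s < T"
    then have "at s within {0..T} = at s" by (intro at_within_interior) auto
    then show "((\<lambda>s. ?P s * exp (- s)) has_real_derivative 0) (at s)" using dE[of s] s by simp
  qed (use t in auto)
  then show ?thesis using f0_mean by (simp add: y_def)
qed

lemma energy_derivative:
  assumes t: "t \<in> {0..T}"
  shows "((\<lambda>t. ip (y t) (y t)) has_real_derivative 2 * ip (kop k (y t)) (y t)) (at t within {0..T})"
proof -
  obtain D where D: "0 < D"
    "\<And>r t x. r \<in> {0..T} \<Longrightarrow> t \<in> {0..T} \<Longrightarrow> \<bar>Z r x - Z t x\<bar> \<le> D * \<bar>r - t\<bar>" using Z_lipschitz by metis
  have Zb: "\<bar>Z s x\<bar> \<le> D * T" if "s \<in> {0..T}" for s x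
  proof -
    have "\<bar>Z s x\<bar> \<le> D * s" using D(2)[OF that, of 0 x] T that by simp
    also have "\<dots> \<le> D * T" using D(1) that by simp
    finally show ?thesis .
  qed
  have "((\<lambda>t. \<integral>x. y t x * y t x \<partial>\<mu>) has_real_derivative (\<integral>x. 2 * (kop k (y t) x * y t x) \<partial>\<mu>)) (at t within {0..T})"
  proof (rule has_real_derivative_integral[where B = "\<lambda>x. D * (2 * \<bar>f0 x\<bar> + 2 * (D * T))"])
    show "((\<lambda>t. y t x * y t x) has_real_derivative 2 * (kop k (y t) x * y t x)) (at t within {0..T})" for x
      by (rule derivative_eq_intros y_derivative[OF t] refl | simp)+
    show "\<bar>y r x * y r x - y t x * y t x\<bar> \<le> D * (2 * \<bar>f0 x\<bar> + 2 * (D * T)) * \<bar>r - t\<bar>"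
      if r: "r \<in> {0..T}" for r x
    proof -
      \<comment> \<open>In the factored difference of squares only \<open>f0\<close> is unbounded,
        and it is integrable.\<close>
      have "y r x * y r x - y t x * y t x = (Z r x - Z t x) * (2 * f0 x + Z r x + Z t x)"
        by (simp add: y_def algebra_simps)
      also have "\<bar>\<dots>\<bar> \<le> (D * \<bar>r - t\<bar>) * (2 * \<bar>f0 x\<bar> + 2 * (D * T))"
        unfolding abs_mult
      proof (rule mult_mono)
        show "\<bar>2 * f0 x + Z r x + Z t x\<bar> \<le> 2 * \<bar>f0 x\<bar> + 2 * (D * T)"
          using Zb[OF r, of x] Zb[OF t, of x] by linarith
      qed (use D r t in auto)
      finally show ?thesis by (simp add: mult_ac)
    qed
    show "integrable \<mu> (\<lambda>x. D * (2 * \<bar>f0 x\<bar> + 2 * (D * T)))"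
      using L2_integrable[OF f0_L2] by simp
  qed (use t y_L2 L2_mult_integrable in auto)
  then show ?thesis by (simp add: ip_def)
qed

text \<open>Gronwall with the integrating factor \<open>exp (- (2 * q * s))\<close>; zero mean of
  \<open>y s\<close> is what admits the bound \<open>q\<close>.\<close>

lemma energy_decay:
  assumes q: "\<And>f. in_L2 \<mu> f \<Longrightarrow> (\<integral>x. f x \<partial>\<mu>) = 0 \<Longrightarrow> ip (kop k f) f \<le> q * ip f f"
    and t: "t \<in> {0..T}"
  shows "ip (y t) (y t) \<le> exp (2 * q * t) * ip f0 f0"
proof -
  define Q where "Q = (\<lambda>s. ip (y s) (y s) * exp (- (2 * q * s)))"
  have dQ: "(Q has_real_derivative (2 * ip (kop k (y s)) (y s) - 2 * q * ip (y s) (y s)) * exp (- (2 * q * s)))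
      (at s within {0..T})" if "s \<in> {0..T}" for s
    unfolding Q_def
    by (rule derivative_eq_intros energy_derivative[OF that] refl | simp add: algebra_simps)+
  have Qc: "continuous_on {0..T} Q" using DERIV_continuous_on[OF dQ] .
  have "Q t \<le> Q 0"
  proof (cases "t = 0")
    case False
    show ?thesis
    proof (rule DERIV_nonpos_imp_decreasing_open[where f = Q])
      show "continuous_on {0..t} Q" by (rule continuous_on_subset[OF Qc]) (use t in auto)
      fix s assume s: "0 < s" "s < t"
      then have sT: "s \<in> {0..T}" and "s \<in> interior {0..T}" using t by auto
      then have "at s within {0..T} = at s" by (intro at_within_interior)
      moreover have "(2 * ip (kop k (y s)) (y s) - 2 * q * ip (y s) (y s)) * exp (- (2 * q * s)) \<le> 0"
        using q[OF y_L2[OF sT] y_mean[OF sT]] by (intro mult_nonpos_nonneg) auto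
      ultimately show "\<exists>l. (Q has_real_derivative l) (at s) \<and> l \<le> 0"
        using dQ[OF sT] by auto
    qed (use t False in auto)
  qed simp
  moreover have "y 0 = f0" by (simp add: y_def fun_eq_iff)
  ultimately have "ip (y t) (y t) * exp (- (2 * q * t)) \<le> ip f0 f0" by (simp add: Q_def)
  then show ?thesis by (simp add: exp_minus field_simps)
qed

lemma solution_decay:
  assumes lam: "first_nonzero_eigenvalue \<mu> L lam" and t: "t \<in> {0..T}"
  shows "in_L2 \<mu> (\<lambda>x. u t x - m)" "L2_norm \<mu> (\<lambda>x. u t x - m) \<le> exp (- lam * t) * L2_norm \<mu> u0"
proof -
  have t0: "0 \<le> t" using t by simp
  have eq: "AE x in \<mu>. u t x - m = exp (- t) * y t x"
    using w_eq[OF t] by eventually_elim (simp add: w_def y_def exp_minus field_simps)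
  have meas: "(\<lambda>x. u t x - m) \<in> borel_measurable \<mu>" using u_integrable[OF t0] by simp
  have eq2: "AE x in \<mu>. (exp (- t) * y t x)\<^sup>2 = (u t x - m)\<^sup>2" using eq by eventually_elim simp
  note yL = L2_scale[OF y_L2[OF t], of "exp (- t)"]
  show "in_L2 \<mu> (\<lambda>x. u t x - m)"
    unfolding in_L2_def
    using integrable_cong_AE_imp[OF L2_square_integrable[OF yL] _ eq2] meas by simp
  have "(\<integral>x. (u t x - m)\<^sup>2 \<partial>\<mu>) = (\<integral>x. (exp (- t) * y t x)\<^sup>2 \<partial>\<mu>)"
    using eq2 meas L2_measurable[OF yL] by (intro integral_cong_AE) auto
  also have "\<dots> = (exp (- t))\<^sup>2 * ip (y t) (y t)" by (simp add: power_mult_distrib ip_self)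
  also have "\<dots> \<le> (exp (- t))\<^sup>2 * (exp (2 * (1 - lam) * t) * ip f0 f0)"
    using energy_decay[OF first_eigenvalue_gap[OF lam] t] by (intro mult_left_mono) auto
  \<comment> \<open>The exponents \<open>-2 * t\<close> and \<open>2 * (1 - lam) * t\<close> add up
    to \<open>-2 * lam * t\<close>.\<close>
  also have "\<dots> = (exp (- lam * t))\<^sup>2 * ip f0 f0"
    by (simp add: power2_eq_square algebra_simps flip: exp_add)
  also have "\<dots> \<le> (exp (- lam * t))\<^sup>2 * ip u0 u0"
  proof (rule mult_left_mono)
    \<comment> \<open>Subtracting the mean is an orthogonal projection: \<open>ip f0 f0\<close>
      equals \<open>ip f0 u0\<close> because \<open>f0\<close> has mean zero, and Cauchy-Schwarz
      shows that the norm does not grow.\<close>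
    have "ip f0 f0 = ip f0 u0 - m * (\<integral>x. f0 x \<partial>\<mu>)"
    proof -
      have "ip f0 f0 = ip f0 (\<lambda>x. u0 x - m)" by (simp add: f0_def[abs_def])
      also have "\<dots> = ip f0 u0 - ip f0 (\<lambda>x. m)" by (rule ip_diff(2)[OF initial L2_const f0_L2])
      finally show ?thesis by (simp add: ip_def)
    qed
    then have "ip f0 f0 = ip f0 u0" by (simp add: f0_mean)
    then have "(ip f0 f0)\<^sup>2 \<le> ip f0 f0 * ip u0 u0"
      using ip_Cauchy_Schwarz[OF f0_L2 initial] by simp
    then show "ip f0 f0 \<le> ip u0 u0"
      using ip_nonneg[of f0] ip_nonneg[of u0] by (cases "ip f0 f0 = 0") (simp_all add: power2_eq_square)
  qed simp
  finally have "sqrt (\<integral>x. (u t x - m)\<^sup>2 \<partial>\<mu>) \<le> sqrt ((exp (- lam * t))\<^sup>2 * ip u0 u0)"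
    by (rule real_sqrt_le_mono)
  then show "L2_norm \<mu> (\<lambda>x. u t x - m) \<le> exp (- lam * t) * L2_norm \<mu> u0"
    by (simp add: L2_norm_def real_sqrt_mult ip_self)
qed

end

section \<open>Invariant kernels on a compact homogeneous manifold\<close>

locale homogeneous_kernel = connected_riemannian A g
  for A :: "('a::{t2_space, second_countable_topology}, 'n::finite) chart set"
    and g :: "('a, 'n) chart \<Rightarrow> 'a \<Rightarrow> real ^ 'n \<Rightarrow> real ^ 'n \<Rightarrow> real" +
  fixes p0 :: 'a and \<tau> :: "'a \<Rightarrow> 'a \<Rightarrow> 'a" and \<mu> :: "'a measure" and J :: "real \<Rightarrow> real"
  assumes comp: "compact (UNIV :: 'a set)"
    and isometries: "\<And>x. riemannian_isometry A g (\<tau> x)"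
    and base_point: "\<And>x. \<tau> x x = p0"
    and borel: "sets \<mu> = sets borel"
    and invariant: "\<And>x. distr \<mu> \<mu> (\<tau> x) = \<mu>"
    and J_nonneg: "\<And>s. 0 \<le> s \<Longrightarrow> 0 \<le> J s"
    and J_normalized: "(\<integral>x. J (d x p0) \<partial>\<mu>) = 1"
    and J_continuous: "continuous_on {0..} J"
    and J_0: "0 < J 0"
begin

abbreviation k where "k \<equiv> \<lambda>x y. J (d x y)"

lemma space_UNIV: "space \<mu> = UNIV"
  using sets_eq_imp_space_eq[OF borel] by simp

lemma \<tau>_continuous: "continuous_on UNIV (\<tau> x)"
proof -
  have "smooth_map A (\<tau> x)"
    using isometries[of x, unfolded riemannian_isometry_def, THEN conjunct2, THEN conjunct1] .
  then show ?thesis by (rule smooth_map_continuous)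
qed

lemma \<tau>_measurable: "\<tau> x \<in> measurable \<mu> \<mu>"
  unfolding measurable_cong_sets[OF borel borel]
  by (rule borel_measurable_continuous_onI[OF \<tau>_continuous])

text \<open>\<open>\<tau> y\<close> is an isometry taking \<open>y\<close> to \<open>p0\<close>, so
  any distance becomes a distance to the base point.\<close>

lemma dist_base: "d (\<tau> y x) p0 = d x y"
  using dist_isometry[OF isometries, of y x y] base_point[of y] by simp

lemma dist_self: "d x x = 0"
proof -
  have "d x x \<le> e" if "0 < e" for e
  proof -
    obtain W where "x \<in> W"
      "\<And>y. y \<in> W \<Longrightarrow> \<exists>\<gamma>. piecewise_C1_curve A \<gamma> \<and> \<gamma> 0 = x \<and> \<gamma> 1 = y \<and> curve_length A g \<gamma> < e"
      using short_curves[OF \<open>0 < e\<close>, of x] by metis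
    then obtain \<gamma> where "piecewise_C1_curve A \<gamma>" "\<gamma> 0 = x" "\<gamma> 1 = x" "curve_length A g \<gamma> < e" by blast
    then show ?thesis using dist_le[of \<gamma>] by simp
  qed
  then show ?thesis using dist_nonneg[of x x] by (meson dense_le dense not_le order_antisym)
qed

lemma k_continuous: "continuous_on UNIV (\<lambda>(x, y). k x y)"
  using continuous_on_compose2[OF J_continuous dist_continuous] dist_nonneg by (auto simp: case_prod_beta)

lemma k_continuous1: "continuous_on UNIV (\<lambda>x. k x y)"
  using continuous_on_compose2[OF k_continuous, of UNIV "\<lambda>x. (x, y)"] by (simp add: continuous_on_Pair)

text \<open>The normalization at \<open>p0\<close> is transported to \<open>y\<close> by
  \<open>\<tau> y\<close>, which preserves the measure.\<close>

lemma integral_k: "(\<integral>x. k x y \<partial>\<mu>) = 1"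
proof -
  have "(\<lambda>x. k x p0) \<in> borel_measurable \<mu>"
    unfolding measurable_cong_sets[OF borel refl] by (rule borel_measurable_continuous_onI[OF k_continuous1])
  then have "(\<integral>x. k x p0 \<partial>distr \<mu> \<mu> (\<tau> y)) = (\<integral>x. k (\<tau> y x) p0 \<partial>\<mu>)"
    by (rule integral_distr[OF \<tau>_measurable])
  then show ?thesis using J_normalized by (simp add: invariant dist_base)
qed

lemma emeasure_\<tau>_vimage:
  assumes "B \<in> sets \<mu>"
  shows "emeasure \<mu> (\<tau> y -` B) = emeasure \<mu> B"
  using emeasure_distr[OF \<tau>_measurable assms, of y] by (simp add: invariant space_UNIV)

lemma open_sets: "open W \<Longrightarrow> W \<in> sets \<mu>"
  by (simp add: borel)

lemma open_cover_translates:
  assumes W: "open W" "p0 \<in> W"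
  obtains Y where "finite Y" "(\<Union>y\<in>Y. \<tau> y -` W) = UNIV"
proof -
  have "open (\<tau> y -` W)" for y
    using open_vimage[OF W(1) \<tau>_continuous] .
  moreover have "UNIV \<subseteq> (\<Union>y\<in>UNIV. \<tau> y -` W)" using base_point W(2) by blast
  ultimately obtain Y where "finite Y" "UNIV \<subseteq> (\<Union>y\<in>Y. \<tau> y -` W)"
    using compactE_image[OF comp, of UNIV "\<lambda>y. \<tau> y -` W"] by metis
  then show thesis using that by blast
qed

lemma emeasure_UNIV_le:
  assumes "finite Y" "(\<Union>y\<in>Y. \<tau> y -` W) = UNIV" "open W"
  shows "emeasure \<mu> UNIV \<le> (\<Sum>y\<in>Y. emeasure \<mu> W)"
proof -
  have "open (\<tau> y -` W)" for y
    using open_vimage[OF assms(3) \<tau>_continuous] .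
  then have "emeasure \<mu> (\<Union>y\<in>Y. \<tau> y -` W) \<le> (\<Sum>y\<in>Y. emeasure \<mu> (\<tau> y -` W))"
    using assms(1) open_sets by (intro emeasure_subadditive_finite) auto
  then show ?thesis using assms(2) emeasure_\<tau>_vimage[OF open_sets[OF assms(3)]] by simp
qed

lemma finite_invariant_measure: "finite_measure \<mu>"
proof
  \<comment> \<open>A neighbourhood of \<open>p0\<close> on which the integrand is bounded below, so
    that Markov's inequality gives it finite measure.\<close>
  define W where "W = {x. J 0 / 2 < k x p0}"
  have "open W" unfolding W_def
    by (intro open_Collect_less continuous_on_const k_continuous1)
  have "p0 \<in> W" using J_0 by (simp add: W_def dist_self)
  \<comment> \<open>The integral is 1 and not the default 0 of a non-integrable function.\<close>
  have int: "integrable \<mu> (\<lambda>x. k x p0)"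
    using J_normalized not_integrable_integral_eq by fastforce
  have "emeasure \<mu> W \<le> emeasure \<mu> {x \<in> space \<mu>. J 0 / 2 \<le> k x p0}"
  proof (rule emeasure_mono)
    have "(\<lambda>x. k x p0) \<in> borel_measurable \<mu>" using int by simp
    then show "{x \<in> space \<mu>. J 0 / 2 \<le> k x p0} \<in> sets \<mu>" by measurable
  qed (auto simp: W_def space_UNIV)
  also have "\<dots> \<le> ennreal (1 / (J 0 / 2) * (\<integral>x. k x p0 \<partial>\<mu>))"
    using int J_0 J_nonneg dist_nonneg by (intro integral_Markov_inequality) auto
  also have "\<dots> < \<infinity>" by simp
  finally have fin: "emeasure \<mu> W < \<infinity>" .
  obtain Y where Y: "finite Y" "(\<Union>y\<in>Y. \<tau> y -` W) = UNIV"
    using open_cover_translates[OF \<open>open W\<close> \<open>p0 \<in> W\<close>] by metis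
  have "emeasure \<mu> UNIV \<le> of_nat (card Y) * emeasure \<mu> W"
    using emeasure_UNIV_le[OF Y \<open>open W\<close>] by simp
  also have "\<dots> < \<infinity>" using fin by (simp add: ennreal_mult_less_top of_nat_less_top)
  finally show "emeasure \<mu> (space \<mu>) \<noteq> \<infinity>" by (simp add: space_UNIV)
qed

text \<open>A null open set around \<open>x\<close> is moved by \<open>\<tau> x\<close> to a null
  neighbourhood of \<open>p0\<close>. Finitely many preimages of that cover the space, so the
  measure would vanish, against the normalization of \<open>J\<close>.\<close>

lemma full_support:
  assumes W: "open W" "W \<noteq> {}"
  shows "emeasure \<mu> W \<noteq> 0"
proof
  assume null: "emeasure \<mu> W = 0"
  obtain x where x: "x \<in> W" using W(2) by blast
  define V where "V = inv (\<tau> x) -` W"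
  have bij: "bij (\<tau> x)" and sm: "smooth_map A (inv (\<tau> x))"
    by (rule isometries[of x, unfolded riemannian_isometry_def, THEN conjunct1]
        isometries[of x, unfolded riemannian_isometry_def, THEN conjunct2, THEN conjunct2, THEN conjunct1])+
  have V: "open V" "p0 \<in> V"
    unfolding V_def using open_vimage[OF W(1) smooth_map_continuous[OF sm]]
      bij x base_point[of x] by (auto simp: inv_f_eq bij_is_inj)
  have "\<tau> x -` V = W" using bij by (auto simp: V_def bij_is_inj)
  then have "emeasure \<mu> V = 0" using emeasure_\<tau>_vimage[OF open_sets[OF V(1)], of x] null by simp
  moreover obtain Y where "finite Y" "(\<Union>y\<in>Y. \<tau> y -` V) = UNIV"
    using open_cover_translates[OF V] by metis
  ultimately have "emeasure \<mu> UNIV = 0" using emeasure_UNIV_le[of Y V] V(1) by simp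
  then have "UNIV \<in> null_sets \<mu>" by (intro null_setsI) (simp_all add: open_sets)
  then have "AE x in \<mu>. k x p0 = 0" by (rule AE_I'[of UNIV]) simp
  then show False using J_normalized integral_eq_zero_AE[of "\<lambda>x. k x p0" \<mu>] by simp
qed

end

sublocale homogeneous_kernel \<subseteq> markov_kernel \<mu> k
proof -
  interpret finite_measure \<mu> by (rule finite_invariant_measure)
  interpret compact_measure_space \<mu> by unfold_locales (rule borel comp)+
  show "markov_kernel \<mu> k"
  proof
    show "sym_kernel k" unfolding sym_kernel_def using k_continuous dist_sym by simp
    \<comment> \<open>\<open>integral_k\<close> integrates over the first argument, on which the
      isometry acts; symmetry passes to the second.\<close>
    show "(\<integral>y. k x y \<partial>\<mu>) = 1" for x using integral_k[of x] by (simp add: dist_sym[of x])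
  qed (use dist_nonneg J_nonneg J_0 full_support conn in \<open>auto simp: dist_self\<close>)
qed

theorem corollary4p1:
  fixes A :: "('a::{t2_space, second_countable_topology}, 'n::finite) chart set"
    and g :: "('a, 'n) chart \<Rightarrow> 'a \<Rightarrow> real ^ 'n \<Rightarrow> real ^ 'n \<Rightarrow> real"
    and p0 :: 'a
    and \<tau> :: "'a \<Rightarrow> 'a \<Rightarrow> 'a"
    and \<mu> :: "'a measure"
    and J :: "real \<Rightarrow> real"
    and s0 lam1 :: real
    and u0 :: "'a \<Rightarrow> real"
    and u :: "real \<Rightarrow> 'a \<Rightarrow> real"
  assumes manifold: "riemannian_manifold A g"
    and compact: "compact (UNIV :: 'a set)"
    and connected: "connected (UNIV :: 'a set)"
    and isometries: "\<And>x. riemannian_isometry A g (\<tau> x)"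
    and base_point: "\<And>x. \<tau> x x = p0"
    and borel_measure: "sets \<mu> = sets borel"
    and invariant: "\<And>x. distr \<mu> \<mu> (\<tau> x) = \<mu>"
    and J_nonneg: "\<And>s. 0 \<le> s \<Longrightarrow> 0 \<le> J s"
    and J_normalized: "(\<integral>x. J (geodesic_dist A g x p0) \<partial>\<mu>) = 1"
    and J_lipschitz: "\<exists>C. lipschitz_on C {0..} J"
    and s0_pos: "0 < s0"
    and J_pos: "\<And>s. 0 \<le> s \<Longrightarrow> s < s0 \<Longrightarrow> 0 < J s"
    and first_eigenvalue:
      "first_nonzero_eigenvalue \<mu> (nonlocal_op \<mu> (geodesic_dist A g) J) lam1"
    and initial: "in_L2 \<mu> u0"
    and solution: "cauchy_solution \<mu> (nonlocal_op \<mu> (geodesic_dist A g) J) u0 u"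
  shows "0 < lam1 \<and>
    (\<forall>t\<ge>0. in_L2 \<mu> (\<lambda>x. u t x - mean_value \<mu> u0) \<and>
       L2_norm \<mu> (\<lambda>x. u t x - mean_value \<mu> u0) \<le> exp (- lam1 * t) * L2_norm \<mu> u0)"
proof -
  have "continuous_on {0..} J" using J_lipschitz lipschitz_on_continuous_on by blast
  then interpret homogeneous_kernel A g p0 \<tau> \<mu> J
    by unfold_locales
       (use assms in \<open>auto intro: less_imp_le\<close>)
  have op: "nonlocal_op \<mu> (geodesic_dist A g) J = L"
    by (intro ext) (simp add: nonlocal_op_def kop_def)
  have "0 < lam1"
    using first_eigenvalue eigenvalue_pos unfolding op first_nonzero_eigenvalue_def by blast
  moreover have "in_L2 \<mu> (\<lambda>x. u t x - mean_value \<mu> u0)"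
    "L2_norm \<mu> (\<lambda>x. u t x - mean_value \<mu> u0) \<le> exp (- lam1 * t) * L2_norm \<mu> u0"
    if t: "0 \<le> t" for t
  proof -
    \<comment> \<open>The horizon \<open>t + 1\<close> is positive even for \<open>t = 0\<close>,
      and \<open>t\<close> lies below it.\<close>
    interpret evolution \<mu> k u0 u "t + 1"
      by unfold_locales (use initial solution t in \<open>simp_all add: op\<close>)
    show "in_L2 \<mu> (\<lambda>x. u t x - mean_value \<mu> u0)"
      "L2_norm \<mu> (\<lambda>x. u t x - mean_value \<mu> u0) \<le> exp (- lam1 * t) * L2_norm \<mu> u0"
      using solution_decay[OF first_eigenvalue[unfolded op], of t] t unfolding m_def by simp_all
  qed
  ultimately show ?thesis by blast
qed

end
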